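(* Let $\alpha\geq -\frac12$ and let $C_\alpha=2(\alpha+1)$ if $\alpha\geq \frac12$ and $C_\alpha=2(\alpha+1)+\frac1{16}$ if $-\frac12\leq\alpha<\frac12$. Then for every real $c>C_\alpha$ and every integer $n\geq 0$ with $n<\frac{c-C_\alpha}{4}$, $$\lambda_n^{\alpha}(c)\;\geq\; 1-\left(\frac{20}{3}\right)c^{\alpha}\,\frac{c^{2n}}{n!}\,e^{-c}.$$
   Context: $J_\alpha$ denotes the Bessel function of the first kind of order $\alpha$, $J_{\alpha}(x)=\sum_{m=0}^{\infty}\frac{(-1)^m}{m!}\frac{(x/2)^{2m+\alpha}}{\Gamma(m+\alpha+1)}$. For $c>0$, the finite Hankel transform operator $\mathcal H_c^{\alpha}$ is the integral operator on $L^2(0,1)$ given by $\mathcal H_c^{\alpha}f(x)=\int_0^1\sqrt{cxy}\,J_\alpha(cxy)f(y)\,dy$. The operator $\mathcal Q_c^{\alpha}=c\,\mathcal H_c^{\alpha}\mathcal H_c^{\alpha}$ is a positive, self-adjoint, compact operator on $L^2(0,1)$. Its infinite, countable sequence of eigenvalues, arranged in decreasing order and counted with multiplicity, is denoted $(\lambda_n^{\alpha}(c))_{n\geq 0}$. *)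

theory Defs
  imports "HOL-Analysis.Analysis"
begin

text \<open>
  Bessel function of the first kind. Only arguments \<open>x > 0\<close> and orders \<open>\<alpha> \<ge> -1/2\<close> are used,
  so \<open>powr\<close> is the genuine real power and no pole of \<open>Gamma\<close> occurs.
\<close>
definition Bessel_J :: "real \<Rightarrow> real \<Rightarrow> real" where
  "Bessel_J \<alpha> x =
     (\<Sum>m. (-1) ^ m / fact m * ((x / 2) powr (2 * real m + \<alpha>) / Gamma (real m + \<alpha> + 1)))"

abbreviation unit_meas :: "real measure" where
  "unit_meas \<equiv> lebesgue_on {0<..<1}"

text \<open>
  \<open>L\<^sup>2(0,1)\<close> is represented by functions; the identification of almost everywhere equal
  functions is made explicit in the notions of eigenspace and dimension below. Real scalars
  suffice, since the kernel is real and symmetric: eigenvalues and multiplicities are the same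
  as over the complex numbers.
\<close>
definition L2_unit :: "(real \<Rightarrow> real) set" where
  "L2_unit = {f. f \<in> borel_measurable unit_meas \<and> integrable unit_meas (\<lambda>x. (f x)\<^sup>2)}"

definition finite_Hankel :: "real \<Rightarrow> real \<Rightarrow> (real \<Rightarrow> real) \<Rightarrow> real \<Rightarrow> real" where
  "finite_Hankel \<alpha> c f x = (LINT y|unit_meas. sqrt (c * x * y) * Bessel_J \<alpha> (c * x * y) * f y)"

definition Q_Hankel :: "real \<Rightarrow> real \<Rightarrow> (real \<Rightarrow> real) \<Rightarrow> real \<Rightarrow> real" where
  "Q_Hankel \<alpha> c f x = c * finite_Hankel \<alpha> c (finite_Hankel \<alpha> c f) x"

definition eigenspace :: "((real \<Rightarrow> real) \<Rightarrow> real \<Rightarrow> real) \<Rightarrow> real \<Rightarrow> (real \<Rightarrow> real) set" where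
  "eigenspace T \<mu> = {f \<in> L2_unit. AE x in unit_meas. T f x = \<mu> * f x}"

text \<open>
  \<open>V\<close>, a set of functions closed under almost everywhere equality, has dimension \<open>d\<close> as a
  subspace of \<open>L\<^sup>2(0,1)\<close>: it has a basis with \<open>d\<close> elements modulo null functions.
\<close>
definition has_dim_AE :: "(real \<Rightarrow> real) set \<Rightarrow> nat \<Rightarrow> bool" where
  "has_dim_AE V d \<longleftrightarrow>
     (\<exists>b :: nat \<Rightarrow> real \<Rightarrow> real.
        (\<forall>i<d. b i \<in> V) \<and>
        (\<forall>a :: nat \<Rightarrow> real. (AE x in unit_meas. (\<Sum>i<d. a i * b i x) = 0) \<longrightarrow> (\<forall>i<d. a i = 0)) \<and>
        (\<forall>f\<in>V. \<exists>a :: nat \<Rightarrow> real. AE x in unit_meas. f x = (\<Sum>i<d. a i * b i x)))"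

text \<open>
  \<open>ev\<close> lists the eigenvalues of \<open>T\<close> on \<open>L\<^sup>2(0,1)\<close> in decreasing order, each repeated according
  to its multiplicity. A real number that is not an eigenvalue has eigenspace of dimension 0,
  hence is not listed. There is at most one such sequence.
\<close>
definition eigenvalue_sequence ::
    "((real \<Rightarrow> real) \<Rightarrow> real \<Rightarrow> real) \<Rightarrow> (nat \<Rightarrow> real) \<Rightarrow> bool" where
  "eigenvalue_sequence T ev \<longleftrightarrow>
     decseq ev \<and>
     (\<forall>\<mu>. finite {n. ev n = \<mu>} \<and> has_dim_AE (eigenspace T \<mu>) (card {n. ev n = \<mu>}))"

definition C_Hankel :: "real \<Rightarrow> real" where
  "C_Hankel \<alpha> = (if \<alpha> \<ge> 1/2 then 2 * (\<alpha> + 1) else 2 * (\<alpha> + 1) + 1/16)"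

end

theory Submission
  imports Defs "HOL-Complex_Analysis.Great_Picard" "HOL-Real_Asymp.Real_Asymp"
begin

text \<open>
  In the variable \<open>t = c x\<^sup>2 / 2\<close> the Hankel transform on the half-line becomes the operator \<open>U\<close> with
  kernel \<open>j(s t)\<close> on \<open>L\<^sup>2(t\<^sup>\<alpha> dt)\<close>, where \<open>J\<^sub>\<alpha>(z) = (z/2)\<^sup>\<alpha> j(z\<^sup>2/4)\<close>, and the finite transform becomes
  \<open>P U P\<close> with \<open>P\<close> the restriction to \<open>t < c/2\<close>. The Laguerre functions \<open>e\<^sup>-\<^sup>t L\<^sub>k(2 t)\<close> are orthogonal
  eigenfunctions of \<open>U\<close> with eigenvalues \<open>(-1)\<^sup>k\<close>. If \<open>\<kappa>\<close> bounds the fraction of the squared norm that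
  a combination of the first \<open>n + 1\<close> of them has beyond \<open>c/2\<close>, then \<open>\<parallel>P U P \<phi>\<parallel>\<^sup>2 \<ge> (1 - 4 \<kappa>) \<parallel>P \<phi>\<parallel>\<^sup>2\<close> on
  their span, because \<open>U\<close> is symmetric and contractive; so \<open>\<lambda>\<^sub>n \<ge> 1 - 4 \<kappa>\<close> by min-max. Since
  \<open>c > 4 n + 2 \<alpha> + 2\<close> lies beyond all zeros, \<open>|L\<^sub>k(t)| \<le> t\<^sup>k / k!\<close> for \<open>t \<ge> c\<close>, which yields
  \<open>\<kappa> \<le> (5/3) c\<^sup>\<alpha> c\<^sup>2\<^sup>n e\<^sup>-\<^sup>c / n!\<close>.
\<close>

section \<open>Min-max for symmetric kernels on the unit interval\<close>

text \<open>The eigenvalues are given only through the dimensions of their eigenspaces. If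
  \<open>ev n\<close> were below 1 - 4 \<kappa>, at most n independent eigenfunctions would belong
  to eigenvalues above that level; power iteration from a trial function orthogonal to them produces
  one more, which is absurd. Contractivity of \<open>U\<close> is the Plancherel inequality for the
  Hankel transform. It is read off from exponentials: \<open>U\<close> sends exp(-s t) to a multiple
  of exp(-t/s), the Gram matrices agree, and truncated Laguerre functions are reached from
  exponentials by polynomial approximation in exp(-t/2). The substitution is scaled so that c enters
  \<open>U\<close> only through the cut at c/2; the finite transform is then c^(-1/2) P U P, and the
  factor c in \<open>Q_Hankel\<close> cancels. The constant 20/3 is 4 * 5/3. The 4 comes from A + B
  + 2 sqrt(A B), where A and B are the energies of \<phi> and U \<phi> beyond c/2, both at most
  \<kappa> times the total. For large n the 5/3 absorbs three losses: a factor below 2 from the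
  incomplete Gamma integral, 16/15 from summing the lower Laguerre polynomials, and the reciprocal
  of a Gamma value.\<close>

definition sq_integrable :: "'a measure \<Rightarrow> ('a \<Rightarrow> real) set" where
  "sq_integrable M = {f. f \<in> borel_measurable M \<and> integrable M (\<lambda>x. (f x)\<^sup>2)}"

lemma L2_unit_eq: "L2_unit = sq_integrable unit_meas"
  by (simp add: L2_unit_def sq_integrable_def)

lemma sq_integrable_mult:
  assumes "f \<in> sq_integrable M" "g \<in> sq_integrable M"
  shows "integrable M (\<lambda>x. f x * g x)"
proof (rule Bochner_Integration.integrable_bound)
  show "integrable M (\<lambda>x. (f x)\<^sup>2 + (g x)\<^sup>2)" using assms by (auto simp: sq_integrable_def)
  show "(\<lambda>x. f x * g x) \<in> borel_measurable M" using assms by (auto simp: sq_integrable_def)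
  have "\<bar>a * b\<bar> \<le> a\<^sup>2 + b\<^sup>2" for a b :: real
  proof -
    have "0 \<le> (\<bar>a\<bar> - \<bar>b\<bar>)\<^sup>2" "0 \<le> a\<^sup>2 + b\<^sup>2" by auto
    then have "2 * \<bar>a * b\<bar> \<le> a\<^sup>2 + b\<^sup>2" by (simp add: power2_eq_square algebra_simps abs_mult)
    then show ?thesis using \<open>0 \<le> a\<^sup>2 + b\<^sup>2\<close> by linarith
  qed
  then show "AE x in M. norm (f x * g x) \<le> norm ((f x)\<^sup>2 + (g x)\<^sup>2)" by simp
qed

lemma sq_integrable_add:
  assumes "f \<in> sq_integrable M" "g \<in> sq_integrable M"
  shows "(\<lambda>x. f x + g x) \<in> sq_integrable M"
proof -
  have "integrable M (\<lambda>x. (f x)\<^sup>2 + (g x)\<^sup>2 + 2 * (f x * g x))"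
    using assms sq_integrable_mult[OF assms] by (auto simp: sq_integrable_def)
  then show ?thesis using assms by (auto simp: sq_integrable_def power2_sum mult.assoc)
qed

lemma sq_integrable_scale:
  assumes "f \<in> sq_integrable M"
  shows "(\<lambda>x. c * f x) \<in> sq_integrable M"
  using assms by (auto simp: sq_integrable_def power_mult_distrib)

lemma sq_integrable_sum:
  assumes "\<And>i. i \<in> I \<Longrightarrow> f i \<in> sq_integrable M"
  shows "(\<lambda>x. \<Sum>i\<in>I. a i * f i x) \<in> sq_integrable M"
  using assms
proof (induction I rule: infinite_finite_induct)
  case (insert i I)
  then show ?case using sq_integrable_add[OF sq_integrable_scale[of "f i" M "a i"]] by auto
qed (auto simp: sq_integrable_def)

lemma sq_integral_nonneg: "0 \<le> (LINT x|M. (f x)\<^sup>2 :: real)"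
  by (rule Bochner_Integration.integral_nonneg) auto

lemma Cauchy_Schwarz_integral:
  assumes "f \<in> sq_integrable M" "g \<in> sq_integrable M"
  shows "(LINT x|M. f x * g x)\<^sup>2 \<le> (LINT x|M. (f x)\<^sup>2) * (LINT x|M. (g x)\<^sup>2)"
proof -
  let ?s = "LINT x|M. (g x)\<^sup>2" let ?t = "LINT x|M. f x * g x" let ?r = "LINT x|M. (f x)\<^sup>2"
  note [simp] = sq_integrable_mult[OF assms]
  have i: "integrable M (\<lambda>x. (f x)\<^sup>2)" "integrable M (\<lambda>x. (g x)\<^sup>2)" using assms by (auto simp: sq_integrable_def)
  \<comment> \<open>The multipliers are chosen so that the expanded square has the discriminant as a
    factor; the case \<open>?s = 0\<close> must then be treated apart, through g = 0 almost
    everywhere.\<close>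
  have "0 \<le> (LINT x|M. (?s * f x - ?t * g x)\<^sup>2)" by (rule sq_integral_nonneg)
  also have "\<dots> = (LINT x|M. ?s\<^sup>2 * (f x)\<^sup>2 + ?t\<^sup>2 * (g x)\<^sup>2 - 2 * ?s * ?t * (f x * g x))"
    by (intro Bochner_Integration.integral_cong refl) (simp add: power2_eq_square algebra_simps)
  also have "\<dots> = ?s\<^sup>2 * ?r + ?t\<^sup>2 * ?s - 2 * ?s * ?t * ?t" using i by simp
  also have "\<dots> = ?s * (?r * ?s - ?t\<^sup>2)" by (simp add: power2_eq_square algebra_simps)
  finally have 1: "0 \<le> ?s * (?r * ?s - ?t\<^sup>2)" .
  show ?thesis
  proof (cases "?s = 0")
    case True
    then have "AE x in M. (g x)\<^sup>2 = 0" using i by (subst (asm) integral_nonneg_eq_0_iff_AE) auto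
    then have "?t = (LINT x|M. 0)" using borel_measurable_integrable[OF sq_integrable_mult[OF assms]]
      by (intro integral_cong_AE) auto
    then show ?thesis by (simp add: sq_integral_nonneg mult_nonneg_nonneg)
  next
    case False
    then have "?s > 0" using sq_integral_nonneg[of M g] by linarith
    then show ?thesis using 1 by (simp add: zero_le_mult_iff)
  qed
qed

text \<open>Gaussian elimination of the last unknown, by induction on the number of equations. In
  the min-max argument the equations are orthogonality conditions.\<close>

lemma underdetermined_system:
  fixes A :: "nat \<Rightarrow> nat \<Rightarrow> real"
  shows "\<exists>a. (\<exists>i\<le>n. a i \<noteq> 0) \<and> (\<forall>j<n. (\<Sum>i\<le>n. a i * A j i) = 0)"
proof (induction n arbitrary: A)
  case 0
  show ?case by (intro exI[of _ "\<lambda>_. 1"]) simp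
next
  case (Suc n)
  show ?case
  proof (cases "\<exists>j<Suc n. A j (Suc n) \<noteq> 0")
    case False
    show ?thesis
    proof (intro exI[of _ "\<lambda>i. if i = Suc n then 1 else 0"] conjI allI impI)
      fix j assume "j < Suc n"
      then have "A j (Suc n) = 0" using False by blast
      moreover have "(\<Sum>i\<le>n. (if i = Suc n then 1 else 0) * A j i) = 0" by (intro sum.neutral) auto
      ultimately show "(\<Sum>i\<le>Suc n. (if i = Suc n then 1 else 0) * A j i) = 0" by simp
    qed auto
  next
    case True
    then obtain p where p: "p < Suc n" "A p (Suc n) \<noteq> 0" by blast
    \<comment> \<open>\<open>s\<close> enumerates the rows other than the pivot row
      \<open>p\<close>, and \<open>B\<close> is the system left after clearing the last column with
      that row.\<close>
    define s where "s = (\<lambda>j. if j < p then j else Suc j)"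
    define B where "B = (\<lambda>j i. A (s j) i - A (s j) (Suc n) / A p (Suc n) * A p i)"
    from Suc[of B] obtain a where a: "\<exists>i\<le>n. a i \<noteq> 0" and aB: "\<forall>j<n. (\<Sum>i\<le>n. a i * B j i) = 0" by blast
    \<comment> \<open>The last coefficient is the one that solves the pivot equation.\<close>
    define a' where "a' = a(Suc n := - (\<Sum>i\<le>n. a i * A p i) / A p (Suc n))"
    have sum: "(\<Sum>i\<le>Suc n. a' i * A j i) = (\<Sum>i\<le>n. a i * A j i) - (\<Sum>i\<le>n. a i * A p i) / A p (Suc n) * A j (Suc n)" for j
    proof -
      have "(\<Sum>i\<le>n. a' i * A j i) = (\<Sum>i\<le>n. a i * A j i)" by (intro sum.cong) (auto simp: a'_def)
      then show ?thesis by (simp add: a'_def)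
    qed
    have "(\<Sum>i\<le>Suc n. a' i * A j i) = 0" if j: "j < Suc n" for j
    proof (cases "j = p")
      case True then show ?thesis using p by (simp only: sum) simp
    next
      case False
      then have "(if j < p then j else j - 1) < n \<and> s (if j < p then j else j - 1) = j"
        using j p by (auto simp: s_def)
      then obtain k where k: "k < n" "s k = j" by blast
      have "(\<Sum>i\<le>n. a i * B k i) = 0" using aB k by blast
      moreover have "(\<Sum>i\<le>n. a i * B k i) = (\<Sum>i\<le>n. a i * A j i) - A j (Suc n) / A p (Suc n) * (\<Sum>i\<le>n. a i * A p i)"
        unfolding B_def k by (simp add: sum_subtractf algebra_simps sum_distrib_left)
      ultimately show ?thesis by (simp only: sum) (simp add: field_simps)
    qed
    moreover have "\<exists>i\<le>Suc n. a' i \<noteq> 0" 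
    proof -
      obtain i where "i \<le> n" "a i \<noteq> 0" using a by blast
      then show ?thesis by (intro exI[of _ i]) (simp add: a'_def)
    qed
    ultimately show ?thesis by blast
  qed
qed

section \<open>Square-integrable functions and integral operators on the unit interval\<close>

lemma finite_measure_unit_meas: "finite_measure unit_meas"
  by (rule finite_measure_lebesgue_on) (simp add: bounded_set_imp_lmeasurable)

interpretation unit_meas: finite_measure unit_meas
  by (rule finite_measure_unit_meas)

lemma space_unit_meas [simp]: "space unit_meas = {0<..<1}" by simp

lemma measure_unit_meas: "measure unit_meas {0<..<1} = 1"
  by (simp add: measure_restrict_space)

lemma measurable_unit_meas_borel: "continuous_on {0..1} (f :: real \<Rightarrow> real) \<Longrightarrow> f \<in> borel_measurable unit_meas"
  by (intro continuous_imp_measurable_on_sets_lebesgue) (auto intro: continuous_on_subset)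

lemma sq_integrable_imp_integrable:
  assumes "f \<in> sq_integrable unit_meas" shows "integrable unit_meas f"
  using sq_integrable_mult[OF assms, of "\<lambda>_. 1"] by (simp add: sq_integrable_def)

lemma sq_integrable_continuous:
  assumes "continuous_on {0..1} (f :: real \<Rightarrow> real)" shows "f \<in> sq_integrable unit_meas"
proof -
  have "bounded (f ` {0..1})" by (intro compact_imp_bounded compact_continuous_image assms) simp
  then obtain B where B: "\<And>x. x \<in> {0..1} \<Longrightarrow> \<bar>f x\<bar> \<le> B" unfolding bounded_iff by fastforce
  have "(f x)\<^sup>2 \<le> B\<^sup>2" if "x \<in> {0<..<1}" for x
    using B[of x] that by (intro abs_le_square_iff[THEN iffD1]) auto
  then show ?thesis unfolding sq_integrable_def using measurable_unit_meas_borel[OF assms]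
    by (auto intro!: unit_meas.integrable_const_bound[where B="B\<^sup>2"])
qed

lemma integral_abs_le_L2_unit:
  assumes "f \<in> sq_integrable unit_meas"
  shows "(LINT x|unit_meas. \<bar>f x\<bar>) \<le> sqrt (LINT x|unit_meas. (f x)\<^sup>2)"
proof -
  have "(\<lambda>x. \<bar>f x\<bar>) \<in> sq_integrable unit_meas" using assms by (auto simp: sq_integrable_def)
  moreover have "(\<lambda>x. 1) \<in> sq_integrable unit_meas" by (simp add: sq_integrable_def)
  ultimately have "(LINT x|unit_meas. \<bar>f x\<bar> * 1)\<^sup>2 \<le> (LINT x|unit_meas. \<bar>f x\<bar>\<^sup>2) * (LINT x|unit_meas. 1\<^sup>2)"
    by (rule Cauchy_Schwarz_integral)
  then have "(LINT x|unit_meas. \<bar>f x\<bar>)\<^sup>2 \<le> (LINT x|unit_meas. (f x)\<^sup>2)" 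
    by (simp add: measure_unit_meas)
  then show ?thesis by (rule real_le_rsqrt)
qed

lemma integral_unit_meas_le:
  assumes "integrable unit_meas f" "\<And>x. x \<in> {0..1} \<Longrightarrow> f x \<le> (C :: real)"
  shows "(LINT x|unit_meas. f x) \<le> C"
proof -
  have "(LINT x|unit_meas. f x) \<le> (LINT x|unit_meas. C)"
    by (rule integral_mono[OF assms(1)]) (auto intro: assms(2))
  then show ?thesis by (simp add: measure_unit_meas)
qed

text \<open>The measure lives on the open interval, but continuity is required on the closed square:
  its compactness makes the kernel bounded and uniformly continuous, which is the source of all
  compactness used below.\<close>

locale symmetric_kernel =
  fixes K :: "real \<Rightarrow> real \<Rightarrow> real"
  assumes continuous_K: "continuous_on ({0..1} \<times> {0..1}) (\<lambda>(x, y). K x y)"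
    and symmetric_K: "K x y = K y x"
begin

definition T :: "(real \<Rightarrow> real) \<Rightarrow> real \<Rightarrow> real" where
  "T f x = (LINT y|unit_meas. K x y * f y)"

lemma bounded_K: obtains B where "B > 0" "\<And>x y. x \<in> {0..1} \<Longrightarrow> y \<in> {0..1} \<Longrightarrow> \<bar>K x y\<bar> \<le> B"
proof -
  have "bounded ((\<lambda>(x, y). K x y) ` ({0..1} \<times> {0..1}))"
    by (intro compact_imp_bounded compact_continuous_image continuous_K compact_Times) simp_all
  then obtain B where "B > 0" "\<forall>z \<in> ((\<lambda>(x, y). K x y) ` ({0..1} \<times> {0..1})). norm z \<le> B"
    unfolding bounded_pos by blast
  then show ?thesis by (intro that[of B]) auto
qed

lemma measurable_K [measurable]: "x \<in> {0..1} \<Longrightarrow> K x \<in> borel_measurable unit_meas"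
proof (rule measurable_unit_meas_borel)
  assume "x \<in> {0..1}"
  then have "continuous_on {0..1} (\<lambda>y. (\<lambda>(x, y). K x y) (x, y))"
    by (intro continuous_on_compose2[OF continuous_K]) (auto intro!: continuous_intros)
  then show "continuous_on {0..1} (K x)" by simp
qed

lemma integrable_K_mult:
  assumes "f \<in> sq_integrable unit_meas" "x \<in> {0..1}"
  shows "integrable unit_meas (\<lambda>y. K x y * f y)"
proof -
  obtain B where "B > 0" and B: "\<And>x y. x \<in> {0..1} \<Longrightarrow> y \<in> {0..1} \<Longrightarrow> \<bar>K x y\<bar> \<le> B" using bounded_K by blast
  have i: "integrable unit_meas f" by (rule sq_integrable_imp_integrable[OF assms(1)])
  show ?thesis
  proof (rule Bochner_Integration.integrable_bound)
    show "integrable unit_meas (\<lambda>y. B * f y)" using i by simp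
    show "(\<lambda>y. K x y * f y) \<in> borel_measurable unit_meas" using measurable_K[OF assms(2)] i by auto
    have "norm (K x y * f y) \<le> norm (B * f y)" if "y \<in> {0<..<1}" for y
      using B[of x y] assms that \<open>B > 0\<close> by (auto simp: abs_mult intro!: mult_right_mono)
    then show "AE y in unit_meas. norm (K x y * f y) \<le> norm (B * f y)" by (intro AE_I2) auto
  qed
qed

lemma T_scale: "T (\<lambda>x. a * f x) x = a * T f x"
  unfolding T_def by (simp add: mult.left_commute)

lemma T_sub:
  assumes "f \<in> sq_integrable unit_meas" "x \<in> {0..1}" "y \<in> {0..1}"
    and "\<And>z. z \<in> {0<..<1} \<Longrightarrow> \<bar>K x z - K y z\<bar> \<le> e" "e \<ge> 0"
  shows "\<bar>T f x - T f y\<bar> \<le> e * sqrt (LINT x|unit_meas. (f x)\<^sup>2)"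
proof -
  have i: "integrable unit_meas f" by (rule sq_integrable_imp_integrable[OF assms(1)])
  have "T f x - T f y = (LINT z|unit_meas. (K x z - K y z) * f z)"
    unfolding T_def using integrable_K_mult[OF assms(1)] assms(2,3)
    by (simp add: left_diff_distrib)
  also have "\<bar>\<dots>\<bar> \<le> (LINT z|unit_meas. e * \<bar>f z\<bar>)"
  proof (rule order.trans[OF integral_abs_bound integral_mono])
    show "integrable unit_meas (\<lambda>z. \<bar>(K x z - K y z) * f z\<bar>)"
      using integrable_K_mult[OF assms(1,2)] integrable_K_mult[OF assms(1,3)] by (auto simp: left_diff_distrib)
  qed (use assms i in \<open>auto simp: abs_mult intro!: mult_right_mono\<close>)
  also have "\<dots> \<le> e * sqrt (LINT x|unit_meas. (f x)\<^sup>2)"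
    using integral_abs_le_L2_unit[OF assms(1)] assms(5) by (auto intro: mult_left_mono)
  finally show ?thesis .
qed

text \<open>The modulus of continuity is that of the kernel and depends on \<open>f\<close> only
  through its norm, so \<open>T\<close> maps the unit ball of L^2 to an equicontinuous family. This
  is the form in which Arzela-Ascoli applies.\<close>

lemma T_equicontinuous:
  assumes "e > 0"
  shows "\<exists>d>0. \<forall>f\<in>sq_integrable unit_meas. \<forall>x\<in>{0..1}. \<forall>y\<in>{0..1}. \<bar>x - y\<bar> < d \<longrightarrow>
     \<bar>T f x - T f y\<bar> \<le> e * sqrt (LINT x|unit_meas. (f x)\<^sup>2)"
proof -
  have "uniformly_continuous_on ({0..1} \<times> {0..1}) (\<lambda>(x, y). K x y)"
    by (intro compact_uniformly_continuous continuous_K compact_Times) simp_all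
  then have "\<exists>d>0. \<forall>p\<in>{0..1} \<times> {0..1}. \<forall>q\<in>{0..1} \<times> {0..1}. dist q p < d \<longrightarrow>
      dist ((\<lambda>(x, y). K x y) q) ((\<lambda>(x, y). K x y) p) < e"
    unfolding uniformly_continuous_on_def using assms by simp
  then obtain d where d: "d > 0" "\<forall>p\<in>{0..1} \<times> {0..1}. \<forall>q\<in>{0..1} \<times> {0..1}. dist q p < d \<longrightarrow>
      dist ((\<lambda>(x, y). K x y) q) ((\<lambda>(x, y). K x y) p) < e" by blast
  have "\<bar>T f x - T f y\<bar> \<le> e * sqrt (LINT x|unit_meas. (f x)\<^sup>2)"
    if *: "f \<in> sq_integrable unit_meas" "x \<in> {0..1}" "y \<in> {0..1}" "\<bar>x - y\<bar> < d" for f x y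
  proof (rule T_sub[OF *(1-3)])
    fix z :: real assume z: "z \<in> {0<..<1}"
    have "dist (x, z) (y, z) < d" using *(4) by (simp add: dist_Pair_Pair dist_real_def)
    then have "dist (K x z) (K y z) < e" using d(2) * z by fastforce
    then show "\<bar>K x z - K y z\<bar> \<le> e" by (simp add: dist_real_def)
  qed (use assms in simp)
  then show ?thesis using d(1) by blast
qed

lemma continuous_T:
  assumes "f \<in> sq_integrable unit_meas"
  shows "continuous_on {0..1} (T f)"
  unfolding continuous_on_iff
proof safe
  fix x e :: real assume x: "x \<in> {0..1}" and "e > 0"
  let ?n = "sqrt (LINT x|unit_meas. (f x)\<^sup>2)"
  have n: "?n \<ge> 0" by (simp add: sq_integral_nonneg)
  \<comment> \<open>The norm \<open>?n\<close> may vanish, hence the added 1.\<close>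
  have "e / (?n + 1) > 0" using n \<open>e > 0\<close> by (intro divide_pos_pos) linarith+
  then obtain d where d: "d > 0" "\<forall>f\<in>sq_integrable unit_meas. \<forall>x\<in>{0..1}. \<forall>y\<in>{0..1}. \<bar>x - y\<bar> < d \<longrightarrow>
     \<bar>T f x - T f y\<bar> \<le> e / (?n + 1) * sqrt (LINT x|unit_meas. (f x)\<^sup>2)" using T_equicontinuous by blast
  have "e / (?n + 1) * ?n < e"
  proof -
    have "e * ?n / (?n + 1) < e" using n \<open>e > 0\<close> by (subst pos_divide_less_eq) (linarith, simp add: algebra_simps)
    then show ?thesis by simp
  qed
  then show "\<exists>d>0. \<forall>x'\<in>{0..1}. dist x' x < d \<longrightarrow> dist (T f x') (T f x) < e"
    using d(1) d(2)[rule_format, OF assms _ x] unfolding dist_real_def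
    by (intro exI[of _ d] conjI ballI impI) (blast intro: le_less_trans)+
qed

lemma sq_integrable_T: "f \<in> sq_integrable unit_meas \<Longrightarrow> T f \<in> sq_integrable unit_meas"
  by (rule sq_integrable_continuous[OF continuous_T])

lemma T_bound:
  assumes "B > 0" "\<And>x y. x \<in> {0..1} \<Longrightarrow> y \<in> {0..1} \<Longrightarrow> \<bar>K x y\<bar> \<le> B"
    "f \<in> sq_integrable unit_meas" "x \<in> {0..1}"
  shows "\<bar>T f x\<bar> \<le> B * sqrt (LINT x|unit_meas. (f x)\<^sup>2)"
proof -
  have i: "integrable unit_meas f" by (rule sq_integrable_imp_integrable[OF assms(3)])
  have "\<bar>T f x\<bar> \<le> (LINT z|unit_meas. B * \<bar>f z\<bar>)" unfolding T_def
  proof (rule order.trans[OF integral_abs_bound integral_mono])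
    show "integrable unit_meas (\<lambda>z. \<bar>K x z * f z\<bar>)"
      using integrable_K_mult[OF assms(3,4)] by auto
  qed (use assms i in \<open>auto simp: abs_mult intro!: mult_right_mono\<close>)
  also have "\<dots> \<le> B * sqrt (LINT x|unit_meas. (f x)\<^sup>2)"
    using integral_abs_le_L2_unit[OF assms(3)] assms(1) by (auto intro: mult_left_mono)
  finally show ?thesis .
qed

lemma T_symmetric:
  assumes "f \<in> sq_integrable unit_meas" "g \<in> sq_integrable unit_meas"
  shows "(LINT x|unit_meas. T f x * g x) = (LINT x|unit_meas. f x * T g x)"
proof -
  interpret P: pair_sigma_finite unit_meas unit_meas ..
  obtain B where "B > 0" and B: "\<And>x y. x \<in> {0..1} \<Longrightarrow> y \<in> {0..1} \<Longrightarrow> \<bar>K x y\<bar> \<le> B" using bounded_K by blast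
  note i = sq_integrable_imp_integrable[OF assms(1)] sq_integrable_imp_integrable[OF assms(2)]
  have [measurable]: "f \<in> borel_measurable unit_meas" "g \<in> borel_measurable unit_meas" using i by auto
  \<comment> \<open>Extension by zero off the closed square makes the kernel Borel measurable on the
    whole plane; measurability on the product of the two restricted Lebesgue measures is then a
    composition.\<close>
  define K' where "K' = (\<lambda>p. indicator ({0..1} \<times> {0..1}) p *\<^sub>R (\<lambda>(x, y). K x y) p)"
  have K': "K' (x, y) = K x y" if "x \<in> {0<..<1}" "y \<in> {0<..<1}" for x y
    using that by (simp add: K'_def)
  have "K' \<in> borel_measurable borel" unfolding K'_def
    by (intro borel_measurable_continuous_on_indicator continuous_K) (simp add: borel_closed closed_Times)
  then have K'm: "K' \<in> borel_measurable (borel \<Otimes>\<^sub>M borel)" by (simp add: borel_prod)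
  have idm [measurable]: "(\<lambda>x. x) \<in> unit_meas \<rightarrow>\<^sub>M (borel :: real measure)"
    by (rule measurable_unit_meas_borel) simp
  have [measurable]: "K' \<in> borel_measurable (unit_meas \<Otimes>\<^sub>M unit_meas)"
  proof -
    have "(\<lambda>p. (fst p, snd p)) \<in> (unit_meas \<Otimes>\<^sub>M unit_meas) \<rightarrow>\<^sub>M (borel \<Otimes>\<^sub>M (borel :: real measure))"
      using idm by measurable
    from measurable_compose[OF this K'm] show ?thesis by simp
  qed
  have I: "integrable (unit_meas \<Otimes>\<^sub>M unit_meas) (\<lambda>(x, y). g x * K' (x, y) * f y)"
  proof (rule Bochner_Integration.integrable_bound)
    have "integrable (unit_meas \<Otimes>\<^sub>M unit_meas) (\<lambda>(x, y). g x * f y)"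
    proof (rule P.Fubini_integrable)
      show "integrable unit_meas (\<lambda>x. LINT y|unit_meas. norm (case (x, y) of (x, y) \<Rightarrow> g x * f y))"
        using i by (simp add: abs_mult)
      show "AE x in unit_meas. integrable unit_meas (\<lambda>y. case (x, y) of (x, y) \<Rightarrow> g x * f y)"
        using i by simp
    qed simp
    then show "integrable (unit_meas \<Otimes>\<^sub>M unit_meas) (\<lambda>p. B * (\<lambda>(x, y). g x * f y) p)" by simp
    show "AE p in unit_meas \<Otimes>\<^sub>M unit_meas. norm (case p of (x, y) \<Rightarrow> g x * K' (x, y) * f y)
        \<le> norm (B * (case p of (x, y) \<Rightarrow> g x * f y))"
    proof (intro AE_I2, clarsimp simp: space_pair_measure K' abs_mult)
      fix x y :: real assume "0 < x" "x < 1" "0 < y" "y < 1"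
      then have "\<bar>K x y\<bar> * (\<bar>g x\<bar> * \<bar>f y\<bar>) \<le> \<bar>B\<bar> * (\<bar>g x\<bar> * \<bar>f y\<bar>)" using B[of x y] \<open>B > 0\<close> by (intro mult_right_mono) auto
      then show "\<bar>g x\<bar> * \<bar>K x y\<bar> * \<bar>f y\<bar> \<le> \<bar>B\<bar> * (\<bar>g x\<bar> * \<bar>f y\<bar>)" by (simp add: mult_ac)
    qed
  qed simp
  have 1: "(LINT y|unit_meas. g x * K' (x, y) * f y) = T f x * g x" if "x \<in> {0<..<1}" for x
  proof -
    have "(LINT y|unit_meas. g x * K' (x, y) * f y) = (LINT y|unit_meas. g x * (K x y * f y))"
      using that by (intro Bochner_Integration.integral_cong refl) (simp add: K')
    then show ?thesis by (simp add: T_def)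
  qed
  have 2: "(LINT x|unit_meas. g x * K' (x, y) * f y) = f y * T g y" if "y \<in> {0<..<1}" for y
  proof -
    have "(LINT x|unit_meas. g x * K' (x, y) * f y) = (LINT x|unit_meas. f y * (K y x * g x))"
      using that by (intro Bochner_Integration.integral_cong refl) (simp add: K' symmetric_K[of y])
    then show ?thesis by (simp add: T_def)
  qed
  have "(LINT x|unit_meas. T f x * g x) = (LINT x|unit_meas. LINT y|unit_meas. g x * K' (x, y) * f y)"
    by (intro Bochner_Integration.integral_cong refl 1[symmetric]) (simp only: space_unit_meas)
  also have "\<dots> = (LINT y|unit_meas. LINT x|unit_meas. g x * K' (x, y) * f y)"
    using P.Fubini_integral[of "\<lambda>x y. g x * K' (x, y) * f y"] I by simp
  also have "\<dots> = (LINT y|unit_meas. f y * T g y)"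
    by (intro Bochner_Integration.integral_cong refl 2) (simp only: space_unit_meas)
  finally show ?thesis .
qed

lemma T_limit:
  assumes F: "\<And>k. F k \<in> sq_integrable unit_meas" and g: "g \<in> sq_integrable unit_meas"
    and bound: "\<And>k x. x \<in> {0<..<1} \<Longrightarrow> \<bar>F k x\<bar> \<le> C"
    and lim: "\<And>x. x \<in> {0<..<1} \<Longrightarrow> (\<lambda>k. F k x) \<longlonglongrightarrow> g x"
    and x: "x \<in> {0..1}"
  shows "(\<lambda>k. T (F k) x) \<longlonglongrightarrow> T g x"
  unfolding T_def
proof (rule integral_dominated_convergence[where w="\<lambda>y. \<bar>K x y\<bar> * C"])
  show "(\<lambda>y. K x y * g y) \<in> borel_measurable unit_meas"
    by (rule borel_measurable_integrable[OF integrable_K_mult[OF g x]])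
  show "(\<lambda>y. K x y * F k y) \<in> borel_measurable unit_meas" for k
    by (rule borel_measurable_integrable[OF integrable_K_mult[OF F x]])
  have "(\<lambda>_. 1) \<in> sq_integrable unit_meas" by (simp add: sq_integrable_def)
  from integrable_mult_left[OF integrable_abs[OF integrable_K_mult[OF this x]], of C]
  show "integrable unit_meas (\<lambda>y. \<bar>K x y\<bar> * C)" by simp
  show "AE y in unit_meas. (\<lambda>k. K x y * F k y) \<longlonglongrightarrow> K x y * g y"
    by (intro AE_I2 tendsto_mult_left lim) simp
  show "AE y in unit_meas. norm (K x y * F k y) \<le> \<bar>K x y\<bar> * C" for k
    by (intro AE_I2) (simp add: abs_mult mult_left_mono bound)
qed

lemma integral_limit:
  assumes F: "\<And>k. F k \<in> borel_measurable unit_meas" and g: "g \<in> borel_measurable unit_meas"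
    and h: "integrable unit_meas (h :: real \<Rightarrow> real)"
    and bound: "\<And>k x. x \<in> {0<..<1} \<Longrightarrow> \<bar>F k x\<bar> \<le> C"
    and lim: "\<And>x. x \<in> {0<..<1} \<Longrightarrow> (\<lambda>k. F k x) \<longlonglongrightarrow> g x"
  shows "(\<lambda>k. LINT x|unit_meas. h x * F k x) \<longlonglongrightarrow> (LINT x|unit_meas. h x * g x)"
proof (rule integral_dominated_convergence[where w="\<lambda>y. \<bar>h y\<bar> * C"])
  show "AE y in unit_meas. (\<lambda>k. h y * F k y) \<longlonglongrightarrow> h y * g y"
    by (intro AE_I2 tendsto_mult_left lim) simp
  show "AE y in unit_meas. norm (h y * F k y) \<le> \<bar>h y\<bar> * C" for k
    by (intro AE_I2) (simp add: abs_mult mult_left_mono bound)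
qed (use F g h in auto)

text \<open>
  Power iteration: the quotients of the squared norms of successive iterates increase to the
  square of an eigenvalue, and by equicontinuity the normalised iterates accumulate at an
  eigenfunction.
\<close>
lemma power_iteration_eigenfunction:
  assumes f: "f \<in> sq_integrable unit_meas" and f0: "(LINT x|unit_meas. (f x)\<^sup>2) > 0"
    and t: "(LINT x|unit_meas. (T f x)\<^sup>2) \<ge> t * (LINT x|unit_meas. (f x)\<^sup>2)" "t > 0"
    and W: "\<And>b. b \<in> W \<Longrightarrow> b \<in> sq_integrable unit_meas"
    and W_inv: "\<And>b. b \<in> W \<Longrightarrow> \<exists>m. AE x in unit_meas. T (T b) x = m * b x"
    and orth: "\<And>b. b \<in> W \<Longrightarrow> (LINT x|unit_meas. b x * f x) = 0"
  obtains g m where "g \<in> sq_integrable unit_meas" "m \<ge> t"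
    "AE x in unit_meas. T (T g) x = m * g x" "(LINT x|unit_meas. (g x)\<^sup>2) > 0"
    "\<And>b. b \<in> W \<Longrightarrow> (LINT x|unit_meas. b x * g x) = 0"
proof -
  let ?S = "sq_integrable unit_meas" let ?I = "integral\<^sup>L unit_meas"
  obtain B where "B > 0" and B: "\<And>x y. x \<in> {0..1} \<Longrightarrow> y \<in> {0..1} \<Longrightarrow> \<bar>K x y\<bar> \<le> B" using bounded_K by blast
  define u where "u = (\<lambda>k. (T ^^ k) f)"
  define N where "N = (\<lambda>k. ?I (\<lambda>x. (u k x)\<^sup>2))"
  have u_Suc: "u (Suc k) = T (u k)" for k by (simp add: u_def)
  have uS: "u k \<in> ?S" for k
    by (induction k) (auto simp: u_def f sq_integrable_T)
  have N_sym: "?I (\<lambda>x. u k x * u (Suc (Suc k)) x) = N (Suc k)" for k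
    using T_symmetric[OF uS uS, of k "Suc k"] by (simp add: u_Suc N_def power2_eq_square)
  \<comment> \<open>Symmetry makes the inner product of iterates two apart equal to the squared norm
    of the one between, so Cauchy-Schwarz becomes log-convexity of \<open>N\<close>, and the
    quotients \<open>q\<close> increase.\<close>
  have N_logconvex: "(N (Suc k))\<^sup>2 \<le> N k * N (Suc (Suc k))" for k
    using Cauchy_Schwarz_integral[OF uS uS, of k "Suc (Suc k)"] unfolding N_sym by (simp add: N_def)
  have N_nonneg: "N k \<ge> 0" for k by (simp add: N_def sq_integral_nonneg)
  have N0: "N 0 > 0" using f0 by (simp add: N_def u_def)
  have N1: "N 1 \<ge> t * N 0" using t by (simp add: N_def u_def)
  have N_pos: "N k > 0 \<and> N (Suc k) > 0" for k
  proof (induction k)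
    case 0
    have "t * N 0 > 0" using N0 t by simp
    then show ?case using N0 N1 by auto
  next
    case (Suc k)
    have "0 < (N (Suc k))\<^sup>2" using Suc by simp
    also note N_logconvex[of k]
    finally show ?case using Suc by (simp add: zero_less_mult_iff)
  qed
  then have N_pos: "N k > 0" for k by blast
  define q where "q = (\<lambda>k. N (Suc k) / N k)"
  have q_mono: "q k \<le> q (Suc k)" for k
    using N_logconvex[of k] N_pos[of k] N_pos[of "Suc k"]
    by (simp add: q_def divide_simps power2_eq_square mult_ac)
  then have "incseq q" by (rule incseq_SucI)
  have q0: "q k \<ge> t" for k
  proof -
    have "t \<le> q 0" using N1 N0 by (simp add: q_def pos_le_divide_eq)
    also have "q 0 \<le> q k" using \<open>incseq q\<close> by (simp add: incseqD)
    finally show ?thesis .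
  qed
  have q_bound: "q k \<le> B\<^sup>2" for k
  proof -
    have "(u (Suc k) x)\<^sup>2 \<le> B\<^sup>2 * N k" if "x \<in> {0..1}" for x
    proof -
      have "\<bar>u (Suc k) x\<bar> \<le> B * sqrt (N k)" unfolding u_Suc N_def
        by (rule T_bound[OF \<open>B > 0\<close> B uS that])
      then have "\<bar>u (Suc k) x\<bar>\<^sup>2 \<le> (B * sqrt (N k))\<^sup>2" by (intro power_mono) auto
      then show ?thesis using N_nonneg[of k] by (simp add: power_mult_distrib)
    qed
    then have "?I (\<lambda>x. (u (Suc k) x)\<^sup>2) \<le> B\<^sup>2 * N k"
      using uS[of "Suc k"] by (intro integral_unit_meas_le) (simp_all only: sq_integrable_def mem_Collect_eq)
    then have "N (Suc k) \<le> B\<^sup>2 * N k" unfolding N_def .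
    then show ?thesis using N_pos[of k] by (simp add: q_def pos_divide_le_eq)
  qed
  obtain m where m: "q \<longlonglongrightarrow> m" "\<And>k. q k \<le> m"
    using incseq_convergent[OF \<open>incseq q\<close>] q_bound by metis
  define v where "v = (\<lambda>k x. u k x / sqrt (N k))"
  have v_eq: "v k = (\<lambda>x. (1 / sqrt (N k)) * u k x)" for k by (simp add: v_def)
  have vS: "v k \<in> ?S" for k unfolding v_eq by (rule sq_integrable_scale[OF uS])
  have v_norm: "?I (\<lambda>x. (v k x)\<^sup>2) = 1" for k
    using N_pos[of k] unfolding v_def power_divide by (simp add: N_def)
  have Tv: "T (v k) x = u (Suc k) x / sqrt (N k)" for k x
    unfolding v_eq T_scale u_Suc by simp
  have v_Suc: "v (Suc k) x = T (v k) x / sqrt (q k)" for k x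
    unfolding Tv using N_pos[of k] N_pos[of "Suc k"] by (simp add: v_def q_def real_sqrt_divide)
  have st: "sqrt t > 0" "sqrt t \<le> sqrt (q k)" for k using t q0[of k] by auto
  have v_bound: "\<bar>v (Suc k) x\<bar> \<le> B / sqrt t" if "x \<in> {0..1}" for k x
  proof -
    have "\<bar>T (v k) x\<bar> \<le> B" using T_bound[OF \<open>B > 0\<close> B vS[of k] that] v_norm[of k] by simp
    then show ?thesis unfolding v_Suc abs_divide using st(1) st(2)[of k] \<open>B > 0\<close> by (intro frac_le) auto
  qed
  have equi: "\<exists>d. 0 < d \<and> (\<forall>k y. y \<in> {0..1} \<and> norm (x - y) < d \<longrightarrow> norm (v (Suc k) x - v (Suc k) y) < e)"
    if x: "x \<in> {0..1}" and e: "0 < e" for x e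
  proof -
    have est: "e * sqrt t / 2 > 0" using e st by simp
    then obtain d where d: "d > 0" "\<forall>f\<in>?S. \<forall>x\<in>{0..1}. \<forall>y\<in>{0..1}. \<bar>x - y\<bar> < d \<longrightarrow>
        \<bar>T f x - T f y\<bar> \<le> e * sqrt t / 2 * sqrt (?I (\<lambda>x. (f x)\<^sup>2))" using T_equicontinuous by blast
    have "norm (v (Suc k) x - v (Suc k) y) < e" if y: "y \<in> {0..1}" "norm (x - y) < d" for k y
    proof -
      have "\<bar>T (v k) x - T (v k) y\<bar> \<le> e * sqrt t / 2"
        using d(2)[rule_format, OF vS x y(1), of k] y(2) v_norm[of k] by simp
      moreover have "v (Suc k) x - v (Suc k) y = (T (v k) x - T (v k) y) / sqrt (q k)"
        by (simp add: v_Suc diff_divide_distrib)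
      ultimately have "\<bar>v (Suc k) x - v (Suc k) y\<bar> \<le> (e * sqrt t / 2) / sqrt t"
        unfolding \<open>v (Suc k) x - v (Suc k) y = _\<close> abs_divide using st(1) st(2)[of k] est by (intro frac_le) auto
      also have "\<dots> < e" using st e by simp
      finally show ?thesis by simp
    qed
    then show ?thesis using d(1) by blast
  qed
  \<comment> \<open>Only even positive indices are used. Orthogonality to \<open>W\<close> survives
    two applications of \<open>T\<close> at a time, since members of \<open>W\<close> are
    eigenfunctions of the square of \<open>T\<close>; and at least one application is needed for
    boundedness and continuity, which \<open>f\<close> itself may lack.\<close>
  obtain g r where g: "continuous_on {0..1} g" and r: "strict_mono (r :: nat \<Rightarrow> nat)"
    and conv: "\<And>e. 0 < e \<Longrightarrow> \<exists>N. \<forall>k x. k \<ge> N \<and> x \<in> {0..1} \<longrightarrow> norm (v (Suc (Suc (2 * r k))) x - g x) < e"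
  proof (rule Arzela_Ascoli[of "{0..1}" "\<lambda>k. v (Suc (Suc (2 * k)))" "B / sqrt t"])
    show "norm (v (Suc (Suc (2 * k))) x) \<le> B / sqrt t" if "x \<in> {0..1}" for k x
      using v_bound[OF that] by simp
    show "\<exists>d. 0 < d \<and> (\<forall>k y. y \<in> {0..1} \<and> norm (x - y) < d \<longrightarrow> norm (v (Suc (Suc (2 * k))) x - v (Suc (Suc (2 * k))) y) < e)"
      if "x \<in> {0..1}" "0 < e" for x e
      using equi[OF that] by blast
  qed (use that in auto)
  define F where "F = (\<lambda>k. v (Suc (Suc (2 * r k))))"
  have F_lim: "(\<lambda>k. F k x) \<longlonglongrightarrow> g x" if "x \<in> {0..1}" for x
    unfolding F_def by (rule LIMSEQ_I) (use conv that in blast)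
  have FS: "F k \<in> ?S" for k unfolding F_def by (rule vS)
  have F_bound: "\<bar>F k x\<bar> \<le> B / sqrt t" if "x \<in> {0..1}" for k x unfolding F_def by (rule v_bound[OF that])
  have F_norm: "?I (\<lambda>x. (F k x)\<^sup>2) = 1" for k unfolding F_def by (rule v_norm)
  have gS: "g \<in> ?S" by (rule sq_integrable_continuous[OF g])
  have TF_lim: "(\<lambda>k. T (F k) x) \<longlonglongrightarrow> T g x" if "x \<in> {0..1}" for x
    by (rule T_limit[OF FS gS _ _ that, where C="B / sqrt t"]) (use F_bound F_lim in auto)
  have TF_bound: "\<bar>T (F k) x\<bar> \<le> B" if "x \<in> {0..1}" for k x
    using T_bound[OF \<open>B > 0\<close> B FS that] F_norm by simp
  have TTF_lim: "(\<lambda>k. T (T (F k)) x) \<longlonglongrightarrow> T (T g) x" if "x \<in> {0..1}" for x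
    by (rule T_limit[OF sq_integrable_T[OF FS] sq_integrable_T[OF gS] _ _ that, where C=B]) (use TF_bound TF_lim in auto)
  have I_TF_le: "?I (\<lambda>x. (T (F k) x)\<^sup>2) \<le> B\<^sup>2" for k
  proof -
    have "(T (F k) x)\<^sup>2 \<le> B\<^sup>2" if "x \<in> {0..1}" for x
      using power_mono[OF TF_bound[OF that, of k], of 2] by simp
    then show ?thesis
      using sq_integrable_T[OF FS, of k] by (intro integral_unit_meas_le) (simp_all only: sq_integrable_def mem_Collect_eq)
  qed
  have TTF_bound: "\<bar>T (T (F k)) x\<bar> \<le> B\<^sup>2" if "x \<in> {0..1}" for k x
  proof -
    have "\<bar>T (T (F k)) x\<bar> \<le> B * sqrt (?I (\<lambda>x. (T (F k) x)\<^sup>2))"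
      by (rule T_bound[OF \<open>B > 0\<close> B sq_integrable_T[OF FS] that])
    also have "\<dots> \<le> B * sqrt (B\<^sup>2)" using \<open>B > 0\<close> I_TF_le[of k] by (intro mult_left_mono real_sqrt_le_mono) auto
    finally show ?thesis using \<open>B > 0\<close> by (simp add: power2_eq_square)
  qed
  have ione: "integrable unit_meas (\<lambda>_. 1::real)" by simp
  have "(\<lambda>k. ?I (\<lambda>x. 1 * (F k x)\<^sup>2)) \<longlonglongrightarrow> ?I (\<lambda>x. 1 * (g x)\<^sup>2)"
  proof (rule integral_limit[OF _ _ ione])
    show "(\<lambda>x. (F k x)\<^sup>2) \<in> borel_measurable unit_meas" for k using FS[of k] by (auto simp: sq_integrable_def)
    show "(\<lambda>x. (g x)\<^sup>2) \<in> borel_measurable unit_meas" using gS by (auto simp: sq_integrable_def)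
    show "\<bar>(F k x)\<^sup>2\<bar> \<le> (B / sqrt t)\<^sup>2" if "x \<in> {0<..<1}" for k x
      using power_mono[OF F_bound[of x k], of 2] that by simp
    show "(\<lambda>k. (F k x)\<^sup>2) \<longlonglongrightarrow> (g x)\<^sup>2" if "x \<in> {0<..<1}" for x
      by (intro tendsto_power F_lim) (use that in simp)
  qed
  then have g_norm: "?I (\<lambda>x. (g x)\<^sup>2) = 1" unfolding F_norm mult_1 by (simp add: tendsto_const_iff LIMSEQ_const_iff)
  \<comment> \<open>For normalised iterates the squared norm of T (T v) is
    \<open>q k * q (Suc k)\<close> and its inner product with v is \<open>q k\<close>. Both
    quotients tend to \<open>m\<close>, so the residual tends to m^2 - 2 m^2 + m^2 = 0.\<close>
  have res: "?I (\<lambda>x. (T (T (v k)) x - m * v k x)\<^sup>2) = q k * q (Suc k) - 2 * m * q k + m\<^sup>2" for k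
  proof -
    have TTv: "T (T (v k)) = (\<lambda>x. (1 / sqrt (N k)) * u (Suc (Suc k)) x)"
    proof
      fix x
      have "T (v k) = (\<lambda>x. (1 / sqrt (N k)) * u (Suc k) x)" using Tv by auto
      then show "T (T (v k)) x = (1 / sqrt (N k)) * u (Suc (Suc k)) x"
        by (simp only: T_scale u_Suc)
    qed
    have "?I (\<lambda>x. (T (T (v k)) x - m * v k x)\<^sup>2)
        = ?I (\<lambda>x. 1 / N k * (u (Suc (Suc k)) x)\<^sup>2 - 2 * m / N k * (u k x * u (Suc (Suc k)) x) + m\<^sup>2 / N k * (u k x)\<^sup>2)"
    proof (intro Bochner_Integration.integral_cong refl)
      fix x
      have s: "sqrt (N k) * sqrt (N k) = N k" "sqrt (N k) \<noteq> 0" using N_pos[of k] by auto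
      have "((1 / s) * a - m * (b / s))\<^sup>2 = 1 / (s * s) * a\<^sup>2 - 2 * m / (s * s) * (b * a) + m\<^sup>2 / (s * s) * b\<^sup>2"
        if "s \<noteq> 0" for a b s :: real
        using that by (simp add: field_simps power2_eq_square)
      from this[OF s(2), of "u (Suc (Suc k)) x" "u k x"]
      show "(T (T (v k)) x - m * v k x)\<^sup>2 = 1 / N k * (u (Suc (Suc k)) x)\<^sup>2
          - 2 * m / N k * (u k x * u (Suc (Suc k)) x) + m\<^sup>2 / N k * (u k x)\<^sup>2"
        unfolding TTv unfolding v_def s(1) .
    qed
    also have "\<dots> = 1 / N k * N (Suc (Suc k)) - 2 * m / N k * N (Suc k) + m\<^sup>2 / N k * N k"
      unfolding N_sym[of k, symmetric] unfolding N_def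
      using uS[of k] uS[of "Suc (Suc k)"] sq_integrable_mult[OF uS[of k] uS[of "Suc (Suc k)"]]
      by (simp add: sq_integrable_def)
    also have "\<dots> = q k * q (Suc k) - 2 * m * q k + m\<^sup>2"
      using N_pos[of k] N_pos[of "Suc k"] by (simp add: q_def)
    finally show ?thesis .
  qed
  have "(\<lambda>k. q k * q (Suc k) - 2 * m * q k + m\<^sup>2) \<longlonglongrightarrow> m * m - 2 * m * m + m\<^sup>2"
    by (intro tendsto_intros m LIMSEQ_Suc)
  then have v0: "(\<lambda>k. ?I (\<lambda>x. (T (T (v k)) x - m * v k x)\<^sup>2)) \<longlonglongrightarrow> 0"
    unfolding res by (simp add: power2_eq_square)
  have "strict_mono (\<lambda>k. Suc (Suc (2 * r k)))" using r by (simp add: strict_mono_def)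
  from LIMSEQ_subseq_LIMSEQ[OF v0 this]
  have F0: "(\<lambda>k. ?I (\<lambda>x. (T (T (F k)) x - m * F k x)\<^sup>2)) \<longlonglongrightarrow> 0"
    unfolding F_def o_def .
  have dS: "(\<lambda>x. T (T h) x - m * h x) \<in> ?S" if "h \<in> ?S" for h
    using sq_integrable_add[OF sq_integrable_T[OF sq_integrable_T[OF that]] sq_integrable_scale[OF that, of "- m"]] by simp
  have m_pos: "m \<ge> t" using m(2)[of 0] q0[of 0] by linarith
  have F1: "(\<lambda>k. ?I (\<lambda>x. 1 * (T (T (F k)) x - m * F k x)\<^sup>2)) \<longlonglongrightarrow> ?I (\<lambda>x. 1 * (T (T g) x - m * g x)\<^sup>2)"
  proof (rule integral_limit[OF _ _ ione])
    show "(\<lambda>x. (T (T (F k)) x - m * F k x)\<^sup>2) \<in> borel_measurable unit_meas" for k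
      using dS[OF FS[of k]] by (auto simp: sq_integrable_def)
    show "(\<lambda>x. (T (T g) x - m * g x)\<^sup>2) \<in> borel_measurable unit_meas"
      using dS[OF gS] by (auto simp: sq_integrable_def)
    show "\<bar>(T (T (F k)) x - m * F k x)\<^sup>2\<bar> \<le> (B\<^sup>2 + m * (B / sqrt t))\<^sup>2" if x: "x \<in> {0<..<1}" for k x
    proof -
      have "\<bar>T (T (F k)) x - m * F k x\<bar> \<le> \<bar>T (T (F k)) x\<bar> + m * \<bar>F k x\<bar>"
        using abs_triangle_ineq4[of "T (T (F k)) x" "m * F k x"] m_pos t by (simp add: abs_mult)
      also have "\<dots> \<le> B\<^sup>2 + m * (B / sqrt t)"
        using x m_pos t by (intro add_mono mult_left_mono TTF_bound F_bound) auto
      finally show ?thesis using power_mono[of "\<bar>T (T (F k)) x - m * F k x\<bar>" _ 2] by simp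
    qed
    show "(\<lambda>k. (T (T (F k)) x - m * F k x)\<^sup>2) \<longlonglongrightarrow> (T (T g) x - m * g x)\<^sup>2" if "x \<in> {0<..<1}" for x
      by (intro tendsto_intros F_lim TTF_lim) (use that in simp_all)
  qed
  have "?I (\<lambda>x. (T (T g) x - m * g x)\<^sup>2) = 0"
    using LIMSEQ_unique[OF F1[unfolded mult_1] F0] .
  then have "AE x in unit_meas. (T (T g) x - m * g x)\<^sup>2 = 0"
    using dS[OF gS] by (subst (asm) integral_nonneg_eq_0_iff_AE) (auto simp: sq_integrable_def)
  then have eig: "AE x in unit_meas. T (T g) x = m * g x" by simp
  \<comment> \<open>Two uses of symmetry move \<open>T\<close> twice onto \<open>b\<close>, where it
    acts as a scalar.\<close>
  have orth_u: "?I (\<lambda>x. b x * u (2 * k) x) = 0" if bW: "b \<in> W" for b k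
  proof (induction k)
    case 0 then show ?case using orth[OF bW] by (simp add: u_def)
  next
    case (Suc k)
    obtain l where l: "AE x in unit_meas. T (T b) x = l * b x" using W_inv[OF bW] by blast
    have "?I (\<lambda>x. b x * u (2 * Suc k) x) = ?I (\<lambda>x. T (T b) x * u (2 * k) x)"
      using T_symmetric[OF W[OF bW] uS[of "Suc (2 * k)"]] T_symmetric[OF sq_integrable_T[OF W[OF bW]] uS[of "2 * k"]]
      by (simp add: u_Suc)
    also have "\<dots> = ?I (\<lambda>x. l * (b x * u (2 * k) x))"
    proof (rule integral_cong_AE)
      show "(\<lambda>x. T (T b) x * u (2 * k) x) \<in> borel_measurable unit_meas"
        using sq_integrable_mult[OF sq_integrable_T[OF sq_integrable_T[OF W[OF bW]]] uS[of "2 * k"]] by simp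
      show "(\<lambda>x. l * (b x * u (2 * k) x)) \<in> borel_measurable unit_meas"
        using sq_integrable_mult[OF W[OF bW] uS[of "2 * k"]] by simp
      show "AE x in unit_meas. T (T b) x * u (2 * k) x = l * (b x * u (2 * k) x)"
        using l by eventually_elim simp
    qed
    also have "\<dots> = 0" using Suc by simp
    finally show ?case .
  qed
  have orth_F: "?I (\<lambda>x. b x * F k x) = 0" if bW: "b \<in> W" for b k
  proof -
    have "?I (\<lambda>x. b x * F k x) = ?I (\<lambda>x. (1 / sqrt (N (2 * Suc (r k)))) * (b x * u (2 * Suc (r k)) x))"
      unfolding F_def v_def by (intro Bochner_Integration.integral_cong refl) simp
    then show ?thesis using orth_u[OF bW, of "Suc (r k)"] by simp
  qed
  have orth_g: "?I (\<lambda>x. b x * g x) = 0" if bW: "b \<in> W" for b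
  proof -
    have "(\<lambda>k. ?I (\<lambda>x. b x * F k x)) \<longlonglongrightarrow> ?I (\<lambda>x. b x * g x)"
      by (rule integral_limit[OF _ _ sq_integrable_imp_integrable[OF W[OF bW]], where C="B / sqrt t"])
        (use FS gS F_bound F_lim in \<open>auto simp: sq_integrable_def\<close>)
    then show ?thesis unfolding orth_F[OF bW] by (simp add: LIMSEQ_const_iff)
  qed
  show ?thesis
    using that[OF gS m_pos eig _ orth_g] g_norm by simp
qed

text \<open>One half of the Courant--Fischer principle.\<close>
lemma eigenvalue_lower_bound:
  assumes Q: "\<And>f x. f \<in> sq_integrable unit_meas \<Longrightarrow> x \<in> {0<..<1} \<Longrightarrow> Q f x = c * T (T f) x"
    and c: "c > 0" and ev: "eigenvalue_sequence Q ev" and \<theta>: "\<theta> > 0"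
    and f: "\<And>i. i \<le> n \<Longrightarrow> f i \<in> sq_integrable unit_meas"
    and nonzero: "\<And>a i. i \<le> n \<Longrightarrow> a i \<noteq> 0 \<Longrightarrow> (LINT x|unit_meas. (\<Sum>i\<le>n. a i * f i x)\<^sup>2) > 0"
    and bound: "\<And>a. c * (LINT x|unit_meas. (T (\<lambda>x. \<Sum>i\<le>n. a i * f i x) x)\<^sup>2)
        \<ge> \<theta> * (LINT x|unit_meas. (\<Sum>i\<le>n. a i * f i x)\<^sup>2)"
  shows "ev n \<ge> \<theta>"
proof (rule ccontr)
  assume "\<not> ev n \<ge> \<theta>"
  then have evn: "ev n < \<theta>" by simp
  have dec: "decseq ev" and fin: "\<And>\<mu>. finite {k. ev k = \<mu>}"
    and dim: "\<And>\<mu>. has_dim_AE (eigenspace Q \<mu>) (card {k. ev k = \<mu>})"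
    using ev by (auto simp: eigenvalue_sequence_def)
  \<comment> \<open>By monotonicity all indices with value at least \<theta> precede n, so n
    orthogonality conditions will cover every such eigenspace.\<close>
  have small: "k < n" if "ev k \<ge> \<theta>" for k
  proof (rule ccontr)
    assume "\<not> k < n"
    then have "ev k \<le> ev n" using dec by (simp add: decseqD)
    then show False using that evn by simp
  qed
  have "\<exists>b. (\<forall>i<card {k. ev k = \<mu>}. b i \<in> eigenspace Q \<mu>) \<and>
      (\<forall>h\<in>eigenspace Q \<mu>. \<exists>a. AE x in unit_meas. h x = (\<Sum>i<card {k. ev k = \<mu>}. a i * b i x))" for \<mu>
    using dim[of \<mu>] unfolding has_dim_AE_def by (elim exE conjE) (intro exI conjI)
  then have "\<forall>\<mu>. \<exists>b. (\<forall>i<card {k. ev k = \<mu>}. b i \<in> eigenspace Q \<mu>) \<and>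
      (\<forall>h\<in>eigenspace Q \<mu>. \<exists>a. AE x in unit_meas. h x = (\<Sum>i<card {k. ev k = \<mu>}. a i * b i x))" ..
  from choice[OF this] obtain b where b': "\<forall>\<mu>. (\<forall>i<card {k. ev k = \<mu>}. b \<mu> i \<in> eigenspace Q \<mu>) \<and>
      (\<forall>h\<in>eigenspace Q \<mu>. \<exists>a. AE x in unit_meas. h x = (\<Sum>i<card {k. ev k = \<mu>}. a i * b \<mu> i x))" ..
  have b: "b \<mu> i \<in> eigenspace Q \<mu>" if "i < card {k. ev k = \<mu>}" for \<mu> i
    using b' that by blast
  have span: "\<exists>a. AE x in unit_meas. h x = (\<Sum>i<card {k. ev k = \<mu>}. a i * b \<mu> i x)"
    if "h \<in> eigenspace Q \<mu>" for \<mu> h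
    using b' that by blast
  have "\<forall>\<mu>. \<exists>h. bij_betw h {k. ev k = \<mu>} {0..<card {k. ev k = \<mu>}}"
    using ex_bij_betw_finite_nat[OF fin] by blast
  from choice[OF this] obtain idx
    where "\<forall>\<mu>. bij_betw (idx \<mu>) {k. ev k = \<mu>} {0..<card {k. ev k = \<mu>}}" ..
  then have idx: "bij_betw (idx \<mu>) {k. ev k = \<mu>} {0..<card {k. ev k = \<mu>}}" for \<mu> ..
  \<comment> \<open>\<open>idx\<close> numbers the indices that share one eigenvalue, so
    \<open>e\<close> assigns to each index its own basis vector of the eigenspace. No orthogonality
    among the \<open>e k\<close> is arranged: it is enough that those with
    \<open>ev k = \<mu>\<close> span the eigenspace of \<mu>.\<close>
  define e where "e = (\<lambda>k. b (ev k) (idx (ev k) k))"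
  have e_eig: "e k \<in> eigenspace Q (ev k)" for k
  proof -
    have "idx (ev k) k \<in> {0..<card {j. ev j = ev k}}"
      using bij_betw_apply[OF idx, of k "ev k"] by simp
    then show ?thesis unfolding e_def by (intro b) simp
  qed
  have eS: "e k \<in> sq_integrable unit_meas" for k
    using e_eig[of k] by (simp add: eigenspace_def L2_unit_eq)
  \<comment> \<open>There are n conditions on n + 1 coefficients.\<close>
  obtain a where a: "\<exists>i\<le>n. a i \<noteq> 0"
    and a0: "\<forall>j<n. (\<Sum>i\<le>n. a i * (LINT x|unit_meas. e j x * f i x)) = 0"
    using underdetermined_system[of n "\<lambda>j i. LINT x|unit_meas. e j x * f i x"] by blast
  define F where "F = (\<lambda>x. \<Sum>i\<le>n. a i * f i x)"
  have FS: "F \<in> sq_integrable unit_meas" unfolding F_def by (rule sq_integrable_sum) (use f in simp)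
  have orth: "(LINT x|unit_meas. e j x * F x) = 0" if "j < n" for j
  proof -
    have "(LINT x|unit_meas. e j x * F x) = (LINT x|unit_meas. (\<Sum>i\<le>n. a i * (e j x * f i x)))"
      unfolding F_def by (intro Bochner_Integration.integral_cong refl) (simp add: sum_distrib_left mult.left_commute)
    also have "\<dots> = (\<Sum>i\<le>n. (LINT x|unit_meas. a i * (e j x * f i x)))"
      by (intro Bochner_Integration.integral_sum integrable_mult_right sq_integrable_mult eS f) simp
    also have "\<dots> = 0" using a0 that by simp
    finally show ?thesis .
  qed
  have F_pos: "(LINT x|unit_meas. (F x)\<^sup>2) > 0" 
  proof -
    obtain i where "i \<le> n" "a i \<noteq> 0" using a by blast
    from nonzero[of i a, OF this] show ?thesis unfolding F_def .
  qed
  have F_bound: "(LINT x|unit_meas. (T F x)\<^sup>2) \<ge> \<theta> / c * (LINT x|unit_meas. (F x)\<^sup>2)"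
    using bound[of a] c unfolding F_def by (simp add: field_simps)
  have "\<theta> / c > 0" using \<theta> c by simp
  obtain g m where g: "g \<in> sq_integrable unit_meas" "m \<ge> \<theta> / c"
    "AE x in unit_meas. T (T g) x = m * g x" "(LINT x|unit_meas. (g x)\<^sup>2) > 0"
    "\<And>h. h \<in> e ` {..<n} \<Longrightarrow> (LINT x|unit_meas. h x * g x) = 0"
  proof (rule power_iteration_eigenfunction[OF FS F_pos F_bound \<open>\<theta> / c > 0\<close>, of "e ` {..<n}"])
    show "h \<in> sq_integrable unit_meas" if "h \<in> e ` {..<n}" for h using that eS by auto
    show "(LINT x|unit_meas. h x * F x) = 0" if "h \<in> e ` {..<n}" for h using that orth by auto
    show "\<exists>m. AE x in unit_meas. T (T h) x = m * h x" if "h \<in> e ` {..<n}" for h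
    proof -
      from that obtain j where j: "h = e j" by auto
      have "AE x in unit_meas. Q h x = ev j * h x" using e_eig[of j] by (simp add: eigenspace_def j)
      then have "AE x in unit_meas. T (T h) x = ev j / c * h x"
        using AE_space
      proof eventually_elim
        case (elim x)
        then have "c * T (T h) x = ev j * h x" using Q[of h x] eS[of j] by (simp add: j)
        then show ?case using c by (simp add: field_simps)
      qed
      then show ?thesis by blast
    qed
  qed (use that in auto)
  define \<mu> where "\<mu> = c * m"
  have \<mu>: "\<mu> \<ge> \<theta>" using g(2) c by (simp add: \<mu>_def field_simps)
  have "AE x in unit_meas. Q g x = \<mu> * g x"
    using g(3) AE_space
  proof eventually_elim
    case (elim x)
    then show ?case using Q[OF g(1), of x] by (simp add: \<mu>_def)
  qed
  then have "g \<in> eigenspace Q \<mu>" using g(1) by (simp add: eigenspace_def L2_unit_eq)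
  \<comment> \<open>The new eigenfunction \<open>g\<close> has eigenvalue \<mu> \<ge> \<theta>, so
    it lies in the span of some \<open>e k\<close> with k < n; but it is orthogonal to all of those,
    hence to itself.\<close>
  from span[OF this] obtain d where d: "AE x in unit_meas. g x = (\<Sum>i<card {k. ev k = \<mu>}. d i * b \<mu> i x)" by blast
  have bS: "b \<mu> i \<in> sq_integrable unit_meas" if "i < card {k. ev k = \<mu>}" for i
    using b[OF that] by (simp add: eigenspace_def L2_unit_eq)
  have b_orth: "(LINT x|unit_meas. b \<mu> i x * g x) = 0" if i: "i < card {k. ev k = \<mu>}" for i
  proof -
    have "i \<in> idx \<mu> ` {k. ev k = \<mu>}" using idx[of \<mu>] i by (simp add: bij_betw_def)
    then obtain k where k: "ev k = \<mu>" "i = idx \<mu> k" by blast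
    then have "b \<mu> i = e k" by (simp add: e_def)
    moreover have "k < n" using small k \<mu> by simp
    ultimately show ?thesis using g(5) by simp
  qed
  have "(LINT x|unit_meas. (g x)\<^sup>2) = (LINT x|unit_meas. (\<Sum>i<card {k. ev k = \<mu>}. d i * (b \<mu> i x * g x)))"
  proof (rule integral_cong_AE)
    show "(\<lambda>x. (g x)\<^sup>2) \<in> borel_measurable unit_meas" using g(1) by (auto simp: sq_integrable_def)
    show "(\<lambda>x. \<Sum>i<card {k. ev k = \<mu>}. d i * (b \<mu> i x * g x)) \<in> borel_measurable unit_meas"
      by (intro borel_measurable_sum borel_measurable_times borel_measurable_const)
        (use bS g(1) in \<open>auto simp: sq_integrable_def\<close>)
    show "AE x in unit_meas. (g x)\<^sup>2 = (\<Sum>i<card {k. ev k = \<mu>}. d i * (b \<mu> i x * g x))"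
      using d
    proof eventually_elim
      case (elim x)
      then have "(g x)\<^sup>2 = (\<Sum>i<card {k. ev k = \<mu>}. d i * b \<mu> i x) * g x" by (simp add: power2_eq_square)
      then show ?case by (simp add: sum_distrib_right mult.assoc)
    qed
  qed
  also have "\<dots> = (\<Sum>i<card {k. ev k = \<mu>}. (LINT x|unit_meas. d i * (b \<mu> i x * g x)))"
    by (intro Bochner_Integration.integral_sum integrable_mult_right sq_integrable_mult bS g(1)) simp
  also have "\<dots> = 0" using b_orth by simp
  finally show False using g(4) by simp
qed

text \<open>Pairing the eigenvalue equation with an eigenfunction b gives \<open>ev n\<close> times
  the squared norm of b on one side and c times that of T b on the other. This settles the range
  where 1 - 4 \<kappa> is not positive.\<close>

lemma eigenvalue_nonneg:
  assumes Q: "\<And>f x. f \<in> sq_integrable unit_meas \<Longrightarrow> x \<in> {0<..<1} \<Longrightarrow> Q f x = c * T (T f) x"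
    and c: "c \<ge> 0" and ev: "eigenvalue_sequence Q ev"
  shows "ev n \<ge> 0"
proof (rule ccontr)
  assume neg: "\<not> ev n \<ge> 0"
  let ?d = "card {k. ev k = ev n}"
  have "?d > 0" using ev by (auto simp: eigenvalue_sequence_def card_gt_0_iff)
  obtain b where b: "\<forall>i<?d. b i \<in> eigenspace Q (ev n)"
    and indep: "\<forall>a :: nat \<Rightarrow> real. (AE x in unit_meas. (\<Sum>i<?d. a i * b i x) = 0) \<longrightarrow> (\<forall>i<?d. a i = 0)"
    using ev unfolding eigenvalue_sequence_def has_dim_AE_def by blast
  have bS: "b 0 \<in> sq_integrable unit_meas" and b0: "AE x in unit_meas. Q (b 0) x = ev n * b 0 x"
    using b \<open>?d > 0\<close> by (auto simp: eigenspace_def L2_unit_eq)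
  have "ev n * (LINT x|unit_meas. (b 0 x)\<^sup>2) = (LINT x|unit_meas. c * (T (T (b 0)) x * b 0 x))"
    unfolding Bochner_Integration.integral_mult_right_zero[symmetric]
  proof (rule integral_cong_AE)
    show "(\<lambda>x. ev n * (b 0 x)\<^sup>2) \<in> borel_measurable unit_meas" using bS by (auto simp: sq_integrable_def)
    show "(\<lambda>x. c * (T (T (b 0)) x * b 0 x)) \<in> borel_measurable unit_meas"
      using sq_integrable_mult[OF sq_integrable_T[OF sq_integrable_T[OF bS]] bS] by simp
    show "AE x in unit_meas. ev n * (b 0 x)\<^sup>2 = c * (T (T (b 0)) x * b 0 x)"
      using b0 AE_space
    proof eventually_elim
      case (elim x)
      then have "c * T (T (b 0)) x = ev n * b 0 x" using Q[OF bS, of x] by simp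
      then show ?case by (metis mult.assoc power2_eq_square)
    qed
  qed
  also have "\<dots> = c * (LINT x|unit_meas. (T (b 0) x)\<^sup>2)"
    using T_symmetric[OF sq_integrable_T[OF bS] bS] by (simp add: power2_eq_square)
  also have "\<dots> \<ge> 0" using c by (simp add: sq_integral_nonneg)
  finally have "(LINT x|unit_meas. (b 0 x)\<^sup>2) \<le> 0" using neg by (simp add: zero_le_mult_iff)
  then have "(LINT x|unit_meas. (b 0 x)\<^sup>2) = 0" using sq_integral_nonneg[of unit_meas "b 0"] by linarith
  then have "AE x in unit_meas. (b 0 x)\<^sup>2 = 0"
    using bS by (subst (asm) integral_nonneg_eq_0_iff_AE) (auto simp: sq_integrable_def)
  \<comment> \<open>A null basis vector contradicts independence, through the coefficients 1, 0, 0,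
    ...\<close>
  then have "AE x in unit_meas. (\<Sum>i<?d. (if i = 0 then 1 else 0) * b i x) = 0"
  proof eventually_elim
    case (elim x)
    then show ?case by (intro sum.neutral) simp
  qed
  then have "(if (0::nat) = 0 then 1 else 0) = (0::real)" 
    using spec[OF indep, of "\<lambda>i. if i = 0 then 1 else 0"] \<open>?d > 0\<close> by blast
  then show False by simp
qed

end

section \<open>The Bessel--Clifford function\<close>

text \<open>The point 2 is the convex combination of x and x + 1 with weights x - 1 and 2 - x.
  Log-convexity and Gamma 2 = 1 give 1 / Gamma x \<le> x^(2 - x), and concavity of ln bounds this by
  (2 - x) x + (x - 1) = 5/4 - (x - 3/2)^2.\<close>

lemma Gamma_ge_4_5_aux:
  fixes x :: real assumes "1 \<le> x" "x \<le> 2" shows "4/5 \<le> Gamma x"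
proof -
  have G: "Gamma x > 0" "Gamma (x+1) > 0" using assms by (auto intro: Gamma_real_pos)
  have "(ln \<circ> Gamma) ((1-(2-x)) *\<^sub>R x + (2-x) *\<^sub>R (x+1)) \<le> (1-(2-x)) * (ln \<circ> Gamma) x + (2-x) * (ln \<circ> Gamma) (x+1)"
    by (rule convex_onD[OF log_convex_Gamma_real]) (use assms in auto)
  moreover have "(1-(2-x)) *\<^sub>R x + (2-x) *\<^sub>R (x+1) = (2::real)" by (simp add: algebra_simps)
  moreover have "Gamma (2::real) = 1" using Gamma_fact[of 1, where 'a=real] by simp
  moreover have "Gamma (x+1) = x * Gamma x" using assms by (intro Gamma_plus1) (auto dest: nonpos_Ints_nonpos)
  moreover have "ln (x * Gamma x) = ln x + ln (Gamma x)" using G assms by (intro ln_mult_pos) auto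
  ultimately have "0 \<le> ln (Gamma x) + (2-x) * ln x"
    by (simp add: algebra_simps)
  moreover have "ln x \<le> x - 1" using assms ln_le_minus_one[of x] by simp
  moreover have "ln (1 / Gamma x) \<le> (2-x)*ln x" using calculation(1) G by (simp add: ln_div)
  moreover have "(2-x) * ln x \<le> ln ((2-x)*x + (x-1)*1)"
  proof -
    have "concave_on {0<..} ln" 
      by (simp add: ln_concave)
    then have "ln ((1-(2-x)) *\<^sub>R 1 + (2-x) *\<^sub>R x) \<ge> (1-(2-x)) * ln 1 + (2-x) * ln x"
      by (rule concave_onD) (use assms in auto)
    then show ?thesis by (simp add: algebra_simps)
  qed
  ultimately have 1: "ln (1 / Gamma x) \<le> ln ((2-x)*x + (x-1)*1)" by linarith
  have "(2-x)*x + (x-1)*1 = 5/4 - (x - 3/2)^2" by (simp add: power2_eq_square algebra_simps)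
  then have 2: "(2-x)*x + (x-1)*1 \<le> 5/4" by simp
  have "(2-x)*x + (x-1)*1 > 0"
    using assms by (cases "x = 2") (auto intro!: add_pos_nonneg mult_pos_pos)
  then have "1 / Gamma x \<le> (2-x)*x + (x-1)*1" using 1 G by (subst (asm) ln_le_cancel_iff) auto
  then have "1 / Gamma x \<le> 5/4" using 2 by linarith
  then show ?thesis using G by (simp add: field_simps)
qed

text \<open>Here 2 lies between 1 and x, and Gamma equals 1 at both 1 and 2, so log-convexity
  forbids a value below 1 at x.\<close>

lemma Gamma_ge_1:
  fixes x :: real assumes "2 \<le> x" shows "1 \<le> Gamma x"
proof -
  have G: "Gamma x > 0" using assms by (auto intro: Gamma_real_pos)
  have "Gamma (2::real) = 1" using Gamma_fact[of 1, where 'a=real] by simp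
  have xx: "1/(x-1) \<ge> 0" "1/(x-1) \<le> 1" using assms by auto
  have "(ln \<circ> Gamma) ((1-1/(x-1)) *\<^sub>R 1 + (1/(x-1)) *\<^sub>R x) \<le> (1-1/(x-1)) * (ln \<circ> Gamma) 1 + (1/(x-1)) * (ln \<circ> Gamma) x"
    by (rule convex_onD[OF log_convex_Gamma_real]) (use assms xx in auto)
  moreover have "(1-1/(x-1)) *\<^sub>R 1 + (1/(x-1)) *\<^sub>R x = 2"
  proof -
    define k where "k = x - 1"
    have "x = 1 + k" "k \<noteq> 0" using assms by (auto simp: k_def)
    then show ?thesis by (simp add: field_simps)
  qed
  ultimately have "0 \<le> ln (Gamma x) / (x-1)"
    using \<open>Gamma 2 = 1\<close> by (simp only: o_def) simp
  then have "0 \<le> ln (Gamma x)" using assms by (auto simp: zero_le_divide_iff)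
  then show ?thesis using G by simp
qed

text \<open>Below 1 the functional equation helps: Gamma x \<ge> x Gamma x = Gamma (x + 1).\<close>

lemma Gamma_ge_4_5:
  fixes x :: real assumes "1/2 \<le> x" shows "4/5 \<le> Gamma x"
proof -
  consider "x < 1" | "1 \<le> x" "x \<le> 2" | "x \<ge> 2" by linarith
  then show ?thesis
  proof cases
    case 1
    have "Gamma (x+1) = x * Gamma x" using assms by (intro Gamma_plus1) (auto dest: nonpos_Ints_nonpos)
    moreover have "4/5 \<le> Gamma (x+1)" using 1 assms by (intro Gamma_ge_4_5_aux) auto
    moreover have "x * Gamma x \<le> 1 * Gamma x" using 1 assms by (intro mult_right_mono) (auto intro!: less_imp_le Gamma_real_pos)
    ultimately show ?thesis by simp
  next
    case 2 then show ?thesis by (intro Gamma_ge_4_5_aux)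
  next
    case 3 then show ?thesis using Gamma_ge_1[of x] by simp
  qed
qed

text \<open>The function \<open>j\<close> of the overview, a normalised hypergeometric 0F1. Unlike
  \<open>Bessel_J\<close> it is an entire power series, and differentiation only raises the order by
  1 and changes the sign.\<close>

definition Bessel_Clifford :: "real \<Rightarrow> real \<Rightarrow> real" where
  "Bessel_Clifford \<alpha> w = (\<Sum>m. (-1)^m / (fact m * Gamma (real m + \<alpha> + 1)) * w^m)"

lemma Bessel_Clifford_coeff_le:
  assumes "\<alpha> \<ge> -1/2"
  shows "norm ((-1)^m / (fact m * Gamma (real m + \<alpha> + 1)) * w^m) \<le> 5/4 * (\<bar>w\<bar>^m / fact m)"
proof -
  have "4/5 \<le> Gamma (real m + \<alpha> + 1)" using assms by (intro Gamma_ge_4_5) auto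
  then have "1 / Gamma (real m + \<alpha> + 1) \<le> 5/4" by (simp add: field_simps)
  then have "(1 / Gamma (real m + \<alpha> + 1)) * (\<bar>w\<bar>^m / fact m) \<le> 5/4 * (\<bar>w\<bar>^m / fact m)"
    by (intro mult_right_mono) auto
  moreover have "\<bar>Gamma (real m + \<alpha> + 1)\<bar> = Gamma (real m + \<alpha> + 1)" using \<open>4/5 \<le> _\<close> by simp
  ultimately show ?thesis by (simp add: abs_mult power_abs mult.commute)
qed

lemma summable_Bessel_Clifford:
  assumes "\<alpha> \<ge> -1/2"
  shows "summable (\<lambda>m. norm ((-1)^m / (fact m * Gamma (real m + \<alpha> + 1)) * w^m))"
proof (rule summable_comparison_test')
  show "summable (\<lambda>m. 5/4 * (\<bar>w\<bar>^m / fact m))"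
    using summable_exp[of "\<bar>w\<bar>"] by (intro summable_mult) (simp add: field_simps)
  show "norm (norm ((-1)^m / (fact m * Gamma (real m + \<alpha> + 1)) * w^m)) \<le> 5/4 * (\<bar>w\<bar>^m / fact m)" for m
    using Bessel_Clifford_coeff_le[OF assms] by simp
qed

lemmas summable_Bessel_Clifford' = summable_norm_cancel[OF summable_Bessel_Clifford]

lemma has_field_derivative_Bessel_Clifford:
  assumes "\<alpha> \<ge> -1/2"
  shows "(Bessel_Clifford \<alpha> has_field_derivative - Bessel_Clifford (\<alpha>+1) w) (at w)"
proof -
  let ?c = "\<lambda>m. (-1)^m / (fact m * Gamma (real m + \<alpha> + 1)) :: real"
  have "((\<lambda>w. \<Sum>m. ?c m * w^m) has_field_derivative (\<Sum>m. diffs ?c m * w^m)) (at w)"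
    by (rule termdiffs_strong_converges_everywhere) (rule summable_Bessel_Clifford'[OF assms])
  moreover have "diffs ?c m * w^m = - ((-1)^m / (fact m * Gamma (real m + (\<alpha>+1) + 1)) * w^m)" for m
    by (simp add: diffs_def add_ac)
  ultimately show ?thesis
    using suminf_minus[OF summable_Bessel_Clifford'[of "\<alpha>+1" w]] assms
    unfolding Bessel_Clifford_def by simp
qed

lemma continuous_on_Bessel_Clifford:
  assumes "\<alpha> \<ge> -1/2" shows "continuous_on A (Bessel_Clifford \<alpha>)"
  using has_field_derivative_Bessel_Clifford[OF assms] 
  by (meson DERIV_continuous_on has_field_derivative_at_within)

text \<open>As j' and j'' are, up to sign, the functions of order \<alpha> + 1 and \<alpha> + 2,
  this is w j'' + (\<alpha> + 1) j' + j = 0, which is Bessel's equation after the change of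
  variable. It is checked coefficient by coefficient.\<close>

lemma Bessel_Clifford_ODE:
  assumes "\<alpha> \<ge> -1/2"
  shows "w * Bessel_Clifford (\<alpha>+2) w - (\<alpha>+1) * Bessel_Clifford (\<alpha>+1) w + Bessel_Clifford \<alpha> w = 0"
proof -
  \<comment> \<open>The series of w j'', shifted by one with constant term 0, so that the three
    series can be added at equal powers.\<close>
  let ?d = "\<lambda>m. (case m of 0 \<Rightarrow> 0 | Suc m \<Rightarrow> (-1)^m / (fact m * Gamma (real m + (\<alpha>+2) + 1)) * w^Suc m)"
  have s2: "(\<lambda>m. (-1)^m / (fact m * Gamma (real m + (\<alpha>+2) + 1)) * w^m) sums Bessel_Clifford (\<alpha>+2) w"
    unfolding Bessel_Clifford_def using assms by (intro summable_sums summable_Bessel_Clifford') auto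
  have "(\<lambda>m. ?d (Suc m)) sums (w * Bessel_Clifford (\<alpha>+2) w)"
    using sums_mult[OF s2, of w] by (simp add: field_simps)
  then have "?d sums (w * Bessel_Clifford (\<alpha>+2) w + ?d 0)"
    by (rule iffD1[OF sums_Suc_iff])
  then have s2': "?d sums (w * Bessel_Clifford (\<alpha>+2) w)"
    by (simp only: nat.case(1) add_0_right)
  have s1: "(\<lambda>m. (-1)^m / (fact m * Gamma (real m + (\<alpha>+1) + 1)) * w^m) sums Bessel_Clifford (\<alpha>+1) w"
    unfolding Bessel_Clifford_def using assms by (intro summable_sums summable_Bessel_Clifford') auto
  have s0: "(\<lambda>m. (-1)^m / (fact m * Gamma (real m + \<alpha> + 1)) * w^m) sums Bessel_Clifford \<alpha> w"
    unfolding Bessel_Clifford_def using assms by (intro summable_sums summable_Bessel_Clifford') auto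
  have "?d m - (\<alpha>+1) * ((-1)^m / (fact m * Gamma (real m + (\<alpha>+1) + 1)) * w^m)
       + (-1)^m / (fact m * Gamma (real m + \<alpha> + 1)) * w^m = 0" for m
  proof -
    have g: "Gamma (real m + \<alpha> + 1) > 0" using assms by (intro Gamma_real_pos) auto
    have G: "Gamma (real m + \<alpha> + 1 + 1) = (real m + \<alpha> + 1) * Gamma (real m + \<alpha> + 1)"
      using assms by (intro Gamma_plus1) (auto dest: nonpos_Ints_nonpos)
    show ?thesis
    proof (cases m)
      case 0
      have "Gamma (\<alpha> + 2) = (\<alpha>+1) * Gamma (\<alpha> + 1)" using G 0 by (simp add: add_ac)
      moreover have "Gamma (\<alpha> + 1) \<noteq> 0" "\<alpha> + 1 \<noteq> 0"
        using g[unfolded 0] assms by (simp_all only: of_nat_0 add_0)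
      moreover have "real 0 + (\<alpha>+1) + 1 = \<alpha> + 2" "real 0 + \<alpha> + 1 = \<alpha> + 1" by simp_all
      ultimately show ?thesis unfolding 0 nat.case by (simp only:) simp
    next
      case (Suc k)
      have e: "real k + (\<alpha>+2) + 1 = real m + \<alpha> + 1 + 1" "real m + (\<alpha>+1) + 1 = real m + \<alpha> + 1 + 1"
        using Suc by auto
      have nz: "real m + \<alpha> + 1 \<noteq> 0" using assms by linarith
      have fm: "(fact m :: real) = real m * fact k" using Suc by simp
      have mk: "real m > 0" "w ^ m = w * w^k" "(-1::real)^m = - ((-1)^k)" using Suc by auto
      have "?d m = (-1)^k / (fact k * Gamma (real k + (\<alpha>+2) + 1)) * w^Suc k" using Suc by simp
      \<comment> \<open>To be read with r = m and s = m + \<alpha> + 1, so that s - r = \<alpha> +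
        1; F is the factorial of k = m - 1 and h the Gamma value at s.\<close>
      moreover have "E / (F * (s * h)) * W - (s - r) * (- E / (r * F * (s * h)) * W) + - E / (r * F * h) * W = 0"
        if "F \<noteq> 0" "s \<noteq> 0" "h \<noteq> 0" "r \<noteq> 0" for E F s h r W :: real
        using that by (simp add: field_simps)
      from this[of "fact k" "real m + \<alpha> + 1" "Gamma (real m + \<alpha> + 1)" "real m" "(-1)^k" "w * w^k"]
      have "(-1)^k / (fact k * Gamma (real k + (\<alpha>+2) + 1)) * w^Suc k
        - (\<alpha>+1) * ((-1)^m / (fact m * Gamma (real m + (\<alpha>+1) + 1)) * w^m)
        + (-1)^m / (fact m * Gamma (real m + \<alpha> + 1)) * w^m = 0"
        unfolding e G fm mk power_Suc using g nz mk(1) by simp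
      ultimately show ?thesis by (simp only:)
    qed
  qed
  then have "(\<lambda>m. 0::real) sums (w * Bessel_Clifford (\<alpha>+2) w - (\<alpha>+1) * Bessel_Clifford (\<alpha>+1) w + Bessel_Clifford \<alpha> w)"
    using sums_add[OF sums_diff[OF s2' sums_mult[OF s1, of "\<alpha>+1"]] s0] by (simp only:)
  then show ?thesis using sums_unique2 sums_zero by blast
qed

lemma Bessel_Clifford_0: "Bessel_Clifford \<alpha> 0 = 1 / Gamma (\<alpha> + 1)"
  unfolding Bessel_Clifford_def by (subst powser_zero) simp

text \<open>With \<open>j\<close> for the function, the energy \<open>j(w)\<^sup>2 + w j'(w)\<^sup>2\<close> is nonincreasing.\<close>
lemma Bessel_Clifford_bound:
  assumes "\<alpha> \<ge> -1/2" "w \<ge> 0"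
  shows "\<bar>Bessel_Clifford \<alpha> w\<bar> \<le> 1 / Gamma (\<alpha> + 1)"
proof -
  let ?j = "Bessel_Clifford"
  let ?E = "\<lambda>w. (?j \<alpha> w)^2 + w * (?j (\<alpha>+1) w)^2"
  \<comment> \<open>The differential equation cancels the product j j'. What remains is nonpositive
    because \<alpha> \<ge> -1/2.\<close>
  have d: "(?E has_real_derivative - (2*\<alpha>+1) * (?j (\<alpha>+1) x)^2) (at x)" for x
  proof -
    have d1: "(?j (\<alpha>+1) has_real_derivative - ?j (\<alpha>+2) x) (at x)"
      using has_field_derivative_Bessel_Clifford[of "\<alpha>+1" x] assms by (simp add: add_ac)
    have "(?E has_real_derivative 2 * ?j \<alpha> x * (- ?j (\<alpha>+1) x) + ((?j (\<alpha>+1) x)^2 + x * (2 * ?j (\<alpha>+1) x * (- ?j (\<alpha>+2) x)))) (at x)"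
      by (rule derivative_eq_intros d1 has_field_derivative_Bessel_Clifford assms refl | simp)+
    moreover have "x * ?j (\<alpha>+2) x = (\<alpha>+1) * ?j (\<alpha>+1) x - ?j \<alpha> x"
      using Bessel_Clifford_ODE[OF assms(1), of x] by simp
    then have "2 * ?j \<alpha> x * (- ?j (\<alpha>+1) x) + ((?j (\<alpha>+1) x)^2 + x * (2 * ?j (\<alpha>+1) x * (- ?j (\<alpha>+2) x)))
       = - (2*\<alpha>+1) * (?j (\<alpha>+1) x)^2"
      by algebra
    ultimately show ?thesis by simp
  qed
  have "?E w \<le> ?E 0"
  proof (rule DERIV_nonpos_imp_nonincreasing[OF assms(2)])
    fix x assume "0 \<le> x" "x \<le> w"
    then show "\<exists>y. (?E has_real_derivative y) (at x) \<and> y \<le> 0"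
      by (intro exI[of _ "- (2*\<alpha>+1) * (?j (\<alpha>+1) x)^2"] conjI d mult_nonpos_nonneg) (use assms in auto)
  qed
  moreover have "(?j \<alpha> w)^2 \<le> ?E w" using assms by simp
  ultimately have "(?j \<alpha> w)^2 \<le> (?j \<alpha> 0)^2" by simp
  then have "\<bar>?j \<alpha> w\<bar> \<le> \<bar>?j \<alpha> 0\<bar>" by (simp add: abs_le_square_iff)
  moreover have "Gamma (\<alpha>+1) > 0" using assms by (intro Gamma_real_pos) auto
  ultimately show ?thesis by (simp add: Bessel_Clifford_0)
qed

lemma Bessel_J_conv_Bessel_Clifford:
  assumes "\<alpha> \<ge> -1/2" "z > 0"
  shows "Bessel_J \<alpha> z = (z/2) powr \<alpha> * Bessel_Clifford \<alpha> (z\<^sup>2/4)"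
proof -
  have "(-1) ^ m / fact m * ((z / 2) powr (2 * real m + \<alpha>) / Gamma (real m + \<alpha> + 1))
     = (z/2) powr \<alpha> * ((-1)^m / (fact m * Gamma (real m + \<alpha> + 1)) * (z\<^sup>2/4)^m)" for m
  proof -
    have "(z/2) powr (2 * real m + \<alpha>) = (z/2) powr \<alpha> * (z\<^sup>2/4)^m"
    proof -
      have "(z/2) powr (2 * real m + \<alpha>) = (z/2) powr (real (2*m)) * (z/2) powr \<alpha>"
        by (simp add: powr_add)
      also have "(z/2) powr (real (2*m)) = (z/2)^(2*m)" using assms by (subst powr_realpow) auto
      also have "\<dots> = (z\<^sup>2/4)^m" by (simp add: power_mult power2_eq_square)
      finally show ?thesis by (simp add: mult.commute)
    qed
    then show ?thesis by simp
  qed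
  then show ?thesis unfolding Bessel_J_def Bessel_Clifford_def
    using suminf_mult[OF summable_Bessel_Clifford'[OF assms(1), of "z\<^sup>2/4"], of "(z/2) powr \<alpha>"]
    by (simp only:)
qed

section \<open>The Hankel transform as a contraction\<close>

locale bessel_order =
  fixes \<alpha> :: real
  assumes \<alpha>_ge: "\<alpha> \<ge> -1/2"
begin

text \<open>For negative \<alpha> the weight is unbounded at 0, but it is integrable there since
  \<alpha> > -1.\<close>

definition W :: "real measure" where
  "W = density lborel (\<lambda>t. ennreal (indicator {0<..} t * t powr \<alpha>))"

lemma sets_W [measurable_cong, simp]: "sets W = sets borel"
  and space_W [simp]: "space W = UNIV"
  by (simp_all add: W_def)

lemma sigma_finite_W: "sigma_finite_measure W"
  unfolding W_def by (subst sigma_finite_measure.sigma_finite_iff_density_finite[OF sigma_finite_lborel]) auto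

sublocale W: sigma_finite_measure W by (rule sigma_finite_W)

sublocale W_pair: pair_sigma_finite W W ..

lemma AE_W: "(AE t in W. P t) \<longleftrightarrow> (AE t in lborel. t > 0 \<longrightarrow> P t)"
  unfolding W_def by (subst AE_density) (auto simp: indicator_def intro!: AE_cong)

lemma AE_W_I: "(\<And>t. t > 0 \<Longrightarrow> P t) \<Longrightarrow> AE t in W. P t"
  unfolding AE_W by simp

lemma integral_W:
  assumes "f \<in> borel_measurable borel"
  shows "(LINT t|W. f t) = (LINT t|lborel. indicator {0<..} t * t powr \<alpha> * (f t :: real))"
  unfolding W_def using assms by (subst integral_density) auto

lemma integrable_W:
  assumes "f \<in> borel_measurable borel"
  shows "integrable W f \<longleftrightarrow> integrable lborel (\<lambda>t. indicator {0<..} t * t powr \<alpha> * (f t :: real))"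
  unfolding W_def using assms by (subst integrable_density) auto

lemma Gamma_pos: "Gamma (real k + \<alpha> + 1) > 0"
  using \<alpha>_ge by (intro Gamma_real_pos) auto

lemma nn_integral_W_exp:
  assumes "s > 0"
  shows "(\<integral>\<^sup>+t. ennreal (\<bar>t\<bar>^k * exp (- s * t)) \<partial>W) = ennreal (Gamma (real k + \<alpha> + 1) / s powr (real k + \<alpha> + 1))"
proof -
  let ?a = "real k + \<alpha> + 1"
  have a: "?a > 0" using \<alpha>_ge by linarith
  have "ennreal (Gamma ?a) = (\<integral>\<^sup>+t. ennreal (indicator {0..} t * t powr (?a - 1) / exp t) \<partial>lborel)"
    by (rule Gamma_conv_nn_integral_real[OF a])
  also have "\<dots> = ennreal \<bar>s\<bar> * (\<integral>\<^sup>+t. ennreal (indicator {0..} (0 + s * t) * (0 + s * t) powr (?a - 1) / exp (0 + s * t)) \<partial>lborel)"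
    using assms by (intro nn_integral_real_affine) auto
  also have "\<dots> = (\<integral>\<^sup>+t. ennreal s * ennreal (indicator {0..} (s * t) * (s * t) powr (?a - 1) / exp (s * t)) \<partial>lborel)"
    using assms by (subst nn_integral_cmult) auto
  also have "\<dots> = (\<integral>\<^sup>+t. ennreal (s powr ?a) * (ennreal (indicator {0<..} t * t powr \<alpha>) * ennreal (\<bar>t\<bar>^k * exp (- s * t))) \<partial>lborel)"
  proof (rule nn_integral_cong_AE)
    have "AE t in lborel. t \<noteq> (0::real)" by (rule AE_lborel_singleton)
    then show "AE t in lborel. ennreal s * ennreal (indicator {0..} (s * t) * (s * t) powr (?a - 1) / exp (s * t)) =
        ennreal (s powr ?a) * (ennreal (indicator {0<..} t * t powr \<alpha>) * ennreal (\<bar>t\<bar>^k * exp (- s * t)))"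
    proof eventually_elim
      case (elim t)
      show ?case
      proof (cases "t > 0")
        case True
        have "(s * t) powr (?a - 1) = s powr ?a / s * (t powr \<alpha> * t ^ k)"
        proof -
          have "(s * t) powr (?a - 1) = s powr (?a - 1) * t powr (real k + \<alpha>)" using True assms by (simp add: powr_mult)
          also have "s powr (?a - 1) = s powr ?a / s" using assms powr_diff[of s ?a 1] by simp
          also have "t powr (real k + \<alpha>) = t powr \<alpha> * t ^ k" using True by (simp add: powr_add powr_realpow)
          finally show ?thesis by simp
        qed
        then show ?thesis using True assms
          by (simp add: ennreal_mult'[symmetric] exp_minus divide_inverse mult_ac)
      next
        case False
        then have "\<not> s * t \<ge> 0" using elim assms by (simp add: zero_le_mult_iff)
        then show ?thesis using False by simp
      qed
    qed
  qed
  also have "\<dots> = ennreal (s powr ?a) * (\<integral>\<^sup>+t. ennreal (\<bar>t\<bar>^k * exp (- s * t)) \<partial>W)"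
    unfolding W_def by (subst nn_integral_density) (auto simp: nn_integral_cmult)
  finally have *: "ennreal (Gamma ?a) = ennreal (s powr ?a) * (\<integral>\<^sup>+t. ennreal (\<bar>t\<bar>^k * exp (- s * t)) \<partial>W)" .
  have sp: "s powr ?a > 0" using assms by simp
  have "ennreal (Gamma ?a / s powr ?a) = ennreal (1 / s powr ?a) * ennreal (Gamma ?a)"
    using sp Gamma_pos[of k] by (subst ennreal_mult'[symmetric]) auto
  also have "\<dots> = ennreal (1 / s powr ?a) * ennreal (s powr ?a) * (\<integral>\<^sup>+t. ennreal (\<bar>t\<bar>^k * exp (- s * t)) \<partial>W)"
    unfolding * by (simp only: mult.assoc)
  also have "ennreal (1 / s powr ?a) * ennreal (s powr ?a) = 1"
    using sp by (subst ennreal_mult'[symmetric]) auto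
  finally show ?thesis by simp
qed

lemma has_bochner_integral_W_exp:
  assumes "s > 0"
  shows "has_bochner_integral W (\<lambda>t. t^k * exp (- s * t)) (Gamma (real k + \<alpha> + 1) / s powr (real k + \<alpha> + 1))"
proof -
  have "has_bochner_integral W (\<lambda>t. \<bar>t\<bar>^k * exp (- s * t)) (Gamma (real k + \<alpha> + 1) / s powr (real k + \<alpha> + 1))"
    using Gamma_pos[of k] by (intro has_bochner_integral_nn_integral nn_integral_W_exp assms) auto
  moreover have "AE t in W. \<bar>t\<bar>^k * exp (- s * t) = t^k * exp (- s * t)" by (rule AE_W_I) simp
  ultimately show ?thesis by (subst (asm) has_bochner_integral_cong_AE) auto
qed

lemma integral_W_exp: "s > 0 \<Longrightarrow> (LINT t|W. t^k * exp (- s * t)) = Gamma (real k + \<alpha> + 1) / s powr (real k + \<alpha> + 1)"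
  by (rule has_bochner_integral_integral_eq[OF has_bochner_integral_W_exp])

lemma integrable_W_exp: "s > 0 \<Longrightarrow> integrable W (\<lambda>t. t^k * exp (- s * t))"
  by (rule integrable.intros[OF has_bochner_integral_W_exp])

lemma continuous_Bessel_Clifford_abs: "continuous_on UNIV (\<lambda>x. Bessel_Clifford \<alpha> \<bar>x\<bar>)"
  by (intro continuous_on_compose2[OF continuous_on_Bessel_Clifford[OF \<alpha>_ge, of UNIV]] continuous_intros) auto

lemma measurable_Bessel_Clifford_abs [measurable]: "(\<lambda>x. Bessel_Clifford \<alpha> \<bar>x\<bar>) \<in> borel_measurable borel"
  by (intro borel_measurable_continuous_onI continuous_Bessel_Clifford_abs)

abbreviation J0 :: real where "J0 \<equiv> 1 / Gamma (\<alpha> + 1)"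

lemma J0_pos: "J0 > 0" using Gamma_pos[of 0] by simp

lemma Bessel_Clifford_abs_bound: "\<bar>Bessel_Clifford \<alpha> \<bar>x\<bar>\<bar> \<le> J0"
  by (rule Bessel_Clifford_bound[OF \<alpha>_ge]) simp

text \<open>
  The substitution \<open>t = c x\<^sup>2 / 2\<close> turns the Hankel transform on \<open>(0, \<infinity>)\<close> into this operator.
  The absolute value only matters off \<open>(0, \<infinity>)\<close>, where it keeps the kernel bounded.
\<close>
definition U :: "(real \<Rightarrow> real) \<Rightarrow> real \<Rightarrow> real" where
  "U F \<sigma> = (LINT \<tau>|W. Bessel_Clifford \<alpha> \<bar>\<sigma> * \<tau>\<bar> * F \<tau>)"

lemma integrable_U_integrand:
  assumes "integrable W F"
  shows "integrable W (\<lambda>\<tau>. Bessel_Clifford \<alpha> \<bar>\<sigma> * \<tau>\<bar> * F \<tau>)"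
proof (rule Bochner_Integration.integrable_bound)
  show "integrable W (\<lambda>\<tau>. J0 * F \<tau>)" using assms by simp
  have [measurable]: "F \<in> borel_measurable borel" using borel_measurable_integrable[OF assms] by simp
  show "(\<lambda>\<tau>. Bessel_Clifford \<alpha> \<bar>\<sigma> * \<tau>\<bar> * F \<tau>) \<in> borel_measurable W" by measurable
  have "norm (Bessel_Clifford \<alpha> \<bar>\<sigma> * \<tau>\<bar> * F \<tau>) \<le> norm (J0 * F \<tau>)" for \<tau>
    using mult_right_mono[OF Bessel_Clifford_abs_bound[of "\<sigma> * \<tau>"], of "\<bar>F \<tau>\<bar>"] J0_pos by (simp add: abs_mult)
  then show "AE \<tau> in W. norm (Bessel_Clifford \<alpha> \<bar>\<sigma> * \<tau>\<bar> * F \<tau>) \<le> norm (J0 * F \<tau>)" by simp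
qed

lemma U_bound:
  assumes "integrable W F"
  shows "\<bar>U F \<sigma>\<bar> \<le> J0 * (LINT \<tau>|W. \<bar>F \<tau>\<bar>)"
proof -
  have "\<bar>U F \<sigma>\<bar> \<le> (LINT \<tau>|W. J0 * \<bar>F \<tau>\<bar>)" unfolding U_def
  proof (rule order.trans[OF integral_abs_bound integral_mono])
    show "integrable W (\<lambda>\<tau>. \<bar>Bessel_Clifford \<alpha> \<bar>\<sigma> * \<tau>\<bar> * F \<tau>\<bar>)"
      using integrable_U_integrand[OF assms] by simp
    show "integrable W (\<lambda>\<tau>. J0 * \<bar>F \<tau>\<bar>)" using assms by simp
    show "\<bar>Bessel_Clifford \<alpha> \<bar>\<sigma> * \<tau>\<bar> * F \<tau>\<bar> \<le> J0 * \<bar>F \<tau>\<bar>" for \<tau>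
      using mult_right_mono[OF Bessel_Clifford_abs_bound[of "\<sigma> * \<tau>"], of "\<bar>F \<tau>\<bar>"] by (simp add: abs_mult)
  qed
  then show ?thesis by simp
qed

lemma measurable_U [measurable]:
  assumes [measurable]: "F \<in> borel_measurable borel"
  shows "U F \<in> borel_measurable borel"
proof -
  have "(\<lambda>\<sigma>. LINT \<tau>|W. Bessel_Clifford \<alpha> \<bar>\<sigma> * \<tau>\<bar> * F \<tau>) \<in> borel_measurable borel"
    by measurable
  then show ?thesis unfolding U_def[abs_def] .
qed

lemma U_sum:
  assumes "\<And>i. i \<in> I \<Longrightarrow> integrable W (F i)"
  shows "U (\<lambda>t. \<Sum>i\<in>I. a i * F i t) \<sigma> = (\<Sum>i\<in>I. a i * U (F i) \<sigma>)"
proof -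
  have "U (\<lambda>t. \<Sum>i\<in>I. a i * F i t) \<sigma> = (LINT \<tau>|W. (\<Sum>i\<in>I. a i * (Bessel_Clifford \<alpha> \<bar>\<sigma> * \<tau>\<bar> * F i \<tau>)))"
    unfolding U_def by (intro Bochner_Integration.integral_cong refl) (simp add: sum_distrib_left mult.left_commute)
  also have "\<dots> = (\<Sum>i\<in>I. (LINT \<tau>|W. a i * (Bessel_Clifford \<alpha> \<bar>\<sigma> * \<tau>\<bar> * F i \<tau>)))"
    by (intro Bochner_Integration.integral_sum integrable_mult_right integrable_U_integrand assms)
  finally show ?thesis by (simp add: U_def)
qed

lemma U_diff:
  assumes "integrable W F" "integrable W G"
  shows "U (\<lambda>t. F t - G t) \<sigma> = U F \<sigma> - U G \<sigma>"
  unfolding U_def using integrable_U_integrand[OF assms(1)] integrable_U_integrand[OF assms(2)]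
  by (simp add: right_diff_distrib)

lemma integrable_mult_U:
  assumes "integrable W F" "integrable W G"
  shows "integrable W (\<lambda>t. G t * U F t)"
proof (rule Bochner_Integration.integrable_bound)
  have [measurable]: "F \<in> borel_measurable borel" "G \<in> borel_measurable borel"
    using borel_measurable_integrable[OF assms(1)] borel_measurable_integrable[OF assms(2)] by auto
  show "integrable W (\<lambda>t. (J0 * (LINT \<tau>|W. \<bar>F \<tau>\<bar>)) * G t)" using assms by simp
  show "(\<lambda>t. G t * U F t) \<in> borel_measurable W" by measurable
  have "norm (G t * U F t) \<le> norm ((J0 * (LINT \<tau>|W. \<bar>F \<tau>\<bar>)) * G t)" for t
  proof -
    have "\<bar>U F t\<bar> \<le> \<bar>J0 * (LINT \<tau>|W. \<bar>F \<tau>\<bar>)\<bar>" using U_bound[OF assms(1), of t] by linarith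
    then have "\<bar>U F t\<bar> * \<bar>G t\<bar> \<le> \<bar>J0 * (LINT \<tau>|W. \<bar>F \<tau>\<bar>)\<bar> * \<bar>G t\<bar>" by (rule mult_right_mono) simp
    then show ?thesis by (simp only: abs_mult real_norm_def mult.commute[of "\<bar>G t\<bar>"])
  qed
  then show "AE t in W. norm (G t * U F t) \<le> norm ((J0 * (LINT \<tau>|W. \<bar>F \<tau>\<bar>)) * G t)" by simp
qed

text \<open>The kernel depends on the product of its arguments only and is bounded by
  \<open>J0\<close>, so for integrable functions Fubini applies with dominating function J0 |G x| |F
  y|.\<close>

lemma U_symmetric:
  assumes "integrable W F" "integrable W G"
  shows "(LINT t|W. G t * U F t) = (LINT t|W. F t * U G t)"
proof -
  have [measurable]: "F \<in> borel_measurable borel" "G \<in> borel_measurable borel"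
    using borel_measurable_integrable[OF assms(1)] borel_measurable_integrable[OF assms(2)] by auto
  have I: "integrable (W \<Otimes>\<^sub>M W) (\<lambda>(x, y). G x * Bessel_Clifford \<alpha> \<bar>x * y\<bar> * F y)"
  proof (rule Bochner_Integration.integrable_bound)
    have "integrable (W \<Otimes>\<^sub>M W) (\<lambda>(x, y). G x * F y)"
    proof (rule W_pair.Fubini_integrable)
      show "integrable W (\<lambda>x. LINT y|W. norm (case (x, y) of (x, y) \<Rightarrow> G x * F y))"
        using assms by (simp add: abs_mult)
      show "AE x in W. integrable W (\<lambda>y. case (x, y) of (x, y) \<Rightarrow> G x * F y)"
        using assms by simp
    qed measurable
    then show "integrable (W \<Otimes>\<^sub>M W) (\<lambda>p. J0 * (\<lambda>(x, y). G x * F y) p)" by simp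
    have "norm (G x * Bessel_Clifford \<alpha> \<bar>x * y\<bar> * F y) \<le> norm (J0 * (G x * F y))" for x y :: real
    proof -
      have "\<bar>Bessel_Clifford \<alpha> \<bar>x * y\<bar>\<bar> * \<bar>G x * F y\<bar> \<le> \<bar>J0\<bar> * \<bar>G x * F y\<bar>"
        using Bessel_Clifford_abs_bound[of "x * y"] J0_pos by (intro mult_right_mono) auto
      then show ?thesis by (simp add: abs_mult mult_ac)
    qed
    then show "AE p in W \<Otimes>\<^sub>M W. norm (case p of (x, y) \<Rightarrow> G x * Bessel_Clifford \<alpha> \<bar>x * y\<bar> * F y)
        \<le> norm (J0 * (case p of (x, y) \<Rightarrow> G x * F y))"
      by (simp only: case_prod_beta AE_I2)
  qed measurable
  have "(LINT t|W. G t * U F t) = (LINT x|W. LINT y|W. G x * Bessel_Clifford \<alpha> \<bar>x * y\<bar> * F y)"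
    by (simp add: U_def mult.assoc)
  also have "\<dots> = (LINT y|W. LINT x|W. G x * Bessel_Clifford \<alpha> \<bar>x * y\<bar> * F y)"
    by (rule W_pair.Fubini_integral[OF I, symmetric])
  also have "\<dots> = (LINT y|W. F y * U G y)"
  proof (intro Bochner_Integration.integral_cong refl)
    fix y
    have "(LINT x|W. G x * Bessel_Clifford \<alpha> \<bar>x * y\<bar> * F y) = (LINT x|W. F y * (Bessel_Clifford \<alpha> \<bar>y * x\<bar> * G x))"
      by (intro Bochner_Integration.integral_cong refl) (simp add: mult_ac)
    then show "(LINT x|W. G x * Bessel_Clifford \<alpha> \<bar>x * y\<bar> * F y) = F y * U G y" by (simp add: U_def)
  qed
  finally show ?thesis .
qed

section \<open>The operator U on exponentials and its contractivity\<close>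

text \<open>The series of the kernel is integrated term by term. The hypothesis \<open>sm\<close> is
  exactly the convergence of the sum of the L^1 norms; each caller has that series in closed
  form.\<close>

lemma U_power_exp_sums:
  assumes s: "s > 0" and \<sigma>: "\<sigma> \<ge> 0"
    and sm: "summable (\<lambda>m. \<sigma>^m / fact m * (Gamma (real m + real k + \<alpha> + 1) / Gamma (real m + \<alpha> + 1)) / s powr (real m + real k + \<alpha> + 1))"
  shows "(\<lambda>m. (-\<sigma>)^m / fact m * (Gamma (real m + real k + \<alpha> + 1) / Gamma (real m + \<alpha> + 1)) / s powr (real m + real k + \<alpha> + 1))
    sums U (\<lambda>t. t^k * exp (- s * t)) \<sigma>"
proof -
  let ?c = "\<lambda>m. (-1)^m / (fact m * Gamma (real m + \<alpha> + 1)) :: real"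
  let ?f = "\<lambda>m t. ?c m * \<sigma>^m * (t ^ (m + k) * exp (- s * t))"
  have i: "has_bochner_integral W (\<lambda>t. t^(m+k) * exp (- s * t)) (Gamma (real m + real k + \<alpha> + 1) / s powr (real m + real k + \<alpha> + 1))" for m
    using has_bochner_integral_W_exp[OF s, of "m+k"] by (simp add: add_ac)
  have "(\<lambda>m. integral\<^sup>L W (?f m)) sums (LINT t|W. (\<Sum>m. ?f m t))"
  proof (rule sums_integral)
    show "integrable W (?f m)" for m by (intro integrable_mult_right integrable_W_exp s)
    show "AE t in W. summable (\<lambda>m. norm (?f m t))"
    proof (rule AE_W_I)
      fix t :: real assume "t > 0"
      have "summable (\<lambda>m. norm (?c m * (\<sigma> * t)^m) * (t^k * exp (- s * t)))"
        by (intro summable_mult2 summable_Bessel_Clifford \<alpha>_ge)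
      then show "summable (\<lambda>m. norm (?f m t))" using \<open>t > 0\<close>
        by (simp add: abs_mult power_mult_distrib power_add mult_ac)
    qed
    have "(LINT t|W. norm (?f m t)) = \<sigma>^m / fact m * (Gamma (real m + real k + \<alpha> + 1) / Gamma (real m + \<alpha> + 1)) / s powr (real m + real k + \<alpha> + 1)" for m
    proof -
      have "(LINT t|W. norm (?f m t)) = (LINT t|W. \<sigma>^m / (fact m * Gamma (real m + \<alpha> + 1)) * (t ^ (m + k) * exp (- s * t)))"
      proof (rule integral_cong_AE)
        show "AE t in W. norm (?f m t) = \<sigma>^m / (fact m * Gamma (real m + \<alpha> + 1)) * (t ^ (m + k) * exp (- s * t))"
          using \<sigma> Gamma_pos[of m] by (intro AE_W_I) (simp add: abs_mult)
      qed measurable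
      also have "\<dots> = \<sigma>^m / (fact m * Gamma (real m + \<alpha> + 1)) * (Gamma (real m + real k + \<alpha> + 1) / s powr (real m + real k + \<alpha> + 1))"
        using has_bochner_integral_integral_eq[OF i] by simp
      finally show ?thesis by simp
    qed
    then show "summable (\<lambda>m. LINT t|W. norm (?f m t))" using sm by simp
  qed
  moreover have "integral\<^sup>L W (?f m) = (-\<sigma>)^m / fact m * (Gamma (real m + real k + \<alpha> + 1) / Gamma (real m + \<alpha> + 1)) / s powr (real m + real k + \<alpha> + 1)" for m
  proof -
    have "integral\<^sup>L W (?f m) = ?c m * \<sigma>^m * (Gamma (real m + real k + \<alpha> + 1) / s powr (real m + real k + \<alpha> + 1))"
      using has_bochner_integral_integral_eq[OF i] by simp
    then show ?thesis unfolding power_minus[of \<sigma> m] by simp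
  qed
  moreover have "(LINT t|W. (\<Sum>m. ?f m t)) = U (\<lambda>t. t^k * exp (- s * t)) \<sigma>"
    unfolding U_def
  proof (rule integral_cong_AE)
    show "AE t in W. (\<Sum>m. ?f m t) = Bessel_Clifford \<alpha> \<bar>\<sigma> * t\<bar> * (t^k * exp (- s * t))"
    proof (rule AE_W_I)
      fix t :: real assume "t > 0"
      have "(\<Sum>m. ?f m t) = (\<Sum>m. ?c m * (\<sigma> * t)^m * (t^k * exp (- s * t)))"
        by (simp add: power_mult_distrib power_add mult_ac)
      also have "\<dots> = Bessel_Clifford \<alpha> (\<sigma> * t) * (t^k * exp (- s * t))"
        unfolding Bessel_Clifford_def by (intro suminf_mult2[symmetric] summable_Bessel_Clifford' \<alpha>_ge)
      finally show "(\<Sum>m. ?f m t) = Bessel_Clifford \<alpha> \<bar>\<sigma> * t\<bar> * (t^k * exp (- s * t))"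
        using \<sigma> \<open>t > 0\<close> by simp
    qed
  qed measurable
  ultimately show ?thesis by simp
qed

text \<open>For \<open>k = 0\<close> the Gamma quotient is 1 and the exponential series of
  -\<sigma>/s remains. The rates s and 1/s are exchanged, so the span of the exponentials is
  invariant.\<close>

lemma U_exp:
  assumes s: "s > 0" and \<sigma>: "\<sigma> \<ge> 0"
  shows "U (\<lambda>t. exp (- s * t)) \<sigma> = exp (- \<sigma> / s) / s powr (\<alpha> + 1)"
proof -
  have eq: "x^m / fact m * (Gamma (real m + real 0 + \<alpha> + 1) / Gamma (real m + \<alpha> + 1)) / s powr (real m + real 0 + \<alpha> + 1)
      = ((x / s)^m /\<^sub>R fact m) / s powr (\<alpha> + 1)" for x m
  proof -
    have "s powr (real m + real 0 + \<alpha> + 1) = s ^ m * s powr (\<alpha> + 1)"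
      using s powr_add[of s "real m" "\<alpha> + 1"] by (simp add: add_ac powr_realpow)
    moreover have "Gamma (real m + \<alpha> + 1) \<noteq> 0" using Gamma_pos[of m] by simp
    ultimately show ?thesis by (simp add: power_divide divide_inverse power_mult_distrib power_inverse)
  qed
  have "summable (\<lambda>m. ((\<sigma> / s)^m /\<^sub>R fact m) / s powr (\<alpha> + 1))"
    by (intro summable_divide sums_summable[OF exp_converges])
  from U_power_exp_sums[OF s \<sigma>, of 0, unfolded eq, OF this]
  have "(\<lambda>m. ((- \<sigma> / s)^m /\<^sub>R fact m) / s powr (\<alpha> + 1)) sums U (\<lambda>t. exp (- s * t)) \<sigma>" by simp
  moreover have "(\<lambda>m. ((- \<sigma> / s)^m /\<^sub>R fact m) / s powr (\<alpha> + 1)) sums (exp (- \<sigma> / s) / s powr (\<alpha> + 1))"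
    by (intro sums_divide exp_converges)
  ultimately show ?thesis using sums_unique2 by blast
qed

lemma sq_integrable_exp:
  assumes "s > 0" shows "(\<lambda>t. t^k * exp (- s * t)) \<in> sq_integrable W"
proof -
  have "(\<lambda>t. (t^k * exp (- s * t))\<^sup>2) = (\<lambda>t. t^(2*k) * exp (- (2 * s) * t))"
  proof
    fix t
    have "(exp (- s * t))\<^sup>2 = exp (- (2 * s) * t)" by (simp flip: exp_double)
    then show "(t^k * exp (- s * t))\<^sup>2 = t^(2*k) * exp (- (2 * s) * t)"
      by (simp only: power_mult_distrib power_mult[symmetric] mult.commute[of 2 k])
  qed
  then show ?thesis using integrable_W_exp[of "2 * s" "2 * k"] assms by (simp add: sq_integrable_def)
qed

text \<open>
  The bound \<open>\<parallel>U F\<parallel> \<le> \<parallel>F\<parallel>\<close> in weak form, which passes to dominated pointwise limits of \<open>F\<close> and needs no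
  decay of \<open>U F\<close>.
\<close>
definition contracted :: "(real \<Rightarrow> real) \<Rightarrow> bool" where
  "contracted F \<longleftrightarrow> F \<in> borel_measurable borel \<and> (\<forall>h. integrable W h \<longrightarrow> h \<in> sq_integrable W \<longrightarrow>
     (LINT t|W. h t * U F t)\<^sup>2 \<le> (LINT t|W. (h t)\<^sup>2) * (LINT t|W. (F t)\<^sup>2))"

text \<open>Dominated convergence in the inner integral of \<open>U\<close> and in both integrals of
  the inequality. The majorant is integrable and square integrable for \<open>W\<close>, and
  \<open>U_bound\<close> turns its L^1 norm into a uniform bound for the images.\<close>

lemma contracted_limit:
  assumes G: "\<And>m::nat. contracted (G m)" and F: "F \<in> borel_measurable borel"
    and lim: "\<And>t. t > 0 \<Longrightarrow> (\<lambda>m. G m t) \<longlonglongrightarrow> F t"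
    and bound: "\<And>m t. t > 0 \<Longrightarrow> \<bar>G m t\<bar> \<le> D * exp (- t / 2)"
  shows "contracted F"
  unfolding contracted_def
proof (intro conjI allI impI F)
  fix h assume h: "integrable W h" "h \<in> sq_integrable W"
  have [measurable]: "G m \<in> borel_measurable borel" for m using G by (simp add: contracted_def)
  have [measurable]: "h \<in> borel_measurable borel" using borel_measurable_integrable[OF h(1)] by simp
  note [measurable] = F
  have iD: "integrable W (\<lambda>t. D * exp (- t / 2))" using integrable_W_exp[of "1/2" 0] by simp
  have Gi: "integrable W (G m)" for m
    using iD
  proof (rule Bochner_Integration.integrable_bound)
    show "AE t in W. norm (G m t) \<le> norm (D * exp (- t / 2))"
    proof (rule AE_W_I)
      fix t :: real assume "t > 0"
      then show "norm (G m t) \<le> norm (D * exp (- t / 2))" using bound[of t m] by (simp add: abs_le_iff)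
    qed
  qed measurable
  have I2: "(\<lambda>m. LINT t|W. (G m t)\<^sup>2) \<longlonglongrightarrow> (LINT t|W. (F t)\<^sup>2)"
  proof (rule integral_dominated_convergence[where w="\<lambda>t. D\<^sup>2 * exp (- t)"])
    show "integrable W (\<lambda>t. D\<^sup>2 * exp (- t))" using integrable_W_exp[of 1 0] by simp
    show "AE t in W. (\<lambda>m. (G m t)\<^sup>2) \<longlonglongrightarrow> (F t)\<^sup>2" by (intro AE_W_I tendsto_power lim)
    show "AE t in W. norm ((G m t)\<^sup>2) \<le> D\<^sup>2 * exp (- t)" for m
    proof (rule AE_W_I)
      fix t :: real assume "t > 0"
      have "(G m t)\<^sup>2 \<le> (D * exp (- t / 2))\<^sup>2" using power_mono[OF bound[OF \<open>t > 0\<close>, of m], of 2] by simp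
      also have "\<dots> = D\<^sup>2 * exp (- t)" by (simp add: power_mult_distrib flip: exp_double)
      finally show "norm ((G m t)\<^sup>2) \<le> D\<^sup>2 * exp (- t)" by simp
    qed
  qed measurable
  have U_lim: "(\<lambda>m. U (G m) \<sigma>) \<longlonglongrightarrow> U F \<sigma>" for \<sigma>
    unfolding U_def
  proof (rule integral_dominated_convergence[where w="\<lambda>t. J0 * (D * exp (- t / 2))"])
    show "integrable W (\<lambda>t. J0 * (D * exp (- t / 2)))" using iD by simp
    show "AE t in W. (\<lambda>m. Bessel_Clifford \<alpha> \<bar>\<sigma> * t\<bar> * G m t) \<longlonglongrightarrow> Bessel_Clifford \<alpha> \<bar>\<sigma> * t\<bar> * F t"
      by (intro AE_W_I tendsto_mult_left lim)
    show "AE t in W. norm (Bessel_Clifford \<alpha> \<bar>\<sigma> * t\<bar> * G m t) \<le> J0 * (D * exp (- t / 2))" for m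
    proof (rule AE_W_I)
      fix t :: real assume "t > 0"
      then show "norm (Bessel_Clifford \<alpha> \<bar>\<sigma> * t\<bar> * G m t) \<le> J0 * (D * exp (- t / 2))"
        using mult_mono[OF Bessel_Clifford_abs_bound[of "\<sigma> * t"] bound[of t m]] J0_pos by (simp add: abs_mult)
    qed
  qed measurable
  have "(\<lambda>m. LINT t|W. h t * U (G m) t) \<longlonglongrightarrow> (LINT t|W. h t * U F t)"
  proof (rule integral_dominated_convergence[where w="\<lambda>t. \<bar>h t\<bar> * (J0 * (LINT t|W. D * exp (- t / 2)))"])
    show "integrable W (\<lambda>t. \<bar>h t\<bar> * (J0 * (LINT t|W. D * exp (- t / 2))))" using h by simp
    show "AE t in W. (\<lambda>m. h t * U (G m) t) \<longlonglongrightarrow> h t * U F t"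
      by (intro AE_W_I tendsto_mult_left U_lim)
    have UB: "\<bar>U (G m) t\<bar> \<le> J0 * (LINT t|W. D * exp (- t / 2))" for m t
    proof (rule order.trans[OF U_bound[OF Gi]])
      have "(LINT t|W. \<bar>G m t\<bar>) \<le> (LINT t|W. D * exp (- t / 2))"
        using Gi[of m] iD bound by (intro integral_mono_AE AE_W_I) auto
      then show "J0 * (LINT \<tau>|W. \<bar>G m \<tau>\<bar>) \<le> J0 * (LINT t|W. D * exp (- t / 2))"
        using J0_pos by (intro mult_left_mono) auto
    qed
    show "AE t in W. norm (h t * U (G m) t) \<le> \<bar>h t\<bar> * (J0 * (LINT t|W. D * exp (- t / 2)))" for m
      unfolding real_norm_def abs_mult by (intro AE_I2 mult_left_mono UB abs_ge_zero)
  qed measurable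
  then have "(\<lambda>m. (LINT t|W. h t * U (G m) t)\<^sup>2) \<longlonglongrightarrow> (LINT t|W. h t * U F t)\<^sup>2" by (rule tendsto_power)
  moreover have "(\<lambda>m. (LINT t|W. (h t)\<^sup>2) * (LINT t|W. (G m t)\<^sup>2)) \<longlonglongrightarrow> (LINT t|W. (h t)\<^sup>2) * (LINT t|W. (F t)\<^sup>2)"
    by (intro tendsto_mult_left I2)
  ultimately show "(LINT t|W. h t * U F t)\<^sup>2 \<le> (LINT t|W. (h t)\<^sup>2) * (LINT t|W. (F t)\<^sup>2)"
    by (rule LIMSEQ_le) (use G h in \<open>auto simp: contracted_def\<close>)
qed

text \<open>On exponentials \<open>U\<close> is explicit, and it is visibly isometric on their span.\<close>
lemma contracted_exp_sum:
  fixes a s :: "nat \<Rightarrow> real"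
  assumes s: "\<And>i. i < N \<Longrightarrow> s i > 0"
  shows "contracted (\<lambda>t. \<Sum>i<N. a i * exp (- s i * t))"
  unfolding contracted_def
proof (intro conjI allI impI)
  let ?F = "\<lambda>t. \<Sum>i<N. a i * exp (- s i * t)"
  \<comment> \<open>The image of \<open>?F\<close> under \<open>U\<close> on the half-line, by
    \<open>U_exp\<close>.\<close>
  let ?V = "\<lambda>t. \<Sum>i<N. (a i / s i powr (\<alpha> + 1)) * exp (- (1 / s i) * t)"
  show "?F \<in> borel_measurable borel" by measurable
  fix h assume h: "integrable W h" "h \<in> sq_integrable W"
  have [measurable]: "h \<in> borel_measurable borel" using borel_measurable_integrable[OF h(1)] by simp
  have UF: "U ?F \<sigma> = ?V \<sigma>" if "\<sigma> > 0" for \<sigma>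
  proof -
    have "U ?F \<sigma> = (\<Sum>i<N. a i * U (\<lambda>t. exp (- s i * t)) \<sigma>)"
      by (rule U_sum) (use integrable_W_exp[of _ 0] s in simp)
    also have "\<dots> = ?V \<sigma>" using s that by (intro sum.cong refl) (simp add: U_exp[simplified])
    finally show ?thesis .
  qed
  \<comment> \<open>The Gram matrix of exponentials with rates r_i has entries Gamma (\<alpha> + 1)
    / (r_i + r_j)^(\<alpha> + 1).\<close>
  have sum_sq: "(LINT t|W. (\<Sum>i<N. c i * exp (- r i * t))\<^sup>2) = (\<Sum>i<N. \<Sum>j<N. c i * c j * (Gamma (\<alpha> + 1) / (r i + r j) powr (\<alpha> + 1)))"
    if r: "\<And>i. i < N \<Longrightarrow> r i > 0" for c r :: "nat \<Rightarrow> real"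
  proof -
    have "(LINT t|W. (\<Sum>i<N. c i * exp (- r i * t))\<^sup>2) = (LINT t|W. (\<Sum>i<N. \<Sum>j<N. c i * c j * exp (- (r i + r j) * t)))"
    proof (intro Bochner_Integration.integral_cong refl)
      fix t
      have "(\<Sum>i<N. c i * exp (- r i * t))\<^sup>2 = (\<Sum>i<N. \<Sum>j<N. (c i * exp (- r i * t)) * (c j * exp (- r j * t)))"
        by (simp add: power2_eq_square sum_product)
      also have "\<dots> = (\<Sum>i<N. \<Sum>j<N. c i * c j * exp (- (r i + r j) * t))"
      proof (intro sum.cong refl)
        fix i j
        have "exp (- (r i + r j) * t) = exp (- r i * t) * exp (- r j * t)"
          by (subst exp_add[symmetric]) (simp add: algebra_simps)
        then show "(c i * exp (- r i * t)) * (c j * exp (- r j * t)) = c i * c j * exp (- (r i + r j) * t)" by simp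
      qed
      finally show "(\<Sum>i<N. c i * exp (- r i * t))\<^sup>2 = (\<Sum>i<N. \<Sum>j<N. c i * c j * exp (- (r i + r j) * t))" .
    qed
    also have "\<dots> = (\<Sum>i<N. \<Sum>j<N. (LINT t|W. c i * c j * exp (- (r i + r j) * t)))"
    proof -
      have i: "integrable W (\<lambda>t. c i * c j * exp (- (r i + r j) * t))" if "i < N" "j < N" for i j
        using integrable_W_exp[of "r i + r j" 0] r[OF that(1)] r[OF that(2)] by (intro integrable_mult_right) simp
      show ?thesis using i by (subst Bochner_Integration.integral_sum) (auto intro!: sum.cong Bochner_Integration.integral_sum Bochner_Integration.integrable_sum)
    qed
    also have "\<dots> = (\<Sum>i<N. \<Sum>j<N. c i * c j * (Gamma (\<alpha> + 1) / (r i + r j) powr (\<alpha> + 1)))"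
    proof (intro sum.cong refl)
      fix i j assume "i \<in> {..<N}" "j \<in> {..<N}"
      then have "r i + r j > 0" using r[of i] r[of j] by simp
      from integral_W_exp[OF this, of 0]
      show "(LINT t|W. c i * c j * exp (- (r i + r j) * t)) = c i * c j * (Gamma (\<alpha> + 1) / (r i + r j) powr (\<alpha> + 1))"
        by simp
    qed
    finally show ?thesis .
  qed
  have "(LINT t|W. (?V t)\<^sup>2) = (LINT t|W. (?F t)\<^sup>2)"
  proof (subst sum_sq[of s a, OF s], assumption, subst sum_sq[of "\<lambda>i. 1 / s i" "\<lambda>i. a i / s i powr (\<alpha> + 1)"])
    show "1 / s i > 0" if "i < N" for i using s[OF that] by simp
    show "(\<Sum>i<N. \<Sum>j<N. a i / s i powr (\<alpha> + 1) * (a j / s j powr (\<alpha> + 1)) * (Gamma (\<alpha> + 1) / (1 / s i + 1 / s j) powr (\<alpha> + 1))) =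
        (\<Sum>i<N. \<Sum>j<N. a i * a j * (Gamma (\<alpha> + 1) / (s i + s j) powr (\<alpha> + 1)))"
  proof (intro sum.cong refl)
    fix i j assume ij: "i \<in> {..<N}" "j \<in> {..<N}"
    have p: "s i > 0" "s j > 0" using s ij by auto
    \<comment> \<open>The isometry in one line: s_i s_j (1/s_i + 1/s_j) = s_i + s_j, so the
      normalising powers of \<open>?V\<close> turn one Gram matrix into the other.\<close>
    have "s i powr (\<alpha> + 1) * s j powr (\<alpha> + 1) * (1 / s i + 1 / s j) powr (\<alpha> + 1) = (s i + s j) powr (\<alpha> + 1)"
    proof -
      have "s i * s j * (1 / s i + 1 / s j) = s i + s j" using p by (simp add: field_simps)
      then show ?thesis using p by (simp flip: powr_mult)
    qed
    then show "a i / s i powr (\<alpha> + 1) * (a j / s j powr (\<alpha> + 1)) * (Gamma (\<alpha> + 1) / (1 / s i + 1 / s j) powr (\<alpha> + 1)) =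
        a i * a j * (Gamma (\<alpha> + 1) / (s i + s j) powr (\<alpha> + 1))"
      by (simp flip: \<open>_ = (s i + s j) powr _\<close>)
  qed
  qed
  moreover have "(LINT t|W. h t * U ?F t) = (LINT t|W. h t * ?V t)"
    by (rule integral_cong_AE) (measurable, intro AE_W_I, simp only: UF)
  moreover have "?V \<in> sq_integrable W"
  proof (rule sq_integrable_sum)
    fix i assume "i \<in> {..<N}"
    then show "(\<lambda>t. exp (- (1 / s i) * t)) \<in> sq_integrable W" using sq_integrable_exp[of "1 / s i" 0] s by simp
  qed
  ultimately show "(LINT t|W. h t * U ?F t)\<^sup>2 \<le> (LINT t|W. (h t)\<^sup>2) * (LINT t|W. (?F t)\<^sup>2)"
    using Cauchy_Schwarz_integral[OF h(2), of ?V] by simp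
qed

text \<open>With u = exp(-t/2), a polynomial in u times u is a combination of exponentials exp(-(i +
  1) t/2), to which \<open>contracted_exp_sum\<close> applies. Weierstrass approximation on [0, 1]
  is uniform, and the extra factor u makes all rates positive and supplies the majorant.\<close>

lemma contracted_continuous:
  assumes G: "continuous_on {0..1} (G :: real \<Rightarrow> real)" and m: "(\<lambda>t. G (exp (- t / 2))) \<in> borel_measurable borel"
  shows "contracted (\<lambda>t. exp (- t / 2) * G (exp (- t / 2)))"
proof -
  have "\<exists>p. real_polynomial_function p \<and> (\<forall>x\<in>{0..1}. \<bar>G x - p x\<bar> < inverse (real (Suc m)))" for m
  proof -
    have "inverse (real (Suc m)) > 0" by simp
    with Stone_Weierstrass_real_polynomial_function[OF compact_Icc G]
    obtain p where "real_polynomial_function p" "\<And>x. x \<in> {0..1} \<Longrightarrow> \<bar>G x - p x\<bar> < inverse (real (Suc m))"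
      by blast
    then show ?thesis by blast
  qed
  then have "\<forall>m. \<exists>p. real_polynomial_function p \<and> (\<forall>x\<in>{0..1}. \<bar>G x - p x\<bar> < inverse (real (Suc m)))" ..
  from choice[OF this] obtain p where p':
    "\<forall>m. real_polynomial_function (p m) \<and> (\<forall>x\<in>{0..1}. \<bar>G x - p m x\<bar> < inverse (real (Suc m)))" ..
  have p: "real_polynomial_function (p m)" "x \<in> {0..1} \<Longrightarrow> \<bar>G x - p m x\<bar> < inverse (real (Suc m))" for m x
    using p' by blast+
  have "bounded (G ` {0..1})" by (intro compact_imp_bounded compact_continuous_image G) simp
  then obtain B where B: "\<And>x. x \<in> {0..1} \<Longrightarrow> \<bar>G x\<bar> \<le> B" unfolding bounded_iff by fastforce
  show ?thesis
  proof (rule contracted_limit[where G="\<lambda>m t. exp (- t / 2) * p m (exp (- t / 2))" and D="B + 1"])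
    fix m
    obtain a N where pm: "p m = (\<lambda>x. \<Sum>i\<le>N. a i * x ^ i)"
      using p(1)[of m] unfolding real_polynomial_function_iff_sum by blast
    have "exp (- t / 2) * p m (exp (- t / 2)) = (\<Sum>i<Suc N. a i * exp (- (real (Suc i) / 2) * t))" for t
      unfolding pm sum_distrib_left lessThan_Suc_atMost
    proof (intro sum.cong refl)
      fix i
      have "exp (- (real (Suc i) / 2) * t) = exp (- t / 2) ^ Suc i"
        by (subst exp_of_nat_mult[symmetric]) (simp add: algebra_simps)
      then show "exp (- t / 2) * (a i * exp (- t / 2) ^ i) = a i * exp (- (real (Suc i) / 2) * t)" by simp
    qed
    then show "contracted (\<lambda>t. exp (- t / 2) * p m (exp (- t / 2)))"
      using contracted_exp_sum[of "Suc N" "\<lambda>i. real (Suc i) / 2" a] by simp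
  next
    show "(\<lambda>t. exp (- t / 2) * G (exp (- t / 2))) \<in> borel_measurable borel" using m by measurable
  next
    fix t :: real assume t: "t > 0"
    have e: "exp (- t / 2) \<in> {0..1}" using t by simp
    have "(\<lambda>m. G (exp (- t / 2)) - p m (exp (- t / 2))) \<longlonglongrightarrow> 0"
      by (rule Lim_null_comparison[OF _ LIMSEQ_inverse_real_of_nat]) (use p(2)[OF e] in \<open>auto intro: less_imp_le always_eventually\<close>)
    then have "(\<lambda>m. G (exp (- t / 2)) - (G (exp (- t / 2)) - p m (exp (- t / 2)))) \<longlonglongrightarrow> G (exp (- t / 2)) - 0"
      by (intro tendsto_diff tendsto_const)
    then show "(\<lambda>m. exp (- t / 2) * p m (exp (- t / 2))) \<longlonglongrightarrow> exp (- t / 2) * G (exp (- t / 2))"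
      by (intro tendsto_mult_left) simp
    fix m
    have "inverse (real (Suc m)) \<le> 1" by (simp add: field_simps)
    then have "\<bar>p m (exp (- t / 2))\<bar> \<le> B + 1" using B[OF e] p(2)[OF e, of m] by linarith
    then show "\<bar>exp (- t / 2) * p m (exp (- t / 2))\<bar> \<le> (B + 1) * exp (- t / 2)"
      by (simp add: abs_mult mult.commute)
  qed
qed

text \<open>In terms of u = exp(-t/2) the function is f (-2 ln u). The only critical point is u = 0,
  the image of infinity, and vanishing of \<open>f\<close> beyond \<open>R\<close> makes it constant
  0 there.\<close>

lemma contracted_compact_support:
  assumes f: "continuous_on UNIV (f :: real \<Rightarrow> real)" and R: "\<And>t. t \<ge> R \<Longrightarrow> f t = 0"
  shows "contracted (\<lambda>t. exp (- t / 2) * f t)"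
proof -
  define G where "G = (\<lambda>u. if u \<le> 0 then 0 else f (- 2 * ln u))"
  \<comment> \<open>Two overlapping open sets: on the first \<open>G\<close> is 0, on the second the
    logarithm is continuous.\<close>
  have "continuous_on ({..<exp (- R / 2)} \<union> {0<..}) G"
  proof (rule continuous_on_open_Un)
    have "G u = 0" if "u \<in> {..<exp (- R / 2)}" for u
    proof (cases "u \<le> 0")
      case False
      then have "ln u < - R / 2" using that by (subst exp_less_cancel_iff[symmetric]) simp
      then show ?thesis using R[of "- 2 * ln u"] by (simp add: G_def)
    qed (simp add: G_def)
    then show "continuous_on {..<exp (- R / 2)} G" by (subst continuous_on_cong[OF refl, of _ _ "\<lambda>_. 0"]) auto
    have "continuous_on {0<..} (\<lambda>u. f (- 2 * ln u))"
      by (intro continuous_on_compose2[OF f] continuous_intros) auto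
    then show "continuous_on {0<..} G" by (subst continuous_on_cong[OF refl, of _ _ "\<lambda>u. f (- 2 * ln u)"]) (auto simp: G_def)
  qed auto
  then have cG: "continuous_on {0..1} G" 
    by (rule continuous_on_subset) (auto simp: less_le)
  have GE: "G (exp (- t / 2)) = f t" for t by (simp add: G_def)
  have "f \<in> borel_measurable borel" using f by (rule borel_measurable_continuous_onI)
  from contracted_continuous[OF cG] this show ?thesis by (simp only: GE)
qed

text \<open>The jump at b is smoothed by continuous cutoffs. The growth condition on
  \<open>P\<close> makes exp(-t/2) P t bounded, so that half of the decay of exp(-t) is left over as
  the majorant.\<close>

lemma contracted_truncation:
  assumes P: "continuous_on UNIV (P :: real \<Rightarrow> real)" and D: "\<And>t. t > 0 \<Longrightarrow> \<bar>P t\<bar> \<le> D * exp (t / 2)"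
  shows "contracted (\<lambda>t. indicator {b<..} t * (exp (- t) * P t))"
proof -
  \<comment> \<open>The first factor is a ramp from 0 at b to 1 at b + 1/m, hence its limit at b
    itself is 0, as for the open half-line; the second falls from 1 to 0 on [m - 1, m].\<close>
  define cut where "cut = (\<lambda>(m::nat) t. max 0 (min 1 (real m * (t - b))) * max 0 (min 1 (real m - t)))"
  have cut: "\<bar>cut m t\<bar> \<le> 1" for m t
    unfolding cut_def abs_mult by (rule mult_le_one) auto
  show ?thesis
  proof (rule contracted_limit[where G="\<lambda>m t. exp (- t / 2) * (exp (- t / 2) * P t * cut m t)" and D=D])
    show "contracted (\<lambda>t. exp (- t / 2) * (exp (- t / 2) * P t * cut m t))" for m
    proof (rule contracted_compact_support[where R="real m"])
      show "continuous_on UNIV (\<lambda>t. exp (- t / 2) * P t * cut m t)"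
        unfolding cut_def by (intro continuous_intros P) auto
    qed (simp add: cut_def)
    have [measurable]: "P \<in> borel_measurable borel" using P by (rule borel_measurable_continuous_onI)
    show "(\<lambda>t. indicator {b<..} t * (exp (- t) * P t)) \<in> borel_measurable borel" by measurable
    fix t :: real assume t: "t > 0"
    have ee: "exp (- t / 2) * exp (- t / 2) = exp (- t)" by (simp flip: exp_add)
    have "(\<lambda>m. cut m t) \<longlonglongrightarrow> indicator {b<..} t"
    proof (cases "t > b")
      case True
      obtain m0 :: nat where m0: "real m0 > max (1 / (t - b)) (t + 1)" using reals_Archimedean2 by blast
      have "cut m t = 1" if "m \<ge> m0" for m
      proof -
        have "real m \<ge> real m0" using that by simp
        then have "real m > 1 / (t - b)" "real m > t + 1" using m0 by auto
        then have "real m * (t - b) \<ge> 1" "real m - t \<ge> 1" using True by (auto simp: field_simps)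
        then show ?thesis by (simp add: cut_def)
      qed
      then have "(\<lambda>m. cut m t) \<longlonglongrightarrow> 1" by (intro tendsto_eventually) (auto simp: eventually_sequentially)
      then show ?thesis using True by simp
    next
      case False
      then have H: "real m * (t - b) \<le> 0" for m by (intro mult_nonneg_nonpos) auto
      have "cut m t = 0" for m using H[of m] by (simp add: cut_def)
      then show ?thesis using False by simp
    qed
    then have "(\<lambda>m. exp (- t / 2) * (exp (- t / 2) * P t * cut m t)) \<longlonglongrightarrow> exp (- t / 2) * (exp (- t / 2) * P t * indicator {b<..} t)"
      by (intro tendsto_intros)
    then show "(\<lambda>m. exp (- t / 2) * (exp (- t / 2) * P t * cut m t)) \<longlonglongrightarrow> indicator {b<..} t * (exp (- t) * P t)"
      by (simp add: mult_ac ee flip: ee)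
    fix m
    have "\<bar>exp (- t / 2) * P t * cut m t\<bar> \<le> exp (- t / 2) * (D * exp (t / 2)) * 1"
      unfolding abs_mult by (intro mult_mono cut) (use D[OF t] in auto)
    also have "\<dots> = D" by (simp add: mult_ac flip: exp_add)
    finally show "\<bar>exp (- t / 2) * (exp (- t / 2) * P t * cut m t)\<bar> \<le> D * exp (- t / 2)"
      by (simp add: abs_mult mult.commute)
  qed
qed

end

section \<open>Laguerre polynomials\<close>

lemma Gamma_real_plus1: "x > 0 \<Longrightarrow> Gamma (x + 1) = x * Gamma (x :: real)"
  by (intro Gamma_plus1) (auto dest: nonpos_Ints_nonpos)

text \<open>Trinomial revision moves the binomial of i and j to k and j, and the binomial theorem
  does the rest. At z = -2 the factor 1 + z = -1 yields the eigenvalues of \<open>U\<close>; at z =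
  -1 the sum vanishes unless j = k, which yields orthogonality.\<close>

lemma sum_binomial_binomial_power:
  fixes z :: real
  assumes "j \<le> k"
  shows "(\<Sum>i\<le>k. real (k choose i) * real (i choose j) * z^i) = real (k choose j) * z^j * (1 + z)^(k - j)"
proof -
  have "(\<Sum>i\<le>k. real (k choose i) * real (i choose j) * z^i) = (\<Sum>i\<in>{j..k}. real (k choose i) * real (i choose j) * z^i)"
    by (intro sum.mono_neutral_right) (auto simp: not_le)
  also have "\<dots> = (\<Sum>l\<in>{0..k - j}. real (k choose (l + j)) * real ((l + j) choose j) * z^(l + j))"
    using assms sum.shift_bounds_cl_nat_ivl[of "\<lambda>i. real (k choose i) * real (i choose j) * z^i" 0 j "k - j"] by simp
  also have "\<dots> = (\<Sum>l\<le>k - j. real (k choose j) * z^j * (real ((k - j) choose l) * z^l * 1^(k - j - l)))"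
    unfolding atMost_atLeast0
  proof (intro sum.cong refl)
    fix l assume "l \<in> {0..k - j}"
    then have "(k choose (l + j)) * ((l + j) choose j) = (k choose j) * ((k - j) choose l)"
      using choose_mult[of j "l + j" k] assms by simp
    then have "real (k choose (l + j)) * real ((l + j) choose j) = real (k choose j) * real ((k - j) choose l)"
      by (simp flip: of_nat_mult)
    then show "real (k choose (l + j)) * real ((l + j) choose j) * z^(l + j) = real (k choose j) * z^j * (real ((k - j) choose l) * z^l * 1^(k - j - l))"
      by (simp add: power_add)
  qed
  also have "\<dots> = real (k choose j) * z^j * (\<Sum>l\<le>k - j. real ((k - j) choose l) * z^l * 1^(k - j - l))"
    by (simp only: sum_distrib_left)
  also have "(\<Sum>l\<le>k - j. real ((k - j) choose l) * z^l * 1^(k - j - l)) = (1 + z)^(k - j)"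
    by (subst binomial_ring[symmetric]) (simp add: add.commute)
  finally show ?thesis .
qed

text \<open>The quotient is the product of the factors m + \<alpha> + 1, ..., m + \<alpha> + k, a
  polynomial in m. Vandermonde's convolution expands it in binomials of m, which sum in closed form
  both against the exponential series and in alternating sums.\<close>

lemma Gamma_quotient_Vandermonde:
  fixes \<alpha> :: real
  assumes "\<alpha> \<ge> -1/2"
  shows "Gamma (real m + real k + \<alpha> + 1) / Gamma (real m + \<alpha> + 1) =
    Gamma (real k + \<alpha> + 1) * (\<Sum>j\<le>k. real (m choose j) * real (k choose j) * fact j / Gamma (real j + \<alpha> + 1))"
proof -
  have gb: "(z gchoose n) = Gamma (z + 1) / (fact n * Gamma (z - real n + 1))" if "z \<ge> -1/2" for z :: real and n
    using that by (intro gbinomial_Gamma) (auto dest: nonpos_Ints_nonpos)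
  have "Gamma (real m + real k + \<alpha> + 1) / Gamma (real m + \<alpha> + 1) = fact k * ((real m + (real k + \<alpha>)) gchoose k)"
    using assms by (subst gb) (simp_all add: add_ac)
  also have "((real m + (real k + \<alpha>)) gchoose k) = (\<Sum>j\<le>k. (real m gchoose j) * ((real k + \<alpha>) gchoose (k - j)))"
    unfolding gbinomial_Vandermonde[symmetric] atMost_atLeast0 ..
  also have "fact k * \<dots> = (\<Sum>j\<le>k. fact k * ((real m gchoose j) * ((real k + \<alpha>) gchoose (k - j))))"
    by (rule sum_distrib_left)
  also have "\<dots> = (\<Sum>j\<le>k. Gamma (real k + \<alpha> + 1) * (real (m choose j) * real (k choose j) * fact j / Gamma (real j + \<alpha> + 1)))"
  proof (intro sum.cong refl)
    fix j assume "j \<in> {..k}"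
    then have j: "j \<le> k" by simp
    have "((real k + \<alpha>) gchoose (k - j)) = Gamma (real k + \<alpha> + 1) / (fact (k - j) * Gamma (real j + \<alpha> + 1))"
      using assms j by (subst gb) (simp_all add: of_nat_diff add_ac)
    moreover have "fact k = real (k choose j) * fact j * fact (k - j)"
      unfolding binomial_fact[OF j] by simp
    moreover have "(real m gchoose j) = real (m choose j)" by (simp add: binomial_gbinomial)
    ultimately show "fact k * ((real m gchoose j) * ((real k + \<alpha>) gchoose (k - j))) =
        Gamma (real k + \<alpha> + 1) * (real (m choose j) * real (k choose j) * fact j / Gamma (real j + \<alpha> + 1))"
      by simp
  qed
  finally show ?thesis by (simp only: sum_distrib_left)
qed

text \<open>The factor x^j / j! splits off and leaves the exponential series in m - j; terms with m
  < j vanish.\<close>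

lemma sums_exp_binomial:
  fixes x :: real
  shows "(\<lambda>m. x^m / fact m * real (m choose j)) sums (x^j / fact j * exp x)"
proof -
  have "(\<lambda>m. x^j / fact j * (x^m /\<^sub>R fact m)) sums (x^j / fact j * exp x)"
    by (intro sums_mult exp_converges)
  moreover have "x^j / fact j * (x^m /\<^sub>R fact m) = x^(m + j) / fact (m + j) * real ((m + j) choose j)" for m
  proof -
    have "real ((m + j) choose j) = fact (m + j) / (fact j * fact m)"
      by (subst binomial_fact) auto
    then show ?thesis by (simp add: power_add divide_inverse)
  qed
  ultimately have "(\<lambda>m. x^(m + j) / fact (m + j) * real ((m + j) choose j)) sums (x^j / fact j * exp x)" by simp
  then show ?thesis
    by (subst sums_zero_iff_shift[symmetric]) (auto)
qed

text \<open>The generalised Laguerre polynomials in the usual normalisation. Writing the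
  coefficients with Gamma makes them cancel against the moments of \<open>W\<close>.\<close>

definition Laguerre :: "real \<Rightarrow> nat \<Rightarrow> real \<Rightarrow> real" where
  "Laguerre \<alpha> k t = Gamma (real k + \<alpha> + 1) / fact k * (\<Sum>i\<le>k. real (k choose i) * (-t)^i / Gamma (real i + \<alpha> + 1))"

lemma Laguerre_0: "\<alpha> \<ge> -1/2 \<Longrightarrow> Laguerre \<alpha> 0 t = 1"
proof -
  assume "\<alpha> \<ge> -1/2"
  then have "Gamma (\<alpha> + 1) > 0" by (intro Gamma_real_pos) auto
  then show ?thesis by (simp add: Laguerre_def)
qed

lemma Laguerre_1: "\<alpha> \<ge> -1/2 \<Longrightarrow> Laguerre \<alpha> 1 t = \<alpha> + 1 - t"
proof -
  assume a: "\<alpha> \<ge> -1/2"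
  then have G: "Gamma (\<alpha> + 1) > 0" by (intro Gamma_real_pos) auto
  have G2: "Gamma (\<alpha> + 2) = (\<alpha> + 1) * Gamma (\<alpha> + 1)" using Gamma_real_plus1[of "\<alpha> + 1"] a by (simp add: add_ac)
  have "Laguerre \<alpha> 1 t = Gamma (\<alpha> + 2) * (1 / Gamma (\<alpha> + 1) - t / Gamma (\<alpha> + 2))"
    by (simp add: Laguerre_def add_ac)
  moreover have "r * g * (1 / g - t / (r * g)) = r - t" if "g > 0" "r \<noteq> 0" for r g :: real
    using that by (simp add: field_simps)
  from this[OF G, of "\<alpha> + 1"] have "Gamma (\<alpha> + 2) * (1 / Gamma (\<alpha> + 1) - t / Gamma (\<alpha> + 2)) = \<alpha> + 1 - t"
    using a unfolding G2 by simp
  ultimately show ?thesis by (simp only:)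
qed

text \<open>
  The factor \<open>1 / fact (k - i)\<close>, continued by \<open>0\<close> to \<open>i > k\<close>, turns the three-term recurrence into
  one identity for all coefficients.
\<close>
lemma Laguerre_coeffs:
  assumes "k \<le> N"
  shows "Laguerre \<alpha> k t = (\<Sum>i\<le>N. (-1)^i * Gamma (real k + \<alpha> + 1) * (if i \<le> k then 1 / fact (k - i) else 0) / (fact i * Gamma (real i + \<alpha> + 1)) * t^i)"
proof -
  have "(\<Sum>i\<le>N. (-1)^i * Gamma (real k + \<alpha> + 1) * (if i \<le> k then 1 / fact (k - i) else 0) / (fact i * Gamma (real i + \<alpha> + 1)) * t^i)
    = (\<Sum>i\<le>k. (-1)^i * Gamma (real k + \<alpha> + 1) * (if i \<le> k then 1 / fact (k - i) else 0) / (fact i * Gamma (real i + \<alpha> + 1)) * t^i)"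
    using assms by (intro sum.mono_neutral_right) auto
  also have "\<dots> = (\<Sum>i\<le>k. Gamma (real k + \<alpha> + 1) / fact k * (real (k choose i) * (-t)^i / Gamma (real i + \<alpha> + 1)))"
  proof (intro sum.cong refl)
    fix i assume "i \<in> {..k}"
    then have i: "i \<le> k" by simp
    then have "real (k choose i) = fact k / (fact i * fact (k - i))" by (rule binomial_fact)
    moreover have "(-t)^i = (-1)^i * t^i" by (rule power_minus)
    ultimately show "(-1)^i * Gamma (real k + \<alpha> + 1) * (if i \<le> k then 1 / fact (k - i) else 0) / (fact i * Gamma (real i + \<alpha> + 1)) * t^i =
        Gamma (real k + \<alpha> + 1) / fact k * (real (k choose i) * (-t)^i / Gamma (real i + \<alpha> + 1))"
      using i by (simp add: mult_ac)
  qed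
  finally show ?thesis unfolding Laguerre_def by (simp only: sum_distrib_left)
qed

text \<open>Comparison of coefficients: all those of a given power share one common factor, and what
  is left is a polynomial identity in k, i and \<alpha>.\<close>

lemma Laguerre_recurrence:
  assumes \<alpha>: "\<alpha> \<ge> -1/2"
  shows "(real k + 2) * Laguerre \<alpha> (Suc (Suc k)) t =
    (2 * real k + 3 + \<alpha> - t) * Laguerre \<alpha> (Suc k) t - (real k + 1 + \<alpha>) * Laguerre \<alpha> k t"
proof -
  define r :: "nat \<Rightarrow> nat \<Rightarrow> real" where "r = (\<lambda>k i. if i \<le> k then 1 / fact (k - i) else 0)"
  define c where "c = (\<lambda>k i. (-1)^i * Gamma (real k + \<alpha> + 1) * r k i / (fact i * Gamma (real i + \<alpha> + 1)))"
  have L: "Laguerre \<alpha> j t = (\<Sum>i\<le>N. c j i * t^i)" if "j \<le> N" for j N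
    unfolding Laguerre_coeffs[OF that] c_def r_def ..
  \<comment> \<open>Also true for i = k + 1, where the factor vanishes, and beyond, where both sides
    are 0.\<close>
  have r1: "r k i = (real k + 1 - real i) * r (Suc k) i" for k i
  proof (cases "i \<le> k")
    case True
    then have "fact (Suc k - i) = (real k + 1 - real i) * fact (k - i)" by (simp add: Suc_diff_le of_nat_diff)
    moreover have "real k + 1 - real i \<noteq> 0" using True by simp
    ultimately show ?thesis using True by (simp add: r_def)
  next
    case False
    then show ?thesis by (cases "i = Suc k") (auto simp: r_def)
  qed
  have GS: "Gamma (real (Suc j) + \<alpha> + 1) = (real j + \<alpha> + 1) * Gamma (real j + \<alpha> + 1)" for j
    using Gamma_real_plus1[of "real j + \<alpha> + 1"] \<alpha> by (simp add: add_ac)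
  have Gp: "Gamma (real j + \<alpha> + 1) > 0" for j using \<alpha> by (intro Gamma_real_pos) auto
  have tL: "t * Laguerre \<alpha> (Suc k) t = (\<Sum>i\<le>Suc (Suc k). (if i = 0 then 0 else c (Suc k) (i - 1)) * t^i)"
  proof -
    have "t * Laguerre \<alpha> (Suc k) t = (\<Sum>i\<le>Suc k. c (Suc k) i * t^Suc i)"
      unfolding L[OF order.refl] sum_distrib_left by (intro sum.cong refl) simp
    also have "\<dots> = (\<Sum>i\<le>Suc (Suc k). (if i = 0 then 0 else c (Suc k) (i - 1)) * t^i)"
      by (subst sum.atMost_Suc_shift[of _ "Suc k"]) simp
    finally show ?thesis .
  qed
  have coeff: "(real k + 2) * c (Suc (Suc k)) i = (2 * real k + 3 + \<alpha>) * c (Suc k) i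
      - (if i = 0 then 0 else c (Suc k) (i - 1)) - (real k + 1 + \<alpha>) * c k i" for i
  proof -
    \<comment> \<open>The common factor of the four coefficients is D g X; dividing by it leads to
      the identity \<open>id\<close>.\<close>
    define X where "X = r (Suc (Suc k)) i"
    define D where "D = (-1)^i / (fact i * Gamma (real i + \<alpha> + 1))"
    define g where "g = Gamma (real k + \<alpha> + 1)"
    have 1: "r (Suc k) i = (real k + 2 - real i) * X" using r1[of "Suc k" i] by (simp add: X_def)
    have 0: "r k i = (real k + 1 - real i) * ((real k + 2 - real i) * X)" using r1[of k i] 1 by simp
    have c2: "c (Suc (Suc k)) i = D * ((real k + \<alpha> + 2) * (real k + \<alpha> + 1) * g) * X"
      unfolding c_def D_def g_def GS X_def[symmetric] by (simp add: add_ac)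
    have c1: "c (Suc k) i = D * ((real k + \<alpha> + 1) * g) * ((real k + 2 - real i) * X)"
      unfolding c_def D_def g_def GS 1 by simp
    have c0: "c k i = D * g * ((real k + 1 - real i) * ((real k + 2 - real i) * X))"
      unfolding c_def D_def g_def 0 by simp
    \<comment> \<open>Multiplication by t shifts the index. At i = 0 the factor
      \<open>real i\<close> makes the formula agree with the missing coefficient.\<close>
    have cs: "(if i = 0 then 0 else c (Suc k) (i - 1)) = - D * ((real k + \<alpha> + 1) * g) * (real i * (real i + \<alpha>)) * X"
    proof (cases i)
      case (Suc l)
      have rl: "r (Suc k) l = X" unfolding X_def Suc r_def by simp
      have "(-1)^l = - ((-1::real)^i)" using Suc by simp
      moreover have "fact i = real i * fact l" using Suc by simp
      moreover have "Gamma (real i + \<alpha> + 1) = (real i + \<alpha>) * Gamma (real l + \<alpha> + 1)" using GS[of l] Suc by (simp add: add_ac)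
      moreover have "real i \<noteq> 0" "real i + \<alpha> \<noteq> 0" using Suc \<alpha> by auto
      ultimately have D: "(-1)^l / (fact l * Gamma (real l + \<alpha> + 1)) = - D * (real i * (real i + \<alpha>))"
        using Gp[of l] unfolding D_def by simp
      have "c (Suc k) l = ((-1)^l / (fact l * Gamma (real l + \<alpha> + 1))) * ((real k + \<alpha> + 1) * g) * X"
        unfolding c_def rl GS g_def by simp
      then have "c (Suc k) l = - D * (real i * (real i + \<alpha>)) * ((real k + \<alpha> + 1) * g) * X"
        unfolding D .
      then show ?thesis using Suc by (simp add: mult_ac)
    qed simp
    have id: "(real k + 2) * ((real k + \<alpha> + 2) * (real k + \<alpha> + 1)) = (2 * real k + 3 + \<alpha>) * ((real k + \<alpha> + 1) * (real k + 2 - real i))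
       + (real k + \<alpha> + 1) * (real i * (real i + \<alpha>)) - (real k + 1 + \<alpha>) * ((real k + 1 - real i) * (real k + 2 - real i))"
      by algebra
    show ?thesis unfolding c2 c1 c0 cs using arg_cong[OF id, of "\<lambda>z. D * g * X * z"] by (simp add: algebra_simps)
  qed
  have "(real k + 2) * Laguerre \<alpha> (Suc (Suc k)) t = (\<Sum>i\<le>Suc (Suc k). ((real k + 2) * c (Suc (Suc k)) i) * t^i)"
    unfolding L[OF order.refl] by (simp only: sum_distrib_left mult.assoc)
  also have "\<dots> = (2 * real k + 3 + \<alpha>) * (\<Sum>i\<le>Suc (Suc k). c (Suc k) i * t^i)
      - (\<Sum>i\<le>Suc (Suc k). (if i = 0 then 0 else c (Suc k) (i - 1)) * t^i) - (real k + 1 + \<alpha>) * (\<Sum>i\<le>Suc (Suc k). c k i * t^i)"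
    unfolding coeff by (simp only: sum_distrib_left sum_subtractf[symmetric] left_diff_distrib mult.assoc)
  also have "\<dots> = (2 * real k + 3 + \<alpha>) * Laguerre \<alpha> (Suc k) t - t * Laguerre \<alpha> (Suc k) t - (real k + 1 + \<alpha>) * Laguerre \<alpha> k t"
    unfolding tL by (subst (1 2) L[of _ "Suc (Suc k)"]) simp_all
  finally show ?thesis by (simp add: left_diff_distrib)
qed

text \<open>Beyond \<open>4 n + 2 \<alpha> + 2\<close> the recurrence is dominated by its first term.\<close>
lemma Laguerre_growth:
  assumes \<alpha>: "\<alpha> \<ge> -1/2" and t: "t \<ge> 4 * real n + 2 * \<alpha> + 2" and "Suc k \<le> n"
  shows "0 < (-1)^k * Laguerre \<alpha> k t \<and> (-1)^k * Laguerre \<alpha> k t \<le> (-1)^Suc k * Laguerre \<alpha> (Suc k) t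
    \<and> (real k + 1) * ((-1)^Suc k * Laguerre \<alpha> (Suc k) t) \<le> t * ((-1)^k * Laguerre \<alpha> k t)"
  using \<open>Suc k \<le> n\<close>
proof (induction k)
  case 0
  then have "t \<ge> 4 + 2 * \<alpha> + 2" using t by simp
  then show ?case using \<alpha> Laguerre_0[OF \<alpha>] Laguerre_1[OF \<alpha>] by simp
next
  case (Suc k)
  \<comment> \<open>The leading sign is removed: to the right of all zeros these values are
    positive.\<close>
  define M where "M = (\<lambda>k. (-1)^k * Laguerre \<alpha> k t)"
  have IH: "0 < M k" "M k \<le> M (Suc k)" using Suc by (auto simp: M_def)
  have t': "t \<ge> 4 * real k + 10 + 2 * \<alpha>" using t Suc.prems by linarith
  have rec: "(real k + 2) * M (Suc (Suc k)) = (t - 2 * real k - 3 - \<alpha>) * M (Suc k) - (real k + 1 + \<alpha>) * M k"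
  proof -
    have "(real k + 2) * M (Suc (Suc k)) = (-1)^k * ((real k + 2) * Laguerre \<alpha> (Suc (Suc k)) t)" by (simp add: M_def)
    also have "\<dots> = (t - 2 * real k - 3 - \<alpha>) * M (Suc k) - (real k + 1 + \<alpha>) * M k"
      unfolding Laguerre_recurrence[OF \<alpha>] M_def by (simp add: right_diff_distrib left_diff_distrib ring_distribs)
    finally show ?thesis .
  qed
  have ka: "real k + 1 + \<alpha> \<ge> 0" using \<alpha> by linarith
  have "(real k + 1 + \<alpha>) * M k \<le> (real k + 1 + \<alpha>) * M (Suc k)" using ka IH by (intro mult_left_mono) auto
  \<comment> \<open>The subtracted term is absorbed by the first since M does not decrease; the
    coefficient left is at least k + 6 by \<open>t'\<close>, more than the k + 2 that is
    needed.\<close>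
  then have "(t - 3 * real k - 4 - 2 * \<alpha>) * M (Suc k) \<le> (real k + 2) * M (Suc (Suc k))"
    unfolding rec by (simp add: algebra_simps)
  moreover have "(real k + 2) * M (Suc k) \<le> (t - 3 * real k - 4 - 2 * \<alpha>) * M (Suc k)"
    using t' IH by (intro mult_right_mono) auto
  ultimately have "(real k + 2) * M (Suc k) \<le> (real k + 2) * M (Suc (Suc k))" by linarith
  then have "M (Suc k) \<le> M (Suc (Suc k))" by (subst (asm) mult_le_cancel_left_pos) auto
  moreover have "(real (Suc k) + 1) * M (Suc (Suc k)) \<le> t * M (Suc k)"
  proof -
    have "0 \<le> (real k + 1 + \<alpha>) * M k" using ka IH by simp
    moreover have "0 \<le> (2 * real k + 3 + \<alpha>) * M (Suc k)" using \<alpha> IH by (intro mult_nonneg_nonneg) auto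
    ultimately show ?thesis using rec by (simp add: algebra_simps)
  qed
  ultimately show ?case using IH unfolding M_def by simp
qed

text \<open>The last estimate of \<open>Laguerre_growth\<close> is iterated: each step costs at most
  a factor t / (k + 1).\<close>

lemma Laguerre_abs_bound:
  assumes \<alpha>: "\<alpha> \<ge> -1/2" and t: "t \<ge> 4 * real n + 2 * \<alpha> + 2" and "k \<le> n"
  shows "\<bar>Laguerre \<alpha> k t\<bar> \<le> t^k / fact k"
  using \<open>k \<le> n\<close>
proof (induction k)
  case 0
  then show ?case by (simp add: Laguerre_0[OF \<alpha>])
next
  case (Suc k)
  define M where "M = (\<lambda>k. (-1)^k * Laguerre \<alpha> k t)"
  have M: "0 < M k" "M k \<le> M (Suc k)" "(real k + 1) * M (Suc k) \<le> t * M k"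
    using Laguerre_growth[OF \<alpha> t Suc.prems] by (auto simp: M_def)
  have abs: "\<bar>M k\<bar> = \<bar>Laguerre \<alpha> k t\<bar>" for k by (simp add: M_def abs_mult power_abs)
  have "t \<ge> 0" using t \<alpha> by linarith
  have "M k \<le> t^k / fact k" using Suc abs[of k] M by simp
  then have "t * M k \<le> t * (t^k / fact k)" using \<open>t \<ge> 0\<close> by (intro mult_left_mono)
  then have "(real k + 1) * M (Suc k) \<le> t^Suc k / fact k" using M by simp
  then have "M (Suc k) \<le> t^Suc k / fact k / (real k + 1)" by (subst pos_le_divide_eq) (auto simp: mult.commute)
  then show ?case using abs[of "Suc k"] M by (simp add: mult.commute add.commute)
qed

text \<open>The diagonal of the Christoffel-Darboux kernel: the weights are the reciprocals of the
  squared norms of the Laguerre polynomials for the weight t^\<alpha> exp(-t).\<close>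

definition Laguerre_kernel :: "real \<Rightarrow> nat \<Rightarrow> real \<Rightarrow> real" where
  "Laguerre_kernel \<alpha> n t = (\<Sum>k\<le>n. fact k / Gamma (real k + \<alpha> + 1) * (Laguerre \<alpha> k t)\<^sup>2)"

text \<open>With s = k + 1, t^2 \<ge> (4 s + 2 \<alpha>)^2 \<ge> 16 s (s + \<alpha>), so the bounds
  \<open>h k\<close> grow at least by the factor 16. The sum is then at most 1 / (1 - 1/16) = 16/15
  times its last term.\<close>

lemma Laguerre_kernel_bound:
  assumes \<alpha>: "\<alpha> \<ge> -1/2" and t: "t \<ge> 4 * real n + 2 * \<alpha> + 2"
  shows "Laguerre_kernel \<alpha> n t \<le> 16/15 * (t^(2 * n) / (fact n * Gamma (real n + \<alpha> + 1)))"
proof -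
  define h where "h = (\<lambda>k. t^(2 * k) / (fact k * Gamma (real k + \<alpha> + 1)))"
  have Gp: "Gamma (real j + \<alpha> + 1) > 0" for j using \<alpha> by (intro Gamma_real_pos) auto
  have tp: "t > 0" using t \<alpha> by linarith
  have "fact k / Gamma (real k + \<alpha> + 1) * (Laguerre \<alpha> k t)\<^sup>2 \<le> h k" if "k \<le> n" for k
  proof -
    have "(Laguerre \<alpha> k t)\<^sup>2 \<le> (t^k / fact k)\<^sup>2"
      using power_mono[OF Laguerre_abs_bound[OF \<alpha> t that], of 2] by simp
    then have "fact k / Gamma (real k + \<alpha> + 1) * (Laguerre \<alpha> k t)\<^sup>2 \<le> fact k / Gamma (real k + \<alpha> + 1) * (t^k / fact k)\<^sup>2"
      using Gp[of k] by (intro mult_left_mono) auto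
    also have "\<dots> = h k" using Gp[of k] by (simp add: h_def power_divide power2_eq_square power_mult mult.commute)
    finally show ?thesis .
  qed
  then have "Laguerre_kernel \<alpha> n t \<le> (\<Sum>k\<le>n. h k)" unfolding Laguerre_kernel_def by (intro sum_mono) auto
  also have "(\<Sum>k\<le>j. h k) \<le> 16/15 * h j" if "j \<le> n" for j
    using that
  proof (induction j)
    case 0
    have "h 0 > 0" using Gp[of 0] by (simp add: h_def)
    then show ?case by simp
  next
    case (Suc j)
    define s where "s = real j + 1"
    have s: "s \<ge> 1" by (simp add: s_def)
    have "t \<ge> 4 * s + 2 * \<alpha>" using t Suc.prems by (simp add: s_def)
    moreover have "4 * s + 2 * \<alpha> \<ge> 0" using s \<alpha> by linarith
    ultimately have "(4 * s + 2 * \<alpha>)\<^sup>2 \<le> t\<^sup>2" by (intro power_mono)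
    moreover have "(4 * s + 2 * \<alpha>)\<^sup>2 = 16 * (s * (s + \<alpha>)) + 4 * \<alpha>\<^sup>2" by (simp add: power2_eq_square algebra_simps)
    moreover have "4 * \<alpha>\<^sup>2 \<ge> 0" by simp
    ultimately have st: "16 * (s * (s + \<alpha>)) \<le> t\<^sup>2" by linarith
    have G1: "Gamma (real (Suc j) + \<alpha> + 1) = (s + \<alpha>) * Gamma (real j + \<alpha> + 1)"
      using Gamma_real_plus1[of "real j + \<alpha> + 1"] \<alpha> by (simp add: s_def add_ac)
    have sa: "s * (s + \<alpha>) > 0" using s \<alpha> by (intro mult_pos_pos) auto
    have fj: "fact (Suc j) = s * fact j" by (simp add: s_def)
    have "h (Suc j) = h j * (t\<^sup>2 / (s * (s + \<alpha>)))"
      unfolding h_def G1 fj by (simp add: power2_eq_square mult_ac)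
    moreover have "t\<^sup>2 / (s * (s + \<alpha>)) \<ge> 16" using st sa by (simp add: pos_le_divide_eq)
    moreover have "h j > 0" using Gp[of j] tp by (simp add: h_def)
    ultimately have "h j * 16 \<le> h (Suc j)" by (simp only: mult_left_mono less_imp_le)
    then show ?case using Suc by simp
  qed
  finally show ?thesis by (simp add: h_def)
qed

section \<open>Laguerre functions as eigenfunctions and their tails\<close>

context bessel_order
begin

lemma U_monomial_exp:
  assumes \<sigma>: "\<sigma> \<ge> 0"
  shows "U (\<lambda>t. t^k * exp (- t)) \<sigma> =
    Gamma (real k + \<alpha> + 1) * (\<Sum>j\<le>k. real (k choose j) * (-\<sigma>)^j / Gamma (real j + \<alpha> + 1)) * exp (- \<sigma>)"
proof -
  define q where "q = (\<lambda>m. Gamma (real m + real k + \<alpha> + 1) / Gamma (real m + \<alpha> + 1))"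
  define K where "K = (\<lambda>j. Gamma (real k + \<alpha> + 1) * (real (k choose j) * fact j / Gamma (real j + \<alpha> + 1)))"
  have q: "q m = (\<Sum>j\<le>k. K j * real (m choose j))" for m
    unfolding q_def K_def Gamma_quotient_Vandermonde[OF \<alpha>_ge] sum_distrib_left
    by (intro sum.cong refl) simp
  \<comment> \<open>Used for both signs: x = \<sigma> gives the summability of norms that
    \<open>U_power_exp_sums\<close> demands, x = -\<sigma> gives the value.\<close>
  have *: "(\<lambda>m. x^m / fact m * q m) sums (\<Sum>j\<le>k. K j * (x^j / fact j * exp x))" for x
  proof -
    have "(\<lambda>m. \<Sum>j\<le>k. K j * (x^m / fact m * real (m choose j))) sums (\<Sum>j\<le>k. K j * (x^j / fact j * exp x))"
      by (intro sums_sum sums_mult sums_exp_binomial)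
    moreover have "(\<Sum>j\<le>k. K j * (x^m / fact m * real (m choose j))) = x^m / fact m * q m" for m
      unfolding q sum_distrib_left by (intro sum.cong refl) simp
    ultimately show ?thesis by simp
  qed
  have "(\<lambda>m. (-\<sigma>)^m / fact m * q m) sums U (\<lambda>t. t^k * exp (- 1 * t)) \<sigma>"
  proof -
    have eq: "x^m / fact m * (Gamma (real m + real k + \<alpha> + 1) / Gamma (real m + \<alpha> + 1)) / 1 powr (real m + real k + \<alpha> + 1)
        = x^m / fact m * q m" for x m
      by (simp add: q_def)
    show ?thesis
      by (rule U_power_exp_sums[OF zero_less_one \<sigma>, of k, unfolded eq, OF sums_summable[OF *]])
  qed
  with *[of "-\<sigma>"] have "U (\<lambda>t. t^k * exp (- 1 * t)) \<sigma> = (\<Sum>j\<le>k. K j * ((-\<sigma>)^j / fact j * exp (- \<sigma>)))"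
    by (rule sums_unique2[symmetric])
  also have "\<dots> = Gamma (real k + \<alpha> + 1) * (\<Sum>j\<le>k. real (k choose j) * (-\<sigma>)^j / Gamma (real j + \<alpha> + 1)) * exp (- \<sigma>)"
    unfolding K_def sum_distrib_left sum_distrib_right by (intro sum.cong refl) simp
  finally show ?thesis by simp
qed

definition Laguerre_fun :: "nat \<Rightarrow> real \<Rightarrow> real" where
  "Laguerre_fun k t = exp (- t) * Laguerre \<alpha> k (2 * t)"

definition Laguerre_fun_coeff :: "nat \<Rightarrow> nat \<Rightarrow> real" where
  "Laguerre_fun_coeff k i = Gamma (real k + \<alpha> + 1) / fact k * (real (k choose i) * (-2)^i / Gamma (real i + \<alpha> + 1))"

lemma Laguerre_fun_expand: "Laguerre_fun k t = (\<Sum>i\<le>k. Laguerre_fun_coeff k i * (t^i * exp (- t)))"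
proof -
  have "(- (2 * t))^i = (-2)^i * t^i" for i using power_mult_distrib[of "-2" t i] by simp
  then show ?thesis unfolding Laguerre_fun_def Laguerre_def Laguerre_fun_coeff_def sum_distrib_left by (intro sum.cong refl) simp
qed

lemma integrable_W_exp1: "integrable W (\<lambda>t. t^k * exp (- t))"
  using integrable_W_exp[of 1 k] by simp

lemma integrable_Laguerre_fun: "integrable W (Laguerre_fun k)"
  unfolding Laguerre_fun_expand[abs_def] by (intro Bochner_Integration.integrable_sum integrable_mult_right integrable_W_exp1)

lemma sq_integrable_Laguerre_fun: "Laguerre_fun k \<in> sq_integrable W"
  unfolding Laguerre_fun_expand[abs_def] using sq_integrable_exp[of 1] by (intro sq_integrable_sum) simp

text \<open>After the two sums are exchanged, the inner one is
  \<open>sum_binomial_binomial_power\<close> at z = -2; its factor (-1)^(k - j) combines with the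
  sign of (-\<sigma>)^j to the eigenvalue (-1)^k.\<close>

lemma U_Laguerre_fun:
  assumes \<sigma>: "\<sigma> \<ge> 0"
  shows "U (Laguerre_fun k) \<sigma> = (-1)^k * Laguerre_fun k \<sigma>"
proof -
  let ?G = "\<lambda>j. Gamma (real j + \<alpha> + 1)"
  have "U (Laguerre_fun k) \<sigma> = (\<Sum>i\<le>k. Laguerre_fun_coeff k i * U (\<lambda>t. t^i * exp (- t)) \<sigma>)"
    unfolding Laguerre_fun_expand[abs_def] by (rule U_sum) (rule integrable_W_exp1)
  also have "\<dots> = (\<Sum>i\<le>k. \<Sum>j\<le>k. ?G k / fact k * ((-\<sigma>)^j / ?G j) * exp (- \<sigma>) * (real (k choose i) * real (i choose j) * (-2)^i))"
  proof (intro sum.cong refl)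
    fix i assume "i \<in> {..k}"
    then have i: "i \<le> k" by simp
    \<comment> \<open>The range of j is made independent of i, as vanishing binomials allow, to
      prepare the exchange of sums.\<close>
    have "(\<Sum>j\<le>i. real (i choose j) * (-\<sigma>)^j / ?G j) = (\<Sum>j\<le>k. real (i choose j) * (-\<sigma>)^j / ?G j)"
      using i by (intro sum.mono_neutral_left) auto
    then have "Laguerre_fun_coeff k i * U (\<lambda>t. t^i * exp (- t)) \<sigma> = Laguerre_fun_coeff k i * (?G i * (\<Sum>j\<le>k. real (i choose j) * (-\<sigma>)^j / ?G j) * exp (- \<sigma>))"
      unfolding U_monomial_exp[OF \<sigma>] by (simp only:)
    also have "\<dots> = ?G k / fact k * (real (k choose i) * (-2)^i) * (\<Sum>j\<le>k. real (i choose j) * (-\<sigma>)^j / ?G j) * exp (- \<sigma>)"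
      unfolding Laguerre_fun_coeff_def using Gamma_pos[of i] by (simp only: times_divide_eq_left times_divide_eq_right) simp
    also have "\<dots> = (\<Sum>j\<le>k. ?G k / fact k * ((-\<sigma>)^j / ?G j) * exp (- \<sigma>) * (real (k choose i) * real (i choose j) * (-2)^i))"
      unfolding sum_distrib_left sum_distrib_right by (intro sum.cong refl) (simp add: mult_ac)
    finally show "Laguerre_fun_coeff k i * U (\<lambda>t. t^i * exp (- t)) \<sigma> = \<dots>" .
  qed
  also have "\<dots> = (\<Sum>j\<le>k. ?G k / fact k * ((-\<sigma>)^j / ?G j) * exp (- \<sigma>) * (\<Sum>i\<le>k. real (k choose i) * real (i choose j) * (-2)^i))"
    unfolding sum_distrib_left by (rule sum.swap)
  also have "\<dots> = (\<Sum>j\<le>k. (-1)^k * (Laguerre_fun_coeff k j * (\<sigma>^j * exp (- \<sigma>))))"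
  proof (intro sum.cong refl)
    fix j assume "j \<in> {..k}"
    then have j: "j \<le> k" by simp
    have "(-\<sigma>)^j = (-1)^j * \<sigma>^j" by (rule power_minus)
    moreover have "(-1)^j * (-1)^(k - j) = (-1::real)^k" using j by (simp flip: power_add)
    moreover have "(\<Sum>i\<le>k. real (k choose i) * real (i choose j) * (-2)^i) = real (k choose j) * (-2)^j * (-1)^(k - j)"
      using sum_binomial_binomial_power[OF j, of "-2"] by simp
    ultimately show "?G k / fact k * ((-\<sigma>)^j / ?G j) * exp (- \<sigma>) * (\<Sum>i\<le>k. real (k choose i) * real (i choose j) * (-2)^i)
        = (-1)^k * (Laguerre_fun_coeff k j * (\<sigma>^j * exp (- \<sigma>)))"
      unfolding Laguerre_fun_coeff_def by (simp add: mult_ac)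
  qed
  finally show ?thesis by (simp only: Laguerre_fun_expand sum_distrib_left)
qed

text \<open>The moments of \<open>W\<close> are Gamma values, and
  \<open>Gamma_quotient_Vandermonde\<close> expands their quotients in binomials of i and l with l
  \<le> j. The alternating sum over i then annihilates every l < k.\<close>

lemma integral_monomial_Laguerre_fun:
  assumes "j \<le> k"
  shows "(LINT t|W. t^j * exp (- t) * Laguerre_fun k t) =
    (if j = k then (-1)^k * Gamma (real k + \<alpha> + 1) / 2 powr (real k + \<alpha> + 1) else 0)"
proof -
  let ?G = "\<lambda>j. Gamma (real j + \<alpha> + 1)"
  define C where "C = ?G k / fact k / 2 powr (real j + \<alpha> + 1) * ?G j"
  have "(LINT t|W. t^j * exp (- t) * Laguerre_fun k t) = (LINT t|W. (\<Sum>i\<le>k. Laguerre_fun_coeff k i * (t^(i + j) * exp (- 2 * t))))"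
  proof (intro Bochner_Integration.integral_cong refl)
    fix t :: real
    have "exp (- 2 * t) = exp (- t) * exp (- t)" by (simp flip: exp_add)
    then show "t^j * exp (- t) * Laguerre_fun k t = (\<Sum>i\<le>k. Laguerre_fun_coeff k i * (t^(i + j) * exp (- 2 * t)))"
      unfolding Laguerre_fun_expand sum_distrib_left by (intro sum.cong refl) (simp add: power_add mult_ac)
  qed
  also have "\<dots> = (\<Sum>i\<le>k. (LINT t|W. Laguerre_fun_coeff k i * (t^(i + j) * exp (- 2 * t))))"
    by (intro Bochner_Integration.integral_sum integrable_mult_right integrable_W_exp) simp
  also have "\<dots> = (\<Sum>i\<le>k. Laguerre_fun_coeff k i * (?G (i + j) / 2 powr (real (i + j) + \<alpha> + 1)))"
    by (simp only: integral_mult_right_zero integral_W_exp[OF zero_less_numeral])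
  also have "\<dots> = (\<Sum>i\<le>k. \<Sum>l\<le>j. C * (real (j choose l) * fact l / ?G l) * (real (k choose i) * real (i choose l) * (-1)^i))"
  proof (intro sum.cong refl)
    fix i
    have p: "2 powr (real (i + j) + \<alpha> + 1) = 2^i * 2 powr (real j + \<alpha> + 1)"
      using powr_add[of 2 "real i" "real j + \<alpha> + 1"] by (simp add: powr_realpow add_ac)
    have m: "(-2::real)^i = (-1)^i * 2^i" by (rule power_minus)
    have "Laguerre_fun_coeff k i * (?G (i + j) / 2 powr (real (i + j) + \<alpha> + 1))
        = ?G k / fact k / 2 powr (real j + \<alpha> + 1) * (real (k choose i) * (-1)^i) * (?G (i + j) / ?G i)"
      unfolding Laguerre_fun_coeff_def p m by (simp add: mult_ac)
    also have "?G (i + j) / ?G i = ?G j * (\<Sum>l\<le>j. real (i choose l) * real (j choose l) * fact l / ?G l)"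
      using Gamma_quotient_Vandermonde[OF \<alpha>_ge, of i j] by simp
    also have "?G k / fact k / 2 powr (real j + \<alpha> + 1) * (real (k choose i) * (-1)^i) * \<dots> =
        (\<Sum>l\<le>j. C * (real (j choose l) * fact l / ?G l) * (real (k choose i) * real (i choose l) * (-1)^i))"
      unfolding C_def sum_distrib_left by (intro sum.cong refl) (simp add: mult_ac)
    finally show "Laguerre_fun_coeff k i * (?G (i + j) / 2 powr (real (i + j) + \<alpha> + 1)) = \<dots>" .
  qed
  also have "\<dots> = (\<Sum>l\<le>j. C * (real (j choose l) * fact l / ?G l) * (\<Sum>i\<le>k. real (k choose i) * real (i choose l) * (-1)^i))"
    unfolding sum_distrib_left by (rule sum.swap)
  also have "\<dots> = (\<Sum>l\<le>j. if l = k then C * (fact k / ?G k) * (-1)^k else 0)"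
  proof (intro sum.cong refl)
    fix l assume "l \<in> {..j}"
    then have "l \<le> j" "l \<le> k" using assms by auto
    then show "C * (real (j choose l) * fact l / ?G l) * (\<Sum>i\<le>k. real (k choose i) * real (i choose l) * (-1)^i) =
        (if l = k then C * (fact k / ?G k) * (-1)^k else 0)"
      unfolding sum_binomial_binomial_power[OF \<open>l \<le> k\<close>] using assms by auto
  qed
  also have "\<dots> = (if j = k then C * (fact k / ?G k) * (-1)^k else 0)"
    using assms by (auto simp: sum.delta)
  also have "\<dots> = (if j = k then (-1)^k * ?G k / 2 powr (real k + \<alpha> + 1) else 0)"
    using Gamma_pos[of k] by (simp add: C_def)
  finally show ?thesis .
qed

definition Laguerre_fun_sqnorm :: "nat \<Rightarrow> real" where
  "Laguerre_fun_sqnorm k = Gamma (real k + \<alpha> + 1) / (fact k * 2 powr (\<alpha> + 1))"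

lemma Laguerre_fun_sqnorm_pos: "Laguerre_fun_sqnorm k > 0" using Gamma_pos[of k] by (simp add: Laguerre_fun_sqnorm_def)

lemma integral_Laguerre_fun_Laguerre_fun_le:
  assumes "j \<le> k"
  shows "(LINT t|W. Laguerre_fun j t * Laguerre_fun k t) = (if j = k then Laguerre_fun_sqnorm k else 0)"
proof -
  have m: "(\<lambda>t. t^i * exp (- t)) \<in> sq_integrable W" for i using sq_integrable_exp[of 1 i] by simp
  have "(LINT t|W. Laguerre_fun j t * Laguerre_fun k t) = (LINT t|W. (\<Sum>i\<le>j. Laguerre_fun_coeff j i * (t^i * exp (- t) * Laguerre_fun k t)))"
    by (intro Bochner_Integration.integral_cong refl) (simp only: Laguerre_fun_expand[of j] sum_distrib_right mult.assoc)
  also have "\<dots> = (\<Sum>i\<le>j. (LINT t|W. Laguerre_fun_coeff j i * (t^i * exp (- t) * Laguerre_fun k t)))"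
    by (intro Bochner_Integration.integral_sum integrable_mult_right sq_integrable_mult m sq_integrable_Laguerre_fun)
  also have "\<dots> = (\<Sum>i\<le>j. if i = k then Laguerre_fun_coeff j k * ((-1)^k * Gamma (real k + \<alpha> + 1) / 2 powr (real k + \<alpha> + 1)) else 0)"
    using assms by (intro sum.cong refl) (auto simp: integral_monomial_Laguerre_fun)
  also have "\<dots> = (if j = k then Laguerre_fun_coeff k k * ((-1)^k * Gamma (real k + \<alpha> + 1) / 2 powr (real k + \<alpha> + 1)) else 0)"
    using assms by (auto simp: sum.delta)
  also have "Laguerre_fun_coeff k k * ((-1)^k * Gamma (real k + \<alpha> + 1) / 2 powr (real k + \<alpha> + 1)) = Laguerre_fun_sqnorm k"
  proof -
    have p: "2 powr (real k + \<alpha> + 1) = 2^k * 2 powr (\<alpha> + 1)"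
      using powr_add[of 2 "real k" "\<alpha> + 1"] by (simp add: powr_realpow add_ac)
    have "(-2)^k * (-1)^k = (2::real)^k" by (simp flip: power_mult_distrib)
    moreover have "Laguerre_fun_coeff k k * ((-1)^k * Gamma (real k + \<alpha> + 1) / 2 powr (real k + \<alpha> + 1)) =
       ((-2)^k * (-1)^k) * Gamma (real k + \<alpha> + 1) / fact k / (2^k * 2 powr (\<alpha> + 1))"
      unfolding Laguerre_fun_coeff_def p using Gamma_pos[of k] by simp
    ultimately show ?thesis by (simp add: Laguerre_fun_sqnorm_def)
  qed
  finally show ?thesis .
qed

lemma integral_Laguerre_fun_Laguerre_fun: "(LINT t|W. Laguerre_fun j t * Laguerre_fun k t) = (if j = k then Laguerre_fun_sqnorm k else 0)"
proof (cases "j \<le> k")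
  case False
  then show ?thesis using integral_Laguerre_fun_Laguerre_fun_le[of k j] by (simp add: mult.commute)
qed (rule integral_Laguerre_fun_Laguerre_fun_le)

definition Laguerre_comb :: "nat \<Rightarrow> (nat \<Rightarrow> real) \<Rightarrow> real \<Rightarrow> real" where
  "Laguerre_comb n a t = (\<Sum>k\<le>n. a k * Laguerre_fun k t)"

lemma sq_integrable_Laguerre_comb: "Laguerre_comb n a \<in> sq_integrable W"
  unfolding Laguerre_comb_def[abs_def] by (intro sq_integrable_sum sq_integrable_Laguerre_fun)

lemma integrable_Laguerre_comb: "integrable W (Laguerre_comb n a)"
  unfolding Laguerre_comb_def[abs_def] by (intro Bochner_Integration.integrable_sum integrable_mult_right integrable_Laguerre_fun)

lemma U_Laguerre_comb: "\<sigma> \<ge> 0 \<Longrightarrow> U (Laguerre_comb n a) \<sigma> = Laguerre_comb n (\<lambda>k. (-1)^k * a k) \<sigma>"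
  unfolding Laguerre_comb_def[abs_def] by (subst U_sum) (auto intro!: integrable_Laguerre_fun sum.cong simp: U_Laguerre_fun)

lemma integral_Laguerre_comb_square: "(LINT t|W. (Laguerre_comb n a t)\<^sup>2) = (\<Sum>k\<le>n. (a k)\<^sup>2 * Laguerre_fun_sqnorm k)"
proof -
  have i: "integrable W (\<lambda>t. a j * a k * (Laguerre_fun j t * Laguerre_fun k t))" for j k
    by (intro integrable_mult_right sq_integrable_mult sq_integrable_Laguerre_fun)
  have "(LINT t|W. (Laguerre_comb n a t)\<^sup>2) = (LINT t|W. (\<Sum>j\<le>n. \<Sum>k\<le>n. a j * a k * (Laguerre_fun j t * Laguerre_fun k t)))"
    by (intro Bochner_Integration.integral_cong refl) (simp add: Laguerre_comb_def power2_eq_square sum_product mult_ac)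
  also have "\<dots> = (\<Sum>j\<le>n. (LINT t|W. (\<Sum>k\<le>n. a j * a k * (Laguerre_fun j t * Laguerre_fun k t))))"
    by (intro Bochner_Integration.integral_sum Bochner_Integration.integrable_sum i)
  also have "\<dots> = (\<Sum>j\<le>n. \<Sum>k\<le>n. (LINT t|W. a j * a k * (Laguerre_fun j t * Laguerre_fun k t)))"
    by (intro sum.cong refl Bochner_Integration.integral_sum i)
  also have "\<dots> = (\<Sum>j\<le>n. \<Sum>k\<le>n. if j = k then a j * a k * Laguerre_fun_sqnorm k else 0)"
    by (intro sum.cong refl) (simp add: integral_Laguerre_fun_Laguerre_fun)
  also have "\<dots> = (\<Sum>k\<le>n. (a k)\<^sup>2 * Laguerre_fun_sqnorm k)"
    by (simp add: sum.delta power2_eq_square)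
  finally show ?thesis .
qed

text \<open>Cauchy-Schwarz against the normalised Laguerre functions, a reproducing-kernel estimate.
  The tails of all combinations are thereby controlled by one integral of the kernel.\<close>

lemma Laguerre_comb_square_le:
  "(Laguerre_comb n a t)\<^sup>2 \<le> (LINT t|W. (Laguerre_comb n a t)\<^sup>2) * (exp (- 2 * t) * 2 powr (\<alpha> + 1) * Laguerre_kernel \<alpha> n (2 * t))"
proof -
  have "(Laguerre_comb n a t)\<^sup>2 = (\<Sum>k\<le>n. (a k * sqrt (Laguerre_fun_sqnorm k)) * (Laguerre_fun k t / sqrt (Laguerre_fun_sqnorm k)))\<^sup>2"
    unfolding Laguerre_comb_def using Laguerre_fun_sqnorm_pos by (intro arg_cong[where f="\<lambda>x. x\<^sup>2"] sum.cong refl) (simp add: less_imp_neq[symmetric])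
  also have "\<dots> \<le> (\<Sum>k\<le>n. (a k * sqrt (Laguerre_fun_sqnorm k))\<^sup>2) * (\<Sum>k\<le>n. (Laguerre_fun k t / sqrt (Laguerre_fun_sqnorm k))\<^sup>2)"
    by (rule Cauchy_Schwarz_ineq_sum)
  also have "(\<Sum>k\<le>n. (a k * sqrt (Laguerre_fun_sqnorm k))\<^sup>2) = (LINT t|W. (Laguerre_comb n a t)\<^sup>2)"
    unfolding integral_Laguerre_comb_square using Laguerre_fun_sqnorm_pos by (intro sum.cong refl) (simp add: power_mult_distrib less_imp_le)
  also have "(\<Sum>k\<le>n. (Laguerre_fun k t / sqrt (Laguerre_fun_sqnorm k))\<^sup>2) = exp (- 2 * t) * 2 powr (\<alpha> + 1) * Laguerre_kernel \<alpha> n (2 * t)"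
    unfolding Laguerre_kernel_def sum_distrib_left
  proof (intro sum.cong refl)
    fix k
    have e: "(exp (- t))\<^sup>2 = exp (- 2 * t)" by (simp flip: exp_double)
    have "(Laguerre_fun k t / sqrt (Laguerre_fun_sqnorm k))\<^sup>2 = (exp (- t))\<^sup>2 * (Laguerre \<alpha> k (2 * t))\<^sup>2 / Laguerre_fun_sqnorm k"
      using Laguerre_fun_sqnorm_pos[of k] by (simp add: Laguerre_fun_def power_divide power_mult_distrib)
    then show "(Laguerre_fun k t / sqrt (Laguerre_fun_sqnorm k))\<^sup>2 = exp (- 2 * t) * 2 powr (\<alpha> + 1) * (fact k / Gamma (real k + \<alpha> + 1) * (Laguerre \<alpha> k (2 * t))\<^sup>2)"
      unfolding e by (simp add: Laguerre_fun_sqnorm_def mult_ac)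
  qed
  finally show ?thesis .
qed

section \<open>Tail estimates\<close>

text \<open>For r = 2 n + \<alpha> the threshold 4 n + 2 \<alpha> + 2 is 2 r + 2, and the first
  factor is the constant \<rho> for which \<rho> (1 - r/x) equals 1 at the threshold.\<close>

lemma half_quotient_id:
  fixes r :: real
  assumes "r \<ge> 0"
  shows "(2 * r + 2) / (r + 2) * (1 - r / (2 * r + 2)) = 1"
proof -
  have nz: "2 * r + 2 \<noteq> 0" "r + 2 \<noteq> 0" using assms by linarith+
  have "1 - r / (2 * r + 2) = ((2 * r + 2) - r) / (2 * r + 2)"
    by (subst diff_divide_distrib, subst divide_self[OF nz(1)], rule refl)
  also have "(2 * r + 2) - r = r + 2" by simp
  finally show ?thesis using nz by simp
qed

lemma has_real_derivative_powr_exp: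
  fixes x :: real
  assumes "x > 0"
  shows "((\<lambda>x. - (x powr q * exp (- x))) has_real_derivative x powr q * exp (- x) * (1 - q / x)) (at x)"
proof -
  have "((\<lambda>x. - (x powr q * exp (- x))) has_real_derivative - (q * x powr (q - 1) * exp (- x) + x powr q * (- exp (- x)))) (at x)"
    using assms by (auto intro!: derivative_eq_intros)
  moreover have "x powr (q - 1) = x powr q / x" using assms powr_diff[of x q 1] by simp
  moreover have "- (q * (P / x) * e + P * (- e)) = P * e * (1 - q / x)" for P e :: real
    by (simp add: algebra_simps)
  ultimately show ?thesis by (simp only:)
qed

text \<open>The incomplete Gamma integral is replaced by a majorant \<open>g\<close> with an
  explicit primitive \<open>G\<close> vanishing at infinity. Since the Laguerre polynomials are
  taken at 2 t, the integral is transformed to x = 2 t and starts at 2 b.\<close>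

lemma Laguerre_comb_tail_le:
  assumes b: "b > 0"
    and deriv: "\<And>x. x \<ge> 2 * b \<Longrightarrow> (G has_real_derivative g x) (at x)"
    and g_ge: "\<And>x. x \<ge> 2 * b \<Longrightarrow> x powr \<alpha> * exp (- x) * Laguerre_kernel \<alpha> n x \<le> g x"
    and lim: "(G \<longlongrightarrow> 0) at_top"
    and [measurable]: "g \<in> borel_measurable borel"
  shows "(LINT t|W. indicator {b<..} t * (Laguerre_comb n a t)\<^sup>2) \<le> (LINT t|W. (Laguerre_comb n a t)\<^sup>2) * - G (2 * b)"
proof -
  let ?E = "LINT t|W. (Laguerre_comb n a t)\<^sup>2"
  have E: "?E \<ge> 0" by (rule sq_integral_nonneg)
  have K: "Laguerre_kernel \<alpha> n x \<ge> 0" for x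
    unfolding Laguerre_kernel_def using Gamma_pos by (intro sum_nonneg mult_nonneg_nonneg divide_nonneg_pos) auto
  have g0: "g x \<ge> 0" if "x \<ge> 2 * b" for x
    by (rule order.trans[OF _ g_ge[OF that]]) (intro mult_nonneg_nonneg K; simp)
  have [measurable]: "Laguerre_comb n a \<in> borel_measurable borel" using borel_measurable_integrable[OF integrable_Laguerre_comb] by simp
  have FTC: "(\<integral>\<^sup>+t. ennreal (2 * g (2 * t)) * indicator {b..} t \<partial>lborel) = ennreal (0 - G (2 * b))"
  proof (rule nn_integral_FTC_atLeast)
    show "((\<lambda>t. G (2 * t)) has_real_derivative 2 * g (2 * x)) (at x)" if "b \<le> x" for x
    proof -
      have "((\<lambda>t. G (2 * t)) has_real_derivative g (2 * x) * 2) (at x)"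
        by (rule DERIV_chain2[OF deriv]) (use that in \<open>auto intro!: derivative_eq_intros\<close>)
      then show ?thesis by (simp add: mult.commute)
    qed
    show "0 \<le> 2 * g (2 * x)" if "b \<le> x" for x using g0[of "2 * x"] that by simp
    show "((\<lambda>t. G (2 * t)) \<longlongrightarrow> 0) at_top"
      by (rule filterlim_compose[OF lim]) real_asymp
  qed measurable
  \<comment> \<open>\<open>G\<close> is nondecreasing with limit 0; the sign is needed to return
    from extended nonnegative reals.\<close>
  have G0: "- G (2 * b) \<ge> 0"
  proof (rule ccontr)
    assume "\<not> ?thesis"
    then have nG: "G (2 * b) > 0" by simp
    have "eventually (\<lambda>x. G x < G (2 * b) \<and> x \<ge> 2 * b) at_top"
      using order_tendstoD(2)[OF lim nG] eventually_ge_at_top[of "2 * b"] by eventually_elim simp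
    then obtain x where x: "G x < G (2 * b)" "x \<ge> 2 * b" by (auto dest: eventually_happens)
    have "G (2 * b) \<le> G x"
      by (rule DERIV_nonneg_imp_nondecreasing[OF x(2)]) (use deriv g0 in blast)
    then show False using x by simp
  qed
  have "(\<integral>\<^sup>+t. ennreal (indicator {b<..} t * (Laguerre_comb n a t)\<^sup>2) \<partial>W) =
      (\<integral>\<^sup>+t. ennreal (indicator {0<..} t * t powr \<alpha>) * ennreal (indicator {b<..} t * (Laguerre_comb n a t)\<^sup>2) \<partial>lborel)"
    unfolding W_def by (rule nn_integral_density) measurable
  also have "\<dots> \<le> (\<integral>\<^sup>+t. ennreal ?E * (ennreal (2 * g (2 * t)) * indicator {b..} t) \<partial>lborel)"
  proof (rule nn_integral_mono)
    fix t :: real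
    show "ennreal (indicator {0<..} t * t powr \<alpha>) * ennreal (indicator {b<..} t * (Laguerre_comb n a t)\<^sup>2)
        \<le> ennreal ?E * (ennreal (2 * g (2 * t)) * indicator {b..} t)"
    proof (cases "t > b")
      case True
      then have t: "t > 0" using b by linarith
      have "t powr \<alpha> * (Laguerre_comb n a t)\<^sup>2 \<le> t powr \<alpha> * (?E * (exp (- 2 * t) * 2 powr (\<alpha> + 1) * Laguerre_kernel \<alpha> n (2 * t)))"
        by (intro mult_left_mono Laguerre_comb_square_le) simp
      also have "\<dots> = ?E * (2 * ((2 * t) powr \<alpha> * exp (- (2 * t)) * Laguerre_kernel \<alpha> n (2 * t)))"
        using t by (simp add: powr_mult powr_add mult_ac)
      also have "\<dots> \<le> ?E * (2 * g (2 * t))"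
        using g_ge[of "2 * t"] True E by (intro mult_left_mono) auto
      finally have "ennreal (t powr \<alpha> * (Laguerre_comb n a t)\<^sup>2) \<le> ennreal (?E * (2 * g (2 * t)))" by (rule ennreal_leI)
      then show ?thesis using True t E g0[of "2 * t"] by (simp add: ennreal_mult)
    qed simp
  qed
  also have "\<dots> = ennreal ?E * ennreal (0 - G (2 * b))"
    unfolding FTC[symmetric] by (rule nn_integral_cmult) measurable
  also have "\<dots> = ennreal (?E * - G (2 * b))" by (simp only: diff_0 ennreal_mult[OF E G0])
  finally show ?thesis
    using E G0 by (intro integral_real_bounded mult_nonneg_nonneg) (auto simp: o_def)
qed

text \<open>The \<kappa> of the overview; the common factor 5/3 must fit all n and \<alpha>, and
  four times it is the 20/3 of the theorem.\<close>

definition tail_const :: "nat \<Rightarrow> real \<Rightarrow> real" where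
  "tail_const n c = 5/3 * (c powr \<alpha> * c^(2 * n) / fact n * exp (- c))"

text \<open>With q = 2 n + \<alpha>, the derivative of -x^q exp(-x) is x^q exp(-x) (1 - q/x); the
  factor \<rho> compensates for 1 - q/x. The last hypothesis is the budget that each case has to
  meet.\<close>

lemma Laguerre_comb_tail_power:
  assumes c: "c > 0" and \<rho>: "\<rho> \<ge> 0" "A \<ge> 0" "\<And>x. x \<ge> c \<Longrightarrow> \<rho> * (1 - (2 * real n + \<alpha>) / x) \<ge> 1"
    and A: "\<And>x. x \<ge> c \<Longrightarrow> Laguerre_kernel \<alpha> n x \<le> A * x^(2 * n)"
    and B: "\<rho> * A \<le> 5/3 / fact n"
  shows "(LINT t|W. indicator {c/2<..} t * (Laguerre_comb n a t)\<^sup>2) \<le> (LINT t|W. (Laguerre_comb n a t)\<^sup>2) * tail_const n c"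
proof -
  let ?q = "2 * real n + \<alpha>"
  let ?G = "\<lambda>x. - (\<rho> * A) * (x powr ?q * exp (- x))"
  have "(LINT t|W. indicator {c/2<..} t * (Laguerre_comb n a t)\<^sup>2) \<le> (LINT t|W. (Laguerre_comb n a t)\<^sup>2) * - ?G (2 * (c/2))"
  proof (rule Laguerre_comb_tail_le)
    show "(?G has_real_derivative (\<rho> * A) * (x powr ?q * exp (- x) * (1 - ?q / x))) (at x)" if "2 * (c/2) \<le> x" for x
      using DERIV_cmult[OF has_real_derivative_powr_exp[of x ?q], of "\<rho> * A"] that c by simp
    show "x powr \<alpha> * exp (- x) * Laguerre_kernel \<alpha> n x \<le> (\<rho> * A) * (x powr ?q * exp (- x) * (1 - ?q / x))" if "2 * (c/2) \<le> x" for x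
    proof -
      have x: "x > 0" "x \<ge> c" using that c by auto
      have xq: "x powr ?q = x powr \<alpha> * x^(2 * n)"
        using x powr_add[of x "real (2 * n)" \<alpha>] by (subst (asm) powr_realpow) (simp_all add: mult.commute)
      have "x powr \<alpha> * exp (- x) * Laguerre_kernel \<alpha> n x \<le> x powr \<alpha> * exp (- x) * (A * x^(2 * n))"
        using A[OF x(2)] by (intro mult_left_mono) auto
      also have "\<dots> = (A * (x powr ?q * exp (- x))) * 1" by (simp add: xq)
      also have "\<dots> \<le> (A * (x powr ?q * exp (- x))) * (\<rho> * (1 - ?q / x))"
        using \<rho>(2) \<rho>(3)[OF x(2)] by (intro mult_left_mono) auto
      finally show ?thesis by (simp add: mult_ac)
    qed
    show "(?G \<longlongrightarrow> 0) at_top"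
      by real_asymp
  qed (use c in auto)
  also have "\<dots> \<le> (LINT t|W. (Laguerre_comb n a t)\<^sup>2) * tail_const n c"
  proof (intro mult_left_mono sq_integral_nonneg)
    have cq: "c powr ?q = c powr \<alpha> * c^(2 * n)"
      using c powr_add[of c "real (2 * n)" \<alpha>] by (subst (asm) powr_realpow) (simp_all add: mult.commute)
    have "(\<rho> * A) * (c powr ?q * exp (- c)) \<le> (5/3 / fact n) * (c powr ?q * exp (- c))"
      by (intro mult_right_mono B) simp
    moreover have "- ?G (2 * (c/2)) = (\<rho> * A) * (c powr ?q * exp (- c))" by simp
    moreover have "tail_const n c = (5/3 / fact n) * (c powr ?q * exp (- c))" unfolding tail_const_def cq by simp
    ultimately show "- ?G (2 * (c/2)) \<le> tail_const n c" by (simp only:)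
  qed
  finally show ?thesis .
qed

lemma Laguerre_comb_tail_0:
  assumes c: "c > 2 * \<alpha> + 2"
  shows "(LINT t|W. indicator {c/2<..} t * (Laguerre_comb 0 a t)\<^sup>2) \<le> (LINT t|W. (Laguerre_comb 0 a t)\<^sup>2) * tail_const 0 c"
proof -
  have G: "4/5 \<le> Gamma (\<alpha> + 1)" using \<alpha>_ge by (intro Gamma_ge_4_5) auto
  define \<rho> where "\<rho> = (if \<alpha> \<le> 0 then 1 else (2 * \<alpha> + 2) / (\<alpha> + 2))"
  have c0: "c > 0" using c \<alpha>_ge by linarith
  have \<rho>0: "\<rho> \<ge> 0" by (simp add: \<rho>_def)
  have \<rho>G: "\<rho> \<le> 5/3 * Gamma (\<alpha> + 1)"
  proof -
    \<comment> \<open>For \<alpha> \<le> 1 the bound Gamma \<ge> 4/5 leaves 5/3 * 4/5 = 4/3, which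
      \<rho> reaches at \<alpha> = 1. Above that, Gamma \<ge> 1 and then Gamma \<ge> 2
      suffice.\<close>
    consider "\<alpha> \<le> 0" | "0 < \<alpha>" "\<alpha> \<le> 1" | "1 < \<alpha>" "\<alpha> \<le> 2" | "2 < \<alpha>" by linarith
    then show ?thesis
    proof cases
      case 1
      then show ?thesis using G by (simp add: \<rho>_def)
    next
      case 2
      then have "\<rho> \<le> 4/3" by (simp add: \<rho>_def divide_simps)
      then show ?thesis using G by linarith
    next
      case 3
      then have "\<rho> \<le> 5/3" by (simp add: \<rho>_def divide_simps)
      moreover have "1 \<le> Gamma (\<alpha> + 1)" using 3 by (intro Gamma_ge_1) auto
      ultimately show ?thesis by linarith
    next
      case 4
      then have "\<rho> \<le> 2" by (simp add: \<rho>_def divide_simps)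
      moreover have "1 * 2 \<le> \<alpha> * Gamma \<alpha>" using 4 Gamma_ge_1[of \<alpha>] mult_mono[of 2 \<alpha> 1 "Gamma \<alpha>"] by simp
      moreover have "Gamma (\<alpha> + 1) = \<alpha> * Gamma \<alpha>" using 4 by (intro Gamma_real_plus1) auto
      ultimately show ?thesis by linarith
    qed
  qed
  show ?thesis
  proof (rule Laguerre_comb_tail_power[OF c0 \<rho>0])
    show "0 \<le> 1 / Gamma (\<alpha> + 1)" using G by simp
    show "\<rho> * (1 - (2 * real 0 + \<alpha>) / x) \<ge> 1" if "x \<ge> c" for x
    proof -
      have x: "x > 0" "x > 2 * \<alpha> + 2" using that c c0 by auto
      show ?thesis
      proof (cases "\<alpha> \<le> 0")
        case True
        then have "\<alpha> / x \<le> 0" using x by (simp add: divide_le_0_iff)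
        then show ?thesis using True by (simp add: \<rho>_def)
      next
        case False
        have "\<alpha> / x \<le> \<alpha> / (2 * \<alpha> + 2)" using x False by (intro divide_left_mono) auto
        then have "\<rho> * (1 - \<alpha> / (2 * \<alpha> + 2)) \<le> \<rho> * (1 - \<alpha> / x)" using \<rho>0 by (intro mult_left_mono) auto
        moreover have "\<rho> = (2 * \<alpha> + 2) / (\<alpha> + 2)" using False by (simp add: \<rho>_def)
        then have "\<rho> * (1 - \<alpha> / (2 * \<alpha> + 2)) = 1" using half_quotient_id[of \<alpha>] False by (simp only: not_le less_imp_le)
        ultimately show ?thesis by simp
      qed
    qed
    show "Laguerre_kernel \<alpha> 0 x \<le> 1 / Gamma (\<alpha> + 1) * x^(2 * 0)" for x
      by (simp add: Laguerre_kernel_def Laguerre_0[OF \<alpha>_ge])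
    show "\<rho> * (1 / Gamma (\<alpha> + 1)) \<le> 5/3 / fact 0"
      using \<rho>G G by (simp add: pos_divide_le_eq)
  qed
qed

lemma Laguerre_comb_tail_ge_2:
  assumes c: "c > 4 * real n + 2 * \<alpha> + 2" and n: "n \<ge> 2"
  shows "(LINT t|W. indicator {c/2<..} t * (Laguerre_comb n a t)\<^sup>2) \<le> (LINT t|W. (Laguerre_comb n a t)\<^sup>2) * tail_const n c"
proof -
  let ?\<rho> = "(4 * real n + 2 * \<alpha> + 2) / (2 * real n + \<alpha> + 2)"
  let ?G = "Gamma (real n + \<alpha> + 1)"
  have c0: "c > 0" using c \<alpha>_ge by linarith
  have p: "2 * real n + \<alpha> > 0" using n \<alpha>_ge by linarith
  have n': "real n \<ge> 2" using n by simp
  have rec: "?G = (real n + \<alpha>) * Gamma (real n + \<alpha>)" using Gamma_real_plus1[of "real n + \<alpha>"] n' \<alpha>_ge by simp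
  have combine: "r * (16/15) \<le> 5/3 * g" if "r \<le> 2 \<and> 2 \<le> g \<or> r \<le> 5/3 \<and> 6/5 \<le> g" for r g :: real
    using that by linarith
  \<comment> \<open>In general \<rho> \<le> 2 and Gamma \<ge> 2. The exception is n = 2 with
    \<alpha> < 0, where Gamma \<ge> 3/2 * 4/5 = 6/5 and \<rho> \<le> 5/3.\<close>
  have main: "?\<rho> * (16/15) \<le> 5/3 * ?G"
  proof (cases "real n + \<alpha> \<ge> 2")
    case True
    have "?\<rho> \<le> 2" using p by (simp add: pos_divide_le_eq)
    moreover have "2 * 1 \<le> (real n + \<alpha>) * Gamma (real n + \<alpha>)"
      using True Gamma_ge_1[of "real n + \<alpha>"] by (intro mult_mono) auto
    ultimately show ?thesis unfolding rec by (intro combine) simp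
  next
    case False
    have "n = 2"
    proof (rule ccontr)
      assume "n \<noteq> 2"
      then have "real n \<ge> 3" using n by simp
      then show False using False \<alpha>_ge by linarith
    qed
    then have \<alpha>0: "\<alpha> < 0" using False by simp
    have "?\<rho> \<le> 5/3" unfolding \<open>n = 2\<close> using \<alpha>0 \<alpha>_ge by (subst pos_divide_le_eq) auto
    moreover have "3/2 * (4/5) \<le> (real n + \<alpha>) * Gamma (real n + \<alpha>)"
      using \<alpha>_ge n' by (intro mult_mono Gamma_ge_4_5) auto
    ultimately show ?thesis unfolding rec by (intro combine) simp
  qed
  show ?thesis
  proof (rule Laguerre_comb_tail_power[OF c0, where \<rho>="?\<rho>" and A="16/15 / (fact n * ?G)"])
    show "?\<rho> \<ge> 0" using p by simp
    show "16/15 / (fact n * ?G) \<ge> 0" using Gamma_pos[of n] by simp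
    show "?\<rho> * (1 - (2 * real n + \<alpha>) / x) \<ge> 1" if "x \<ge> c" for x
    proof -
      have "(2 * real n + \<alpha>) / x \<le> (2 * real n + \<alpha>) / (4 * real n + 2 * \<alpha> + 2)"
        using that c p by (intro divide_left_mono mult_pos_pos) auto
      then have "?\<rho> * (1 - (2 * real n + \<alpha>) / (4 * real n + 2 * \<alpha> + 2)) \<le> ?\<rho> * (1 - (2 * real n + \<alpha>) / x)"
        using p by (intro mult_left_mono) auto
      moreover have "4 * real n + 2 * \<alpha> + 2 = 2 * (2 * real n + \<alpha>) + 2" by simp
      then have "?\<rho> * (1 - (2 * real n + \<alpha>) / (4 * real n + 2 * \<alpha> + 2)) = 1"
        using half_quotient_id[OF less_imp_le[OF p]] by (simp only:)
      ultimately show ?thesis by (simp only:)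
    qed
    show "Laguerre_kernel \<alpha> n x \<le> 16/15 / (fact n * ?G) * x^(2 * n)" if "x \<ge> c" for x
      using Laguerre_kernel_bound[OF \<alpha>_ge, of n x] that c by simp
    have "?\<rho> * (16/15) / ?G \<le> 5/3" by (rule iffD2[OF pos_divide_le_eq[OF Gamma_pos] main])
    then have "?\<rho> * (16/15) / ?G / fact n \<le> 5/3 / fact n" by (intro divide_right_mono) auto
    moreover have "r * (16/15 / (f * g)) = r * (16/15) / g / f" for r f g :: real by simp
    ultimately show "?\<rho> * (16/15 / (fact n * ?G)) \<le> 5/3 / fact n" by (simp only:)
  qed
qed

text \<open>
  For \<open>n = 1\<close> and small \<open>\<alpha>\<close> the bound \<open>|L\<^sub>1(t)| \<le> t\<close> is too lossy, so the kernel is used exactly.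
\<close>
lemma Laguerre_comb_tail_1:
  assumes c: "c > 6 + 2 * \<alpha>"
  shows "(LINT t|W. indicator {c/2<..} t * (Laguerre_comb 1 a t)\<^sup>2) \<le> (LINT t|W. (Laguerre_comb 1 a t)\<^sup>2) * tail_const 1 c"
proof -
  define \<Gamma> where "\<Gamma> = Gamma (\<alpha> + 2)"
  have \<Gamma>: "4/5 \<le> \<Gamma>" unfolding \<Gamma>_def using \<alpha>_ge by (intro Gamma_ge_4_5) auto
  have \<Gamma>_rec: "\<Gamma> = (\<alpha> + 1) * Gamma (\<alpha> + 1)"
    using Gamma_real_plus1[of "\<alpha> + 1"] \<alpha>_ge by (simp add: \<Gamma>_def add_ac)
  have a1: "\<alpha> + 1 > 0" and c0: "c > 5" using c \<alpha>_ge by auto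
  have K: "Laguerre_kernel \<alpha> 1 x = (x\<^sup>2 - 2 * (1 + \<alpha>) * x + (1 + \<alpha>) * (2 + \<alpha>)) / \<Gamma>" for x
  proof -
    have "Laguerre_kernel \<alpha> 1 x = 1 / Gamma (\<alpha> + 1) + (\<alpha> + 1 - x)\<^sup>2 / \<Gamma>"
      using Laguerre_0[OF \<alpha>_ge] Laguerre_1[OF \<alpha>_ge] by (simp add: Laguerre_kernel_def \<Gamma>_def add_ac)
    also have "1 / Gamma (\<alpha> + 1) = (\<alpha> + 1) / \<Gamma>" unfolding \<Gamma>_rec using a1 by simp
    finally show ?thesis by (simp add: add_divide_distrib[symmetric] power2_eq_square algebra_simps)
  qed
  let ?e = "\<lambda>q x. - (x powr q * exp (- x))"
  \<comment> \<open>The coefficients 1 and -\<alpha> reproduce the x^2 and x terms of the kernel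
    exactly and leave the constant 2 (1 + \<alpha>). The last summand contributes 4 (1 + \<alpha>)
    (1 - \<alpha>/x), which is enough because \<alpha>/x \<le> 1/2.\<close>
  let ?G = "\<lambda>x. (?e (\<alpha> + 2) x - \<alpha> * ?e (\<alpha> + 1) x + 4 * (1 + \<alpha>) * ?e \<alpha> x) / \<Gamma>"
  let ?g = "\<lambda>x. x powr \<alpha> * exp (- x) * (x\<^sup>2 - 2 * (\<alpha> + 1) * x + \<alpha> * (\<alpha> + 1) + 4 * (1 + \<alpha>) * (1 - \<alpha> / x)) / \<Gamma>"
  have "(LINT t|W. indicator {c/2<..} t * (Laguerre_comb 1 a t)\<^sup>2) \<le> (LINT t|W. (Laguerre_comb 1 a t)\<^sup>2) * - ?G (2 * (c/2))"
  proof (rule Laguerre_comb_tail_le)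
    show "(?G has_real_derivative ?g x) (at x)" if "2 * (c/2) \<le> x" for x
    proof -
      have x: "x > 0" using that c0 by simp
      have p: "x powr (\<alpha> + 2) = x powr \<alpha> * x\<^sup>2" "x powr (\<alpha> + 1) = x powr \<alpha> * x"
        using x powr_add[of x \<alpha> 2] powr_add[of x \<alpha> 1] by simp_all
      have q: "x\<^sup>2 * (1 - (\<alpha> + 2) / x) = x\<^sup>2 - (\<alpha> + 2) * x" "x * (1 - (\<alpha> + 1) / x) = x - (\<alpha> + 1)"
        using x by (simp_all add: power2_eq_square right_diff_distrib)
      have "P * X * e * z - \<alpha> * (P * x * e * y) + w * (P * e * v) = P * e * (X * z - \<alpha> * (x * y) + w * v)"
        for P X e z y w v :: real
        by (simp add: algebra_simps)
      from this[of "x powr \<alpha>" "x\<^sup>2" "exp (- x)" "1 - (\<alpha> + 2) / x" "1 - (\<alpha> + 1) / x" "4 * (1 + \<alpha>)" "1 - \<alpha> / x"]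
      have eq: "x powr (\<alpha> + 2) * exp (- x) * (1 - (\<alpha> + 2) / x) - \<alpha> * (x powr (\<alpha> + 1) * exp (- x) * (1 - (\<alpha> + 1) / x))
        + 4 * (1 + \<alpha>) * (x powr \<alpha> * exp (- x) * (1 - \<alpha> / x)) =
        x powr \<alpha> * exp (- x) * (x\<^sup>2 - 2 * (\<alpha> + 1) * x + \<alpha> * (\<alpha> + 1) + 4 * (1 + \<alpha>) * (1 - \<alpha> / x))"
        unfolding p q by (simp only:) (simp add: algebra_simps)
      note d = has_real_derivative_powr_exp[OF x]
      show ?thesis unfolding eq[symmetric]
        by (intro DERIV_cdivide DERIV_add DERIV_diff DERIV_cmult d)
    qed
    show "x powr \<alpha> * exp (- x) * Laguerre_kernel \<alpha> 1 x \<le> ?g x" if "2 * (c/2) \<le> x" for x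
    proof -
      have x: "x > 0" "x \<ge> 2 * \<alpha>" using that c c0 by auto
      have "\<alpha> / x \<le> 1/2" using x by (simp add: pos_divide_le_eq)
      then have "4 * (1 + \<alpha>) * (1/2) \<le> 4 * (1 + \<alpha>) * (1 - \<alpha> / x)" using a1 by (intro mult_left_mono) auto
      then have "x\<^sup>2 - 2 * (1 + \<alpha>) * x + (1 + \<alpha>) * (2 + \<alpha>) \<le> x\<^sup>2 - 2 * (\<alpha> + 1) * x + \<alpha> * (\<alpha> + 1) + 4 * (1 + \<alpha>) * (1 - \<alpha> / x)"
        by (simp add: algebra_simps)
      then have "x powr \<alpha> * exp (- x) * (x\<^sup>2 - 2 * (1 + \<alpha>) * x + (1 + \<alpha>) * (2 + \<alpha>)) / \<Gamma> \<le> ?g x"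
        using \<Gamma> by (intro divide_right_mono mult_left_mono) auto
      then show ?thesis unfolding K by simp
    qed
    show "(?G \<longlongrightarrow> 0) at_top"
    proof -
      have "((\<lambda>x. x powr q * exp (- x)) \<longlongrightarrow> 0) at_top" for q :: real by real_asymp
      note e = tendsto_minus[OF this]
      have "(?G \<longlongrightarrow> (- 0 - \<alpha> * - 0 + 4 * (1 + \<alpha>) * - 0) / \<Gamma>) at_top"
        using \<Gamma> by (intro tendsto_divide tendsto_add tendsto_diff tendsto_mult tendsto_const e) auto
      then show ?thesis by simp
    qed
  qed (use c0 in auto)
  also have "\<dots> \<le> (LINT t|W. (Laguerre_comb 1 a t)\<^sup>2) * tail_const 1 c"
  proof (intro mult_left_mono sq_integral_nonneg)
    have p: "c powr (\<alpha> + 2) = c powr \<alpha> * c\<^sup>2" "c powr (\<alpha> + 1) = c powr \<alpha> * c"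
      using c0 powr_add[of c \<alpha> 2] powr_add[of c \<alpha> 1] by simp_all
    \<comment> \<open>With Gamma \<ge> 4/5 the budget is 5/3 * 4/5 = 4/3 times c^2.\<close>
    have "3 * (c\<^sup>2 - \<alpha> * c + 4 * (1 + \<alpha>)) \<le> 4 * c\<^sup>2"
    proof (cases "\<alpha> \<le> 0")
      case True
      have "- \<alpha> * c \<le> 1/2 * c" using \<alpha>_ge c0 by (intro mult_right_mono) auto
      moreover have "5 * c \<le> c * c" using c0 by (intro mult_right_mono) auto
      moreover have "- \<alpha> * c = - (\<alpha> * c)" by simp
      ultimately have "12 + 12 * \<alpha> - 3 * (\<alpha> * c) \<le> c * c" using True c0 by linarith
      then show ?thesis by (simp add: power2_eq_square algebra_simps)
    next
      case False
      have "(6 + 2 * \<alpha>) * (6 + 2 * \<alpha>) \<le> c * c" using False c by (intro mult_mono) auto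
      moreover have "0 \<le> \<alpha> * c" "0 \<le> \<alpha> * \<alpha>" using False c0 by auto
      moreover have "(6 + 2 * \<alpha>) * (6 + 2 * \<alpha>) = 36 + 24 * \<alpha> + 4 * (\<alpha> * \<alpha>)" by (simp add: algebra_simps)
      ultimately have "12 + 12 * \<alpha> - 3 * (\<alpha> * c) \<le> c * c" using False by linarith
      then show ?thesis by (simp add: power2_eq_square algebra_simps)
    qed
    then have "c\<^sup>2 - \<alpha> * c + 4 * (1 + \<alpha>) \<le> 4/3 * c\<^sup>2" by simp
    also have "\<dots> \<le> 5/3 * \<Gamma> * c\<^sup>2" using \<Gamma> by (intro mult_right_mono) auto
    finally have "(c\<^sup>2 - \<alpha> * c + 4 * (1 + \<alpha>)) / \<Gamma> \<le> 5/3 * c\<^sup>2" using \<Gamma> by (simp add: pos_divide_le_eq mult_ac)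
    then have "c powr \<alpha> * exp (- c) * ((c\<^sup>2 - \<alpha> * c + 4 * (1 + \<alpha>)) / \<Gamma>) \<le> c powr \<alpha> * exp (- c) * (5/3 * c\<^sup>2)"
      by (intro mult_left_mono) auto
    moreover have "- ?G (2 * (c/2)) = c powr \<alpha> * exp (- c) * ((c\<^sup>2 - \<alpha> * c + 4 * (1 + \<alpha>)) / \<Gamma>)"
    proof -
      have gen: "- ((- (P * X * e) - a * - (P * x * e) + w * - (P * e)) / g) = P * e * ((X - a * x + w) / g)" for P X e a x w g :: real
        by (simp add: algebra_simps add_divide_distrib diff_divide_distrib)
      have cc: "2 * (c / 2) = c" by simp
      show ?thesis unfolding cc p by (rule gen)
    qed
    ultimately show "- ?G (2 * (c/2)) \<le> tail_const 1 c" by (simp add: tail_const_def mult_ac)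
  qed
  finally show ?thesis .
qed

lemma Laguerre_comb_tail:
  assumes c: "c > 4 * real n + 2 * \<alpha> + 2"
  shows "(LINT t|W. indicator {c/2<..} t * (Laguerre_comb n a t)\<^sup>2) \<le> tail_const n c * (LINT t|W. (Laguerre_comb n a t)\<^sup>2)"
proof -
  consider "n = 0" | "n = 1" | "n \<ge> 2" by linarith
  then show ?thesis
    using Laguerre_comb_tail_0[of c a] Laguerre_comb_tail_1[of c a] Laguerre_comb_tail_ge_2[of n c a] c by cases (auto simp: mult.commute)
qed

end

section \<open>Concentration\<close>

context bessel_order
begin

text \<open>Each (t/2)^i / i! is a single term of the series of exp(t/2); this rate is the growth
  that \<open>contracted_truncation\<close> permits.\<close>

lemma Laguerre_exp_bound: "\<exists>D. \<forall>t>0. \<bar>Laguerre \<alpha> k (2 * t)\<bar> \<le> D * exp (t / 2)"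
proof -
  let ?c = "\<lambda>i. real (k choose i) / Gamma (real i + \<alpha> + 1) * (4^i * fact i)"
  let ?D = "Gamma (real k + \<alpha> + 1) / fact k * (\<Sum>i\<le>k. ?c i)"
  have "\<bar>Laguerre \<alpha> k (2 * t)\<bar> \<le> ?D * exp (t / 2)" if t: "t > 0" for t
  proof -
    have "\<bar>\<Sum>i\<le>k. real (k choose i) * (- (2 * t))^i / Gamma (real i + \<alpha> + 1)\<bar> \<le> (\<Sum>i\<le>k. ?c i * exp (t / 2))"
    proof (rule order.trans[OF sum_abs sum_mono])
      fix i
      have "(t / 2)^i / fact i \<le> exp (t / 2)"
      proof -
        define f where "f = (\<lambda>j. (t / 2)^j /\<^sub>R fact j)"
        have f: "f j = (t / 2)^j / fact j" for j by (simp only: f_def real_scaleR_def divide_inverse mult.commute)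
        have sf: "f sums exp (t / 2)" unfolding f_def by (rule exp_converges)
        have "0 \<le> f j" for j unfolding f using t by simp
        then have "sum f {i} \<le> suminf f" by (intro sum_le_suminf[OF sums_summable[OF sf]]) simp_all
        also have "\<dots> = exp (t / 2)" by (rule sums_unique[OF sf, symmetric])
        finally show ?thesis by (simp add: f)
      qed
      then have "t^i \<le> 2^i * fact i * exp (t / 2)" by (simp add: power_divide pos_divide_le_eq mult_ac)
      then have "2^i * t^i \<le> 2^i * (2^i * fact i * exp (t / 2))" by (intro mult_left_mono) auto
      also have "\<dots> = 4^i * fact i * exp (t / 2)" using power_mult_distrib[of "2::real" 2 i] by simp
      finally have "(2 * t)^i \<le> 4^i * fact i * exp (t / 2)" by (simp add: power_mult_distrib)
      then have "real (k choose i) / Gamma (real i + \<alpha> + 1) * (2 * t)^i \<le> real (k choose i) / Gamma (real i + \<alpha> + 1) * (4^i * fact i * exp (t / 2))"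
        using Gamma_pos[of i] by (intro mult_left_mono) auto
      then show "\<bar>real (k choose i) * (- (2 * t))^i / Gamma (real i + \<alpha> + 1)\<bar> \<le> ?c i * exp (t / 2)"
        using Gamma_pos[of i] t by (simp add: abs_mult power_abs mult_ac)
    qed
    then have "\<bar>\<Sum>i\<le>k. real (k choose i) * (- (2 * t))^i / Gamma (real i + \<alpha> + 1)\<bar> \<le> (\<Sum>i\<le>k. ?c i) * exp (t / 2)"
      by (simp only: sum_distrib_right)
    then have "Gamma (real k + \<alpha> + 1) / fact k * \<bar>\<Sum>i\<le>k. real (k choose i) * (- (2 * t))^i / Gamma (real i + \<alpha> + 1)\<bar>
        \<le> Gamma (real k + \<alpha> + 1) / fact k * ((\<Sum>i\<le>k. ?c i) * exp (t / 2))"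
      using Gamma_pos[of k] by (intro mult_left_mono) auto
    moreover have "\<bar>Gamma (real k + \<alpha> + 1) / fact k\<bar> = Gamma (real k + \<alpha> + 1) / fact k" using Gamma_pos[of k] by simp
    ultimately show ?thesis unfolding Laguerre_def abs_mult by (simp only: mult.assoc)
  qed
  then show ?thesis by blast
qed

lemma continuous_Laguerre: "continuous_on UNIV (\<lambda>t. Laguerre \<alpha> k (2 * t))"
  unfolding Laguerre_def using Gamma_pos by (intro continuous_intros) (simp add: less_imp_neq[symmetric])

lemma contracted_Laguerre_comb_tail: "contracted (\<lambda>t. indicator {b<..} t * Laguerre_comb n a t)"
proof -
  let ?P = "\<lambda>t. \<Sum>k\<le>n. a k * Laguerre \<alpha> k (2 * t)"
  have "\<forall>k. \<exists>D. \<forall>t>0. \<bar>Laguerre \<alpha> k (2 * t)\<bar> \<le> D * exp (t / 2)" using Laguerre_exp_bound by blast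
  from choice[OF this] obtain D where D: "\<forall>k. \<forall>t>0. \<bar>Laguerre \<alpha> k (2 * t)\<bar> \<le> D k * exp (t / 2)" ..
  have "contracted (\<lambda>t. indicator {b<..} t * (exp (- t) * ?P t))"
  proof (rule contracted_truncation)
    show "continuous_on UNIV ?P" by (intro continuous_intros continuous_Laguerre)
    fix t :: real assume t: "t > 0"
    have "\<bar>?P t\<bar> \<le> (\<Sum>k\<le>n. \<bar>a k\<bar> * (D k * exp (t / 2)))"
    proof (rule order.trans[OF sum_abs sum_mono])
      show "\<bar>a k * Laguerre \<alpha> k (2 * t)\<bar> \<le> \<bar>a k\<bar> * (D k * exp (t / 2))" for k
        unfolding abs_mult using D t by (intro mult_left_mono) auto
    qed
    then show "\<bar>?P t\<bar> \<le> (\<Sum>k\<le>n. \<bar>a k\<bar> * D k) * exp (t / 2)"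
      by (simp add: sum_distrib_right mult.assoc)
  qed
  moreover have "exp (- t) * ?P t = Laguerre_comb n a t" for t
    unfolding Laguerre_comb_def Laguerre_fun_def sum_distrib_left by (intro sum.cong refl) simp
  ultimately show ?thesis by simp
qed

text \<open>
  With \<open>P\<close> the restriction to \<open>(0, b)\<close>, \<open>\<phi> = Laguerre_comb n a\<close> and \<open>\<psi> = U \<phi>\<close>, symmetry of \<open>U\<close> gives
  \<open>\<langle>U P \<phi>, P \<psi>\<rangle> = \<parallel>P \<psi>\<parallel>\<^sup>2 - \<parallel>\<phi> - P \<phi>\<parallel>\<^sup>2 + \<langle>\<phi> - P \<phi>, U (\<psi> - P \<psi>)\<rangle>\<close>, and the last term is controlled
  by contractivity.
\<close>
lemma concentration:
  assumes c: "c > 4 * real n + 2 * \<alpha> + 2" and small: "tail_const n c \<le> 1/4"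
  defines "P \<equiv> \<lambda>a t. indicator {..c/2} t * Laguerre_comb n a t"
  shows "(1 - 4 * tail_const n c) * (LINT t|W. (P a t)\<^sup>2) * (LINT t|W. (P (\<lambda>k. (-1)^k * a k) t)\<^sup>2)
     \<le> (LINT t|W. P (\<lambda>k. (-1)^k * a k) t * U (P a) t)\<^sup>2"
    and "(LINT t|W. (P a t)\<^sup>2) \<ge> (1 - tail_const n c) * (\<Sum>k\<le>n. (a k)\<^sup>2 * Laguerre_fun_sqnorm k)"
proof -
  define R where "R = (\<lambda>a t. indicator {c/2<..} t * Laguerre_comb n a t)"
  define a' where "a' = (\<lambda>k. (-1)^k * a k)"
  let ?I = "integral\<^sup>L W"
  let ?\<kappa> = "tail_const n c"
  have [measurable]: "Laguerre_comb n a \<in> borel_measurable borel" for a using borel_measurable_integrable[OF integrable_Laguerre_comb] by simp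
  have iP: "integrable W (P a)" and iR: "integrable W (R a)" for a
    unfolding P_def R_def
    by (rule Bochner_Integration.integrable_bound[OF integrable_Laguerre_comb[of n a]]; auto simp: indicator_def)+
  have PR: "Laguerre_comb n a t = P a t + R a t" for a t by (auto simp: P_def R_def indicator_def)
  have Psq: "(P a t)\<^sup>2 = indicator {..c/2} t * (Laguerre_comb n a t)\<^sup>2" "P a t * Laguerre_comb n a t = indicator {..c/2} t * (Laguerre_comb n a t)\<^sup>2"
    and Rsq: "(R a t)\<^sup>2 = indicator {c/2<..} t * (Laguerre_comb n a t)\<^sup>2" "R a t * Laguerre_comb n a t = indicator {c/2<..} t * (Laguerre_comb n a t)\<^sup>2" for a t
    by (auto simp: P_def R_def indicator_def power2_eq_square)
  have iLS2: "integrable W (\<lambda>t. (Laguerre_comb n a t)\<^sup>2)" for a using sq_integrable_Laguerre_comb[of n a] by (simp add: sq_integrable_def)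
  have P2: "integrable W (\<lambda>t. (P a t)\<^sup>2)" and R2: "integrable W (\<lambda>t. (R a t)\<^sup>2)" for a
    unfolding Psq Rsq
    by (rule Bochner_Integration.integrable_bound[OF iLS2[of a]]; auto simp: indicator_def)+
  have RS: "R a \<in> sq_integrable W" for a
    using R2[of a] borel_measurable_integrable[OF iR[of a]] by (simp add: sq_integrable_def)
  define E where "E = ?I (\<lambda>t. (Laguerre_comb n a t)\<^sup>2)"
  \<comment> \<open>Alternating the signs of the coefficients, which is the action of
    \<open>U\<close>, does not change the norm.\<close>
  have E': "?I (\<lambda>t. (Laguerre_comb n a' t)\<^sup>2) = E"
    unfolding E_def integral_Laguerre_comb_square a'_def by (simp add: power_mult_distrib flip: power_mult)
  have E0: "E \<ge> 0" unfolding E_def by (rule sq_integral_nonneg)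
  define A where "A = ?I (\<lambda>t. (R a t)\<^sup>2)"
  define B where "B = ?I (\<lambda>t. (R a' t)\<^sup>2)"
  have A0: "A \<ge> 0" and B0: "B \<ge> 0" unfolding A_def B_def by (rule sq_integral_nonneg)+
  have AE: "A \<le> ?\<kappa> * E" unfolding A_def E_def Rsq by (rule Laguerre_comb_tail[OF c])
  have BE: "B \<le> ?\<kappa> * E" unfolding B_def E'[symmetric] Rsq by (rule Laguerre_comb_tail[OF c])
  have split: "?I (\<lambda>t. (Laguerre_comb n d t)\<^sup>2) = ?I (\<lambda>t. (P d t)\<^sup>2) + ?I (\<lambda>t. (R d t)\<^sup>2)" for d
  proof -
    have "(Laguerre_comb n d t)\<^sup>2 = (P d t)\<^sup>2 + (R d t)\<^sup>2" for t unfolding Psq Rsq by (auto simp: indicator_def)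
    then show ?thesis using P2[of d] R2[of d] by simp
  qed
  have PA: "?I (\<lambda>t. (P a t)\<^sup>2) = E - A" and PB: "?I (\<lambda>t. (P a' t)\<^sup>2) = E - B"
    using split[of a] split[of a'] by (simp_all add: E_def E'[unfolded E_def] A_def B_def)
  have \<kappa>0: "?\<kappa> \<ge> 0" using c \<alpha>_ge by (simp add: tail_const_def)
  show "(LINT t|W. (P a t)\<^sup>2) \<ge> (1 - ?\<kappa>) * (\<Sum>k\<le>n. (a k)\<^sup>2 * Laguerre_fun_sqnorm k)"
    using AE unfolding PA integral_Laguerre_comb_square[symmetric] E_def by (simp add: algebra_simps)
  have UP: "U (P d) t = Laguerre_comb n (\<lambda>k. (-1)^k * d k) t - U (R d) t" if "t > 0" for d t
  proof -
    have "P d = (\<lambda>t. Laguerre_comb n d t - R d t)" using PR by auto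
    then show ?thesis using U_diff[OF integrable_Laguerre_comb iR, of n d d t] U_Laguerre_comb[of t n d] that by simp
  qed
  have a'': "(\<lambda>k. (-1)^k * a' k) = a" by (auto simp: a'_def simp flip: mult.assoc power_add power_mult_distrib)
  have "?I (\<lambda>t. P a' t * U (P a) t) = ?I (\<lambda>t. (P a' t)\<^sup>2 - P a' t * U (R a) t)"
  proof (rule integral_cong_AE)
    show "AE t in W. P a' t * U (P a) t = (P a' t)\<^sup>2 - P a' t * U (R a) t"
    proof (rule AE_W_I)
      fix t :: real assume "t > 0"
      show "P a' t * U (P a) t = (P a' t)\<^sup>2 - P a' t * U (R a) t"
        unfolding UP[OF \<open>t > 0\<close>] a'_def[symmetric] right_diff_distrib Psq ..
    qed
  qed (use borel_measurable_integrable[OF integrable_mult_U[OF iP iP]] borel_measurable_integrable[OF integrable_mult_U[OF iR iP]]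
      borel_measurable_integrable[OF P2] in \<open>auto intro!: borel_measurable_diff\<close>)
  also have "\<dots> = (E - B) - ?I (\<lambda>t. R a t * U (P a') t)"
    using P2[of a'] integrable_mult_U[OF iR iP, of a' a] PB U_symmetric[OF iR iP, of a' a] by simp
  also have "?I (\<lambda>t. R a t * U (P a') t) = ?I (\<lambda>t. (R a t)\<^sup>2 - R a t * U (R a') t)"
  proof (rule integral_cong_AE)
    show "AE t in W. R a t * U (P a') t = (R a t)\<^sup>2 - R a t * U (R a') t"
    proof (rule AE_W_I)
      fix t :: real assume "t > 0"
      show "R a t * U (P a') t = (R a t)\<^sup>2 - R a t * U (R a') t"
        unfolding UP[OF \<open>t > 0\<close>] a'' right_diff_distrib Rsq ..
    qed
  qed (use borel_measurable_integrable[OF integrable_mult_U[OF iP iR]] borel_measurable_integrable[OF integrable_mult_U[OF iR iR]]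
      borel_measurable_integrable[OF R2] in \<open>auto intro!: borel_measurable_diff\<close>)
  also have "\<dots> = A - ?I (\<lambda>t. R a t * U (R a') t)"
    using R2[of a] integrable_mult_U[OF iR iR, of a a'] by (simp add: A_def)
  finally have main: "?I (\<lambda>t. P a' t * U (P a) t) = E - A - B + ?I (\<lambda>t. R a t * U (R a') t)" by simp
  have "contracted (R a')" unfolding R_def by (rule contracted_Laguerre_comb_tail)
  then have "(?I (\<lambda>t. R a t * U (R a') t))\<^sup>2 \<le> A * B"
    using iR RS unfolding contracted_def A_def B_def by blast
  then have g: "\<bar>?I (\<lambda>t. R a t * U (R a') t)\<bar> \<le> sqrt (A * B)" by (simp add: real_le_rsqrt)
  define s where "s = sqrt (A * B)"
  have s: "s\<^sup>2 = A * B" "s \<ge> 0" using A0 B0 by (auto simp: s_def)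
  have s\<kappa>: "s \<le> ?\<kappa> * E"
  proof -
    have "A * B \<le> (?\<kappa> * E)\<^sup>2" unfolding power2_eq_square using AE BE A0 B0 \<kappa>0 E0 by (intro mult_mono) auto
    then show ?thesis unfolding s_def using \<kappa>0 E0 by (intro real_le_lsqrt) auto
  qed
  have \<kappa>E: "?\<kappa> * E \<le> E / 4" using mult_right_mono[OF small E0] by simp
  define N where "N = E - A - B - s"
  \<comment> \<open>Each of A, B and s is at most \<kappa> E \<le> E/4, so at least E/4 remains.
    Nonnegativity is what allows \<open>N_le\<close> to be squared.\<close>
  have N0: "N \<ge> 0" using AE BE s\<kappa> \<kappa>E E0 unfolding N_def by linarith
  have N_le: "N \<le> ?I (\<lambda>t. P a' t * U (P a) t)" using g unfolding main N_def s_def by linarith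
  have "(1 - 4 * ?\<kappa>) * (E - A) * (E - B) \<le> N\<^sup>2"
  proof -
    \<comment> \<open>The identity rests on s^2 = A B. Its first factor consists of four terms of
      size at most \<kappa> E, whence the 4 in the bound.\<close>
    have d: "(E - A) * (E - B) - N\<^sup>2 = (A + B + 2 * s) * (E - A - B)"
      unfolding N_def using s(1) by algebra
    have "A + B + 2 * s \<le> 4 * (?\<kappa> * E)" using AE BE s\<kappa> by linarith
    moreover have "0 \<le> E - A - B" using AE BE \<kappa>E E0 by linarith
    ultimately have "(A + B + 2 * s) * (E - A - B) \<le> 4 * (?\<kappa> * E) * (E - A - B)" by (rule mult_right_mono)
    also have "\<dots> = 4 * ?\<kappa> * (E * (E - A - B))" by simp
    also have "\<dots> \<le> 4 * ?\<kappa> * ((E - A) * (E - B))"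
    proof (rule mult_left_mono)
      have "(E - A) * (E - B) = E * (E - A - B) + A * B" by (simp add: algebra_simps)
      then show "E * (E - A - B) \<le> (E - A) * (E - B)" using A0 B0 by simp
    qed (use \<kappa>0 in simp)
    finally show ?thesis using d by (simp add: algebra_simps)
  qed
  also have "\<dots> \<le> (?I (\<lambda>t. P a' t * U (P a) t))\<^sup>2" using N0 N_le by (rule power_mono[OF _ _, rotated])
  finally show "(1 - 4 * ?\<kappa>) * ?I (\<lambda>t. (P a t)\<^sup>2) * ?I (\<lambda>t. (P (\<lambda>k. (-1)^k * a k) t)\<^sup>2)
     \<le> (?I (\<lambda>t. P (\<lambda>k. (-1)^k * a k) t * U (P a) t))\<^sup>2"
    unfolding a'_def[symmetric] PA PB .
qed

end

section \<open>Transfer to the finite Hankel transform\<close>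

lemma integral_unit_meas_lborel:
  assumes "f \<in> borel_measurable borel"
  shows "(LINT x|unit_meas. f x) = (LINT x|lborel. indicator {0<..<1} x * (f x :: real))"
    and "integrable unit_meas f \<longleftrightarrow> integrable lborel (\<lambda>x. indicator {0<..<1} x * f x)"
proof -
  have m: "(\<lambda>x. indicator {0<..<1} x * f x) \<in> borel_measurable lborel" using assms by measurable
  show "(LINT x|unit_meas. f x) = (LINT x|lborel. indicator {0<..<1} x * f x)"
    using integral_completion[OF m] by (simp add: integral_restrict_space)
  show "integrable unit_meas f \<longleftrightarrow> integrable lborel (\<lambda>x. indicator {0<..<1} x * f x)"
    using integrable_completion[OF m] by (simp add: integrable_restrict_space)
qed

locale hankel = bessel_order +
  fixes c :: real
  assumes c_pos: "c > 0"
begin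

text \<open>As \<open>0 powr 0 = 0\<close>, the order \<open>-1/2\<close> is split off to keep \<open>kern\<close> continuous at \<open>0\<close>.\<close>
definition kern :: "real \<Rightarrow> real" where
  "kern z = c powr (\<alpha> + 1/2) / 2 powr \<alpha> * (if \<alpha> = -1/2 then 1 else z powr (\<alpha> + 1/2)) * Bessel_Clifford \<alpha> (c\<^sup>2 * z\<^sup>2 / 4)"

lemma continuous_kern: "continuous_on {0..} kern"
proof -
  have "continuous_on {0..} (\<lambda>z. Bessel_Clifford \<alpha> (c\<^sup>2 * z\<^sup>2 / 4))"
    by (intro continuous_on_compose2[OF continuous_on_Bessel_Clifford[OF \<alpha>_ge, of UNIV]] continuous_intros) auto
  moreover have "continuous_on {0..} (\<lambda>z. if \<alpha> = -1/2 then 1 else z powr (\<alpha> + 1/2))"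
  proof (cases "\<alpha> = -1/2")
    case False
    then have "\<alpha> + 1/2 > 0" using \<alpha>_ge by simp
    then have "continuous_on {0..} (\<lambda>z::real. z powr (\<alpha> + 1/2))"
      by (intro continuous_on_powr' continuous_intros) auto
    then show ?thesis using False by simp
  qed simp
  ultimately show ?thesis unfolding kern_def by (intro continuous_intros)
qed

sublocale symmetric_kernel "\<lambda>x y. kern (x * y)"
proof
  have "continuous_on ({0..1} \<times> {0..1}) (\<lambda>p. kern (fst p * snd p))"
    by (intro continuous_on_compose2[OF continuous_kern] continuous_intros) auto
  then show "continuous_on ({0..1} \<times> {0..1}) (\<lambda>(x, y). kern (x * y))" by (simp add: case_prod_beta)
qed (simp add: mult.commute)

lemma kern_pos:
  assumes "x > 0" "y > 0"
  shows "kern (x * y) = c powr (\<alpha> + 1/2) / 2 powr \<alpha> * (x powr (\<alpha> + 1/2) * y powr (\<alpha> + 1/2))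
    * Bessel_Clifford \<alpha> \<bar>(c * x\<^sup>2 / 2) * (c * y\<^sup>2 / 2)\<bar>"
proof -
  have "(if \<alpha> = -1/2 then 1 else (x * y) powr (\<alpha> + 1/2)) = x powr (\<alpha> + 1/2) * y powr (\<alpha> + 1/2)"
    using assms by (simp add: powr_mult)
  moreover have "c\<^sup>2 * (x * y)\<^sup>2 / 4 = \<bar>(c * x\<^sup>2 / 2) * (c * y\<^sup>2 / 2)\<bar>"
    using c_pos by (simp add: power2_eq_square abs_mult)
  ultimately show ?thesis unfolding kern_def by (simp only:)
qed

lemma kern_eq_Bessel:
  assumes "x > 0" "y > 0"
  shows "sqrt (c * x * y) * Bessel_J \<alpha> (c * x * y) = kern (x * y)"
proof -
  let ?z = "c * x * y"
  have z: "?z > 0" using assms c_pos by simp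
  have "sqrt ?z * (?z/2) powr \<alpha> = ?z powr (\<alpha> + 1/2) / 2 powr \<alpha>"
    using z by (simp add: powr_half_sqrt[symmetric] powr_divide powr_add)
  also have "?z powr (\<alpha> + 1/2) = c powr (\<alpha> + 1/2) * (x powr (\<alpha> + 1/2) * y powr (\<alpha> + 1/2))"
    using assms c_pos by (simp add: powr_mult)
  finally have 1: "sqrt ?z * (?z/2) powr \<alpha> = c powr (\<alpha> + 1/2) / 2 powr \<alpha> * (x powr (\<alpha> + 1/2) * y powr (\<alpha> + 1/2))" by simp
  have 2: "?z\<^sup>2/4 = \<bar>(c * x\<^sup>2 / 2) * (c * y\<^sup>2 / 2)\<bar>"
    using c_pos by (simp add: power2_eq_square abs_mult)
  show ?thesis
    unfolding kern_pos[OF assms] Bessel_J_conv_Bessel_Clifford[OF \<alpha>_ge z] 1[symmetric] 2 by (simp only: mult.assoc)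
qed

lemma finite_Hankel_eq_T:
  assumes "x \<in> {0<..<1}"
  shows "finite_Hankel \<alpha> c f x = T f x"
  unfolding finite_Hankel_def T_def
  by (intro Bochner_Integration.integral_cong refl) (use assms kern_eq_Bessel in simp)

lemma Q_Hankel_eq_T:
  assumes "x \<in> {0<..<1}"
  shows "Q_Hankel \<alpha> c f x = c * T (T f) x"
proof -
  have "T (finite_Hankel \<alpha> c f) x = T (T f) x"
    unfolding T_def[of "finite_Hankel \<alpha> c f"] T_def[of "T f"]
    by (intro Bochner_Integration.integral_cong refl) (simp add: finite_Hankel_eq_T)
  then show ?thesis unfolding Q_Hankel_def finite_Hankel_eq_T[OF assms] by simp
qed

text \<open>The reciprocal of the Jacobian factor: for t = c x^2 / 2, the measure t^\<alpha> dt is c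
  (c/2)^\<alpha> x^(2 \<alpha> + 1) dx.\<close>

definition subst_const :: real where "subst_const = 1 / (c * (c/2) powr \<alpha>)"

lemma subst_const_pos: "subst_const > 0" using c_pos by (simp add: subst_const_def)

lemma substitution:
  assumes [measurable]: "\<Phi> \<in> borel_measurable borel"
    and int: "integrable W (\<lambda>t. indicator {..c/2} t * \<Phi> t)"
  shows "(LINT x|unit_meas. x powr (2 * \<alpha> + 1) * \<Phi> (c * x\<^sup>2 / 2)) = subst_const * (LINT t|W. indicator {..c/2} t * \<Phi> t)"
    and "integrable unit_meas (\<lambda>x. x powr (2 * \<alpha> + 1) * \<Phi> (c * x\<^sup>2 / 2))"
proof -
  let ?g = "\<lambda>x. c * x\<^sup>2 / 2"
  let ?f = "\<lambda>t. indicator {0<..} t * t powr \<alpha> * \<Phi> t"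
  have ind: "indicator {0<..} t * t powr \<alpha> * (indicator {..c/2} t * \<Phi> t) = ?f t * indicator {?g 0..?g 1} t" for t :: real
    by (auto simp: indicator_def)
  have "integrable lborel (\<lambda>t. ?f t * indicator {?g 0..?g 1} t)"
    using int unfolding ind[symmetric] by (subst (asm) integrable_W) auto
  then have si: "set_integrable lborel {?g 0..?g 1} ?f"
    by (simp add: set_integrable_def mult.commute)
  have dg: "(?g has_real_derivative c * x) (at x)" for x
    by (auto intro!: derivative_eq_intros)
  have cg: "continuous_on {0..1} (\<lambda>x. c * x)" by (intro continuous_intros)
  have ng: "c * x \<ge> 0" if "x \<in> {0..1}" for x using c_pos that by simp
  note sub = integral_substitution[where g="?g" and a=0 and b=1 and f="?f" and g'="\<lambda>x. c * x", OF si dg cg ng zero_le_one]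
  have W: "(LINT t|W. indicator {..c/2} t * \<Phi> t) = (LBINT x. ?f (?g x) * (c * x) * indicator {0..1} x)"
  proof -
    have "(LINT t|W. indicator {..c/2} t * \<Phi> t) = (LBINT t. indicator {0<..} t * t powr \<alpha> * (indicator {..c/2} t * \<Phi> t))"
      by (rule integral_W) measurable
    also have "\<dots> = (LBINT x. ?f (?g x) * (c * x) * indicator {0..1} x)"
      unfolding ind by (rule sub(2))
    finally show ?thesis .
  qed
  \<comment> \<open>The closed interval of the substitution and the open one of
    \<open>unit_meas\<close> differ visibly only at x = 1; at 0 both sides vanish.\<close>
  have AEeq: "AE x in lborel. ?f (?g x) * (c * x) * indicator {0..1} x
     = (c * (c/2) powr \<alpha>) * (indicator {0<..<1} x * (x powr (2 * \<alpha> + 1) * \<Phi> (?g x)))"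
    using AE_lborel_singleton[of 1]
  proof eventually_elim
    case (elim x)
    show ?case
    proof (cases "0 < x \<and> x < 1")
      case True
      have "(c * x\<^sup>2 / 2) powr \<alpha> = (c/2) powr \<alpha> * x powr (2 * \<alpha>)"
      proof -
        have "c * x\<^sup>2 / 2 = (c/2) * (x powr 2)" using True by simp
        then show ?thesis using c_pos by (simp only: powr_mult powr_powr)
      qed
      moreover have "x powr (2 * \<alpha> + 1) = x powr (2 * \<alpha>) * x" using True by (simp add: powr_add)
      ultimately show ?thesis using True c_pos by simp
    next
      case False
      then show ?thesis using elim by (auto simp: indicator_def)
    qed
  qed
  have m: "(\<lambda>x. x powr (2 * \<alpha> + 1) * \<Phi> (?g x)) \<in> borel_measurable borel" by measurable
  have m1: "(\<lambda>x. ?f (?g x) * (c * x) * indicator {0..1} x) \<in> borel_measurable lborel" by measurable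
  have m2: "(\<lambda>x. (c * (c/2) powr \<alpha>) * (indicator {0<..<1} x * (x powr (2 * \<alpha> + 1) * \<Phi> (?g x)))) \<in> borel_measurable lborel"
    by measurable
  have "(LBINT x. ?f (?g x) * (c * x) * indicator {0..1} x)
      = (LBINT x. (c * (c/2) powr \<alpha>) * (indicator {0<..<1} x * (x powr (2 * \<alpha> + 1) * \<Phi> (?g x))))"
    by (rule integral_cong_AE[OF m1 m2 AEeq])
  also have "\<dots> = (c * (c/2) powr \<alpha>) * (LINT x|unit_meas. x powr (2 * \<alpha> + 1) * \<Phi> (?g x))"
    using integral_unit_meas_lborel(1)[OF m] by simp
  finally show "(LINT x|unit_meas. x powr (2 * \<alpha> + 1) * \<Phi> (?g x)) = subst_const * (LINT t|W. indicator {..c/2} t * \<Phi> t)"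
    unfolding W subst_const_def using c_pos by simp
  have "integrable lborel (\<lambda>x. ?f (?g x) * (c * x) * indicator {0..1} x)"
    using sub(1) by (simp add: set_integrable_def mult.commute)
  then have "integrable lborel (\<lambda>x. (c * (c/2) powr \<alpha>) * (indicator {0<..<1} x * (x powr (2 * \<alpha> + 1) * \<Phi> (?g x))))"
    by (rule iffD1[OF integrable_cong_AE[OF m1 m2 AEeq]])
  then have "integrable lborel (\<lambda>x. indicator {0<..<1} x * (x powr (2 * \<alpha> + 1) * \<Phi> (?g x)))"
    (is "integrable _ ?h")
  proof -
    assume "integrable lborel (\<lambda>x. (c * (c/2) powr \<alpha>) * ?h x)"
    then have "integrable lborel (\<lambda>x. subst_const * ((c * (c/2) powr \<alpha>) * ?h x))" by (rule integrable_mult_right)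
    moreover have "subst_const * ((c * (c/2) powr \<alpha>) * z) = z" for z using c_pos by (simp add: subst_const_def)
    ultimately show ?thesis by (simp only:)
  qed
  then show "integrable unit_meas (\<lambda>x. x powr (2 * \<alpha> + 1) * \<Phi> (?g x))"
    using integral_unit_meas_lborel(2)[OF m] by simp
qed

text \<open>The power of x is the square root of the Jacobian weight x^(2 \<alpha> + 1), so that
  pulling back preserves inner products up to \<open>subst_const\<close>.\<close>

definition test_fun :: "nat \<Rightarrow> real \<Rightarrow> real" where
  "test_fun k x = x powr (\<alpha> + 1/2) * Laguerre_fun k (c * x\<^sup>2 / 2)"

definition test_comb :: "nat \<Rightarrow> (nat \<Rightarrow> real) \<Rightarrow> real \<Rightarrow> real" where
  "test_comb n a x = (\<Sum>k\<le>n. a k * test_fun k x)"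

lemma test_comb_eq: "test_comb n a x = x powr (\<alpha> + 1/2) * Laguerre_comb n a (c * x\<^sup>2 / 2)"
  unfolding test_comb_def test_fun_def Laguerre_comb_def sum_distrib_left by (intro sum.cong refl) simp

lemma measurable_Laguerre_comb [measurable]: "Laguerre_comb n a \<in> borel_measurable borel"
  using borel_measurable_integrable[OF integrable_Laguerre_comb] by simp

lemma integrable_trunc: "integrable W f \<Longrightarrow> integrable W (\<lambda>t. indicator {..b} t * (f t :: real))"
  by (rule Bochner_Integration.integrable_bound[of W f]) (auto simp: indicator_def)

lemma powr_half_square: "x > 0 \<Longrightarrow> x powr (\<alpha> + 1/2) * x powr (\<alpha> + 1/2) = x powr (2 * \<alpha> + 1)"
  by (simp flip: powr_add)

lemma integral_test_comb_square:
  "(LINT x|unit_meas. (test_comb n a x)\<^sup>2) = subst_const * (LINT t|W. (indicator {..c/2} t * Laguerre_comb n a t)\<^sup>2)"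
  "test_comb n a \<in> sq_integrable unit_meas"
proof -
  have i: "integrable W (\<lambda>t. indicator {..c/2} t * (Laguerre_comb n a t)\<^sup>2)"
    using sq_integrable_Laguerre_comb[of n a] by (intro integrable_trunc) (simp add: sq_integrable_def)
  have eq: "(test_comb n a x)\<^sup>2 = x powr (2 * \<alpha> + 1) * (Laguerre_comb n a (c * x\<^sup>2 / 2))\<^sup>2" if "x \<in> {0<..<1}" for x
    using powr_half_square[of x] that by (simp add: test_comb_eq power_mult_distrib power2_eq_square)
  have m: "(\<lambda>t. (Laguerre_comb n a t)\<^sup>2) \<in> borel_measurable borel" by measurable
  have "(LINT x|unit_meas. (test_comb n a x)\<^sup>2) = (LINT x|unit_meas. x powr (2 * \<alpha> + 1) * (Laguerre_comb n a (c * x\<^sup>2 / 2))\<^sup>2)"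
    by (intro Bochner_Integration.integral_cong refl eq) (simp only: space_unit_meas)
  also have "\<dots> = subst_const * (LINT t|W. indicator {..c/2} t * (Laguerre_comb n a t)\<^sup>2)"
    by (rule substitution(1)[OF m i])
  also have "(\<lambda>t. indicator {..c/2} t * (Laguerre_comb n a t)\<^sup>2) = (\<lambda>t. (indicator {..c/2} t * Laguerre_comb n a t)\<^sup>2)"
    by (auto simp: indicator_def)
  finally show "(LINT x|unit_meas. (test_comb n a x)\<^sup>2) = subst_const * (LINT t|W. (indicator {..c/2} t * Laguerre_comb n a t)\<^sup>2)" .
  have "integrable unit_meas (\<lambda>x. (test_comb n a x)\<^sup>2)"
    using substitution(2)[OF m i] by (subst Bochner_Integration.integrable_cong[OF refl eq]) (simp_all only: space_unit_meas)
  moreover have "test_comb n a \<in> borel_measurable unit_meas"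
  proof -
    have "test_comb n a \<in> borel_measurable borel" unfolding test_comb_eq[abs_def] by measurable
    moreover have "(\<lambda>x. x) \<in> unit_meas \<rightarrow>\<^sub>M (borel :: real measure)" by (rule measurable_unit_meas_borel) simp
    ultimately show ?thesis using measurable_compose by fastforce
  qed
  ultimately show "test_comb n a \<in> sq_integrable unit_meas" by (simp add: sq_integrable_def)
qed

text \<open>In the variable t the finite transform is P U P divided by sqrt c: the constants of the
  kernel and of the Jacobian collapse to c^(-1/2), which the factor c in \<open>Q_Hankel\<close>
  undoes.\<close>

lemma T_test_comb:
  assumes x: "x \<in> {0<..<1}"
  shows "T (test_comb n a) x = x powr (\<alpha> + 1/2) / sqrt c * U (\<lambda>t. indicator {..c/2} t * Laguerre_comb n a t) (c * x\<^sup>2 / 2)"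
proof -
  let ?C = "c powr (\<alpha> + 1/2) / 2 powr \<alpha>" and ?\<sigma> = "c * x\<^sup>2 / 2"
  let ?\<Phi> = "\<lambda>t. Bessel_Clifford \<alpha> \<bar>?\<sigma> * t\<bar> * Laguerre_comb n a t"
  have m: "?\<Phi> \<in> borel_measurable borel" by measurable
  have i: "integrable W (\<lambda>t. indicator {..c/2} t * ?\<Phi> t)"
    by (intro integrable_trunc integrable_U_integrand integrable_Laguerre_comb)
  have "T (test_comb n a) x = (LINT y|unit_meas. ?C * x powr (\<alpha> + 1/2) * (y powr (2 * \<alpha> + 1) * ?\<Phi> (c * y\<^sup>2 / 2)))"
    unfolding T_def
  proof (intro Bochner_Integration.integral_cong refl)
    fix y assume "y \<in> space unit_meas"
    then have y: "y > 0" by simp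
    have "x > 0" using x by simp
    show "kern (x * y) * test_comb n a y = ?C * x powr (\<alpha> + 1/2) * (y powr (2 * \<alpha> + 1) * ?\<Phi> (c * y\<^sup>2 / 2))"
      unfolding kern_pos[OF \<open>x > 0\<close> y] test_comb_eq powr_half_square[OF y, symmetric] by (simp only: mult_ac)
  qed
  also have "\<dots> = ?C * x powr (\<alpha> + 1/2) * (LINT y|unit_meas. y powr (2 * \<alpha> + 1) * ?\<Phi> (c * y\<^sup>2 / 2))"
    by (rule integral_mult_right_zero)
  also have "\<dots> = ?C * x powr (\<alpha> + 1/2) * (subst_const * (LINT t|W. indicator {..c/2} t * ?\<Phi> t))"
    by (simp only: substitution(1)[OF m i])
  also have "(LINT t|W. indicator {..c/2} t * ?\<Phi> t) = U (\<lambda>t. indicator {..c/2} t * Laguerre_comb n a t) ?\<sigma>"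
    unfolding U_def by (simp only: mult_ac)
  also have "?C * x powr (\<alpha> + 1/2) * (subst_const * U (\<lambda>t. indicator {..c/2} t * Laguerre_comb n a t) ?\<sigma>)
      = (?C * subst_const) * x powr (\<alpha> + 1/2) * U (\<lambda>t. indicator {..c/2} t * Laguerre_comb n a t) ?\<sigma>" by simp
  also have "?C * subst_const = 1 / sqrt c"
  proof -
    have "c powr (\<alpha> + 1/2) = c powr \<alpha> * sqrt c" using c_pos by (simp add: powr_add powr_half_sqrt)
    moreover have "(c/2) powr \<alpha> = c powr \<alpha> / 2 powr \<alpha>" using c_pos by (simp add: powr_divide)
    moreover have "c = sqrt c * sqrt c" using c_pos by simp
    moreover have "sqrt c > 0" "c powr \<alpha> > 0" using c_pos by auto
    moreover have "p * s / d * (1 / ((s * s) * (p / d))) = 1 / s" if "s > 0" "p > 0" "d > 0" for p s d :: real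
      using that by (simp add: field_simps)
    ultimately show ?thesis unfolding subst_const_def by (metis powr_gt_zero zero_less_numeral less_irrefl)
  qed
  finally show ?thesis by simp
qed

lemma integral_T_test_comb:
  "(LINT x|unit_meas. T (test_comb n a) x * test_comb n d x) =
     subst_const / sqrt c * (LINT t|W. (indicator {..c/2} t * Laguerre_comb n d t) * U (\<lambda>t. indicator {..c/2} t * Laguerre_comb n a t) t)"
proof -
  let ?P = "\<lambda>a t. indicator {..c/2} t * Laguerre_comb n a t"
  have P: "integrable W (?P a)" for a by (intro integrable_trunc integrable_Laguerre_comb)
  have Pm [measurable]: "?P a \<in> borel_measurable borel" for a by measurable
  have m: "(\<lambda>t. Laguerre_comb n d t * U (?P a) t) \<in> borel_measurable borel" by measurable
  have i: "integrable W (\<lambda>t. indicator {..c/2} t * (Laguerre_comb n d t * U (?P a) t))"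
    by (intro integrable_trunc integrable_mult_U integrable_Laguerre_comb P)
  have "(LINT x|unit_meas. T (test_comb n a) x * test_comb n d x) =
      (LINT x|unit_meas. 1 / sqrt c * (x powr (2 * \<alpha> + 1) * (Laguerre_comb n d (c * x\<^sup>2 / 2) * U (?P a) (c * x\<^sup>2 / 2))))"
  proof (intro Bochner_Integration.integral_cong refl)
    fix x assume "x \<in> space unit_meas"
    then have x: "x \<in> {0<..<1}" by (simp only: space_unit_meas)
    then have x0: "x > 0" by simp
    show "T (test_comb n a) x * test_comb n d x = 1 / sqrt c * (x powr (2 * \<alpha> + 1) * (Laguerre_comb n d (c * x\<^sup>2 / 2) * U (?P a) (c * x\<^sup>2 / 2)))"
      unfolding T_test_comb[OF x] test_comb_eq powr_half_square[OF x0, symmetric] by simp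
  qed
  also have "\<dots> = 1 / sqrt c * (LINT x|unit_meas. x powr (2 * \<alpha> + 1) * (Laguerre_comb n d (c * x\<^sup>2 / 2) * U (?P a) (c * x\<^sup>2 / 2)))"
    by (rule integral_mult_right_zero)
  also have "\<dots> = 1 / sqrt c * (subst_const * (LINT t|W. indicator {..c/2} t * (Laguerre_comb n d t * U (?P a) t)))"
    by (simp only: substitution(1)[OF m i])
  finally show ?thesis by (simp add: mult.assoc)
qed

lemma Laguerre_fun_sqnorm_sum_pos:
  assumes "i \<le> n" "a i \<noteq> 0" shows "(\<Sum>k\<le>n. (a k)\<^sup>2 * Laguerre_fun_sqnorm k) > 0"
proof (rule sum_pos2[of _ i])
  show "0 < (a i)\<^sup>2 * Laguerre_fun_sqnorm i" using assms Laguerre_fun_sqnorm_pos[of i] by simp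
  show "0 \<le> (a k)\<^sup>2 * Laguerre_fun_sqnorm k" for k using Laguerre_fun_sqnorm_pos[of k] by simp
qed (use assms in auto)

text \<open>For 4 \<kappa> \<ge> 1 positivity of the operator is enough. Otherwise
  \<open>concentration\<close> applies, and it also shows that the truncated combinations remain
  independent, as the min-max argument requires.\<close>

lemma Q_Hankel_eigenvalue_bound:
  assumes ev: "eigenvalue_sequence (Q_Hankel \<alpha> c) ev" and c: "c > 4 * real n + 2 * \<alpha> + 2"
  shows "ev n \<ge> 1 - 4 * tail_const n c"
proof (cases "4 * tail_const n c < 1")
  case False
  have "ev n \<ge> 0"
    by (rule eigenvalue_nonneg[OF Q_Hankel_eq_T _ ev]) (use c_pos in auto)
  then show ?thesis using False by simp
next
  case True
  let ?\<kappa> = "tail_const n c"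
  let ?P = "\<lambda>a t. indicator {..c/2} t * Laguerre_comb n a t"
  have small: "?\<kappa> \<le> 1/4" using True by simp
  have pos: "(LINT t|W. (?P a t)\<^sup>2) > 0" if "i \<le> n" "a i \<noteq> 0" for a i
  proof -
    have "(1 - ?\<kappa>) * (\<Sum>k\<le>n. (a k)\<^sup>2 * Laguerre_fun_sqnorm k) > 0"
      using Laguerre_fun_sqnorm_sum_pos[of i n a] that small by (intro mult_pos_pos) auto
    then show ?thesis using concentration(2)[OF c small, of a] by linarith
  qed
  show ?thesis
  proof (rule eigenvalue_lower_bound[OF Q_Hankel_eq_T c_pos ev, of _ n test_fun])
    show "0 < 1 - 4 * ?\<kappa>" using True by simp
    show "test_fun i \<in> sq_integrable unit_meas" for i
    proof -
      have "test_fun i = test_comb i (\<lambda>k. if k = i then 1 else 0)"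
        by (auto simp: test_comb_def if_distrib[where f="\<lambda>z. z * _"] sum.delta cong: if_cong)
      then show ?thesis using integral_test_comb_square(2) by simp
    qed
    show "(LINT x|unit_meas. (\<Sum>i\<le>n. a i * test_fun i x)\<^sup>2) > 0" if "i \<le> n" "a i \<noteq> 0" for a i
      unfolding test_comb_def[symmetric] integral_test_comb_square
      using pos[of i a, OF that] subst_const_pos by (intro mult_pos_pos)
    fix a :: "nat \<Rightarrow> real"
    have "(1 - 4 * ?\<kappa>) * (LINT x|unit_meas. (test_comb n a x)\<^sup>2) \<le> c * (LINT x|unit_meas. (T (test_comb n a) x)\<^sup>2)"
    proof (cases "\<exists>i\<le>n. a i \<noteq> 0")
      case False
      then have "test_comb n a x = 0" for x unfolding test_comb_def by (intro sum.neutral) auto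
      then show ?thesis using c_pos by (simp add: sq_integral_nonneg)
    next
      case True
      then obtain i where i: "i \<le> n" "a i \<noteq> 0" by blast
      \<comment> \<open>The coefficients of U \<phi>. The truncation of U \<phi> is the natural
        vector to pair with T \<phi>: if nothing were lost beyond c/2, the two would be
        parallel.\<close>
      define d where "d = (\<lambda>k. (-1)^k * a k)"
      define A where "A = (LINT t|W. (?P a t)\<^sup>2)"
      define B where "B = (LINT t|W. (?P d t)\<^sup>2)"
      define X where "X = (LINT t|W. ?P d t * U (?P a) t)"
      define Y where "Y = (LINT x|unit_meas. (T (test_comb n a) x)\<^sup>2)"
      have B0: "B > 0" unfolding B_def by (rule pos[of i d, OF i(1)]) (use i in \<open>simp add: d_def\<close>)
      have AB: "(1 - 4 * ?\<kappa>) * A * B \<le> X\<^sup>2"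
        unfolding A_def B_def X_def d_def by (rule concentration(1)[OF c small])
      \<comment> \<open>Cauchy-Schwarz bounds the norm of T \<phi> from below by its pairing with
        the truncated U \<phi>. Cancelling \<open>subst_const\<close> and \<open>B > 0\<close> then
        gives the claim, and the zero combination was split off to have B > 0.\<close>
      have "(subst_const / sqrt c * X)\<^sup>2 \<le> Y * (subst_const * B)"
        using Cauchy_Schwarz_integral[OF sq_integrable_T[OF integral_test_comb_square(2)[of n a]] integral_test_comb_square(2)[of n d]]
        unfolding integral_T_test_comb integral_test_comb_square(1) X_def Y_def B_def .
      then have "subst_const * (subst_const * X\<^sup>2) \<le> subst_const * (c * Y * B)"
        using c_pos by (simp add: power_mult_distrib power_divide power2_eq_square[of subst_const] pos_divide_le_eq mult_ac)
      then have "subst_const * X\<^sup>2 \<le> c * Y * B" using subst_const_pos by (rule mult_left_le_imp_le)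
      moreover have "subst_const * ((1 - 4 * ?\<kappa>) * A * B) \<le> subst_const * X\<^sup>2" using AB subst_const_pos by (intro mult_left_mono) auto
      ultimately have "((1 - 4 * ?\<kappa>) * (subst_const * A)) * B \<le> (c * Y) * B" by (simp add: mult_ac)
      then have "(1 - 4 * ?\<kappa>) * (subst_const * A) \<le> c * Y" using B0 by (rule mult_right_le_imp_le)
      then show ?thesis unfolding integral_test_comb_square(1) A_def Y_def .
    qed
    then show "(1 - 4 * ?\<kappa>) * (LINT x|unit_meas. (\<Sum>i\<le>n. a i * test_fun i x)\<^sup>2)
      \<le> c * (LINT x|unit_meas. (T (\<lambda>x. \<Sum>i\<le>n. a i * test_fun i x) x)\<^sup>2)"
      unfolding test_comb_def[abs_def] .
  qed auto
qed

end

theorem theorem1: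
  fixes \<alpha> c :: real and n :: nat and ev :: "nat \<Rightarrow> real"
  assumes "\<alpha> \<ge> - 1/2"
    and "eigenvalue_sequence (Q_Hankel \<alpha> c) ev"
    and "c > C_Hankel \<alpha>"
    and "real n < (c - C_Hankel \<alpha>) / 4"
  shows "ev n \<ge> 1 - (20/3) * c powr \<alpha> * (c ^ (2 * n) / fact n) * exp (- c)"
proof -
  have C: "C_Hankel \<alpha> \<ge> 2 * \<alpha> + 2" by (simp add: C_Hankel_def)
  interpret hankel \<alpha> c
    by unfold_locales (use assms C in auto)
  have "c > 4 * real n + 2 * \<alpha> + 2" using assms(4) C by simp
  then have "ev n \<ge> 1 - 4 * tail_const n c" by (rule Q_Hankel_eigenvalue_bound[OF assms(2)])
  then show ?thesis by (simp add: tail_const_def)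
qed

end
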